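(* The sequences $(a_n)_{n\ge0}$, $(v_n)_{n\ge0}$, $(d_n)_{n\ge0}$ defined in the context satisfy, for all $n\ge0$, the following recurrences with polynomial coefficients. (1) $\sum_{i=0}^3p_i(n)a_{n+i}=0$, where $$\begin{aligned}p_0(n)&=-84-136n-81n^2-21n^3-2n^4,\\ p_1(n)&=399+730n+484n^2+137n^3+14n^4,\\ p_2(n)&=-474-835n-529n^2-143n^3-14n^4,\\ p_3(n)&=54+99n+66n^2+19n^3+2n^4.\end{aligned}$$ (2) $\sum_{i=0}^3q_i(n)v_{n+i}=0$, where $$\begin{aligned}q_0(n)&=-252-303n-136n^2-27n^3-2n^4,\\ q_1(n)&=960+1384n+730n^2+167n^3+14n^4,\\ q_2(n)&=-1008-1436n-748n^2-169n^3-14n^4,\\ q_3(n)&=90+141n+82n^2+21n^3+2n^4.\end{aligned}$$ (3) $\sum_{i=0}^7r_i(n)d_{n+i}=0$, where $[r_0(n),\dots,r_7(n)]^T=M[1,n,n^2,\dots,n^7]^T$ and $$M=\left[\begin{smallmatrix} -\frac{1630207404}{1529} & -\frac{3176073675}{3058} & -\frac{660587685}{1529} & -\frac{1216898711}{12232} & -\frac{167529251}{12232} & -\frac{626799}{556} & -\frac{7141}{139} & -1\\ \frac{18219511026}{1529} & \frac{6798395835}{556} & \frac{16328931207}{3058} & \frac{15735207287}{12232} & \frac{2258693435}{12232} & \frac{8782801}{556} & \frac{103675}{139} & 15\\ -\frac{80949464718}{1529} & -\frac{338705850511}{6116} & -\frac{150907466733}{6116} & -\frac{74228837833}{12232} &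 -\frac{10882115811}{12232} & -\frac{43223443}{556} & -\frac{521157}{139} & -77\\ \frac{347623458975}{3058} & \frac{32991350565}{278} & \frac{322759355227}{6116} & \frac{158457515673}{12232} & \frac{23184921987}{12232} & \frac{91902509}{556} & \frac{1105723}{139} & 163\\ -\frac{368052969807}{3058} & -\frac{190572156372}{1529} & -\frac{168114763631}{3058} & -\frac{163720428321}{12232} & -\frac{23758375953}{12232} & -\frac{93404429}{556} & -\frac{1114663}{139} & -163\\ \frac{177327816597}{3058} & \frac{366011927673}{6116} & \frac{40230202855}{1529} & \frac{78121412337}{12232} & \frac{11304865929}{12232} & \frac{44328883}{556} & \frac{527737}{139} & 77\\ -\frac{29809040325}{3058} & -\frac{62775138251}{6116} & -\frac{28175845633}{6116} & -\frac{13970430847}{12232} & -\frac{2065443305}{12232} & -\frac{8275441}{556} & -\frac{100655}{139} & -15\\ \frac{818331696}{1529} & \frac{880217988}{1529} & \frac{1617383067}{6116} & \frac{822460415}{12232} & \frac{124982969}{12232} & \frac{515919}{556} & \frac{6481}{139} & 1 \end{smallmatrix}\right].$$ Moreover, up to multiplication by a nonzero constant, these are the only P-recurrences of the corresponding order $r$ and degree $d$ satisfied by the three sequences, namely $(r,d)=(3,4)$ for $(a_n)$, $(3,4)$ for $(v_n)$ and $(7,7)$ for $(d_n)$.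
   Context: A P-recurrence of order $r$ and degree $d$ for a sequence $(s_n)_{n\ge0}$ is a relation $\sum_{i=0}^r c_i(n)s_{n+i}=0$ for all $n\ge0$, with polynomials $c_i$ of degree at most $d$, not all zero. Let $\mathbf x(u,v,r)=((\sqrt2+r\sin v)\cos u,(\sqrt2+r\sin v)\sin u,r\cos v)$ and $Q(z;\mathbf x)=1+2\mathbf x_1z+\|\mathbf x\|^2z^2$. For complex $z$ with $|z|<\sqrt2-1$ define the holomorphic functions $$A(z)=\int_0^{2\pi}\!\!\int_0^{2\pi}Q(z;\mathbf x(u,v,1))^{-2}(\sqrt2+\sin v)\,du\,dv,\qquad V(z)=\int_0^1\!\!\int_0^{2\pi}\!\!\int_0^{2\pi}Q(z;\mathbf x(u,v,r))^{-3}\,r(\sqrt2+r\sin v)\,du\,dv\,dr.$$ For real $z=a\in[0,\sqrt2-1)$ these are the area and enclosed volume of the image of the torus $T_{\sqrt2}=\{\mathbf x(u,v,1)\}$ under $\mathbf{x}\mapsto i(i(\mathbf x)+(a,0,0))$, where $i(\mathbf x)=\mathbf x/\|\mathbf x\|^2$. Both functions are even. The numbers $a_n,v_n$ are defined by $\frac{1}{\sqrt2\pi^2}A(z)=\sum_{n\ge0}a_nz^{2n}$ and $\frac{1}{\sqrt2\pi^2}V(z)=\sum_{n\ge0}v_nz^{2n}$; they are rational, with $a_0=4,a_1=52,a_2=477$ and $v_0=2,v_1=48,v_2=\frac{1269}{2}$. The sequence $(d_n)$ is defined by $$\sum_{n\ge0}d_nz^n=2\bar V'(z)\bar A(z)-3\bar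 V(z)\bar A'(z),\qquad \bar A(z)=\sum_n a_nz^n,\quad \bar V(z)=\sum_n v_nz^n,$$ so that $d_0=72$, $d_1=1932$, $d_2=31248$. *)

theory Defs
  imports "HOL-Complex_Analysis.Complex_Analysis"
begin

(* The order r need not be exact: only "not all coefficients zero" is required, not c r \<noteq> 0.
   Values c i with i > r are irrelevant. *)
definition P_recurrence ::
  "nat \<Rightarrow> nat \<Rightarrow> (nat \<Rightarrow> 'a::comm_ring_1 poly) \<Rightarrow> (nat \<Rightarrow> 'a) \<Rightarrow> bool" where
  "P_recurrence r d c s \<longleftrightarrow>
     (\<forall>i\<le>r. degree (c i) \<le> d) \<and> (\<exists>i\<le>r. c i \<noteq> 0) \<and>
     (\<forall>n. (\<Sum>i\<le>r. poly (c i) (of_nat n) * s (n + i)) = 0)"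

definition torus_pt :: "real \<Rightarrow> real \<Rightarrow> real \<Rightarrow> real ^ 3" where
  "torus_pt u v r =
     vector [(sqrt 2 + r * sin v) * cos u, (sqrt 2 + r * sin v) * sin u, r * cos v]"

definition Q :: "complex \<Rightarrow> real ^ 3 \<Rightarrow> complex" where
  "Q z x = 1 + 2 * of_real (x $ 1) * z + of_real ((norm x)\<^sup>2) * z\<^sup>2"

(* A and V are total functions here; only their values on norm z < sqrt 2 - 1, where Q does not
   vanish on the solid torus, are meaningful. *)
definition A :: "complex \<Rightarrow> complex" where
  "A z = integral {0..2 * pi} (\<lambda>v. integral {0..2 * pi} (\<lambda>u.
     of_real (sqrt 2 + sin v) / (Q z (torus_pt u v 1))\<^sup>2))"

definition V :: "complex \<Rightarrow> complex" where
  "V z = integral {0..1} (\<lambda>r. integral {0..2 * pi} (\<lambda>v. integral {0..2 * pi} (\<lambda>u.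
     of_real (r * (sqrt 2 + r * sin v)) / (Q z (torus_pt u v r)) ^ 3)))"

(* A and V are even, so the coefficient of z^(2n) is the n-th coefficient in powers of z^2. *)
definition a_seq :: "nat \<Rightarrow> complex" where
  "a_seq n = fps_nth (fps_expansion (\<lambda>z. A z / of_real (sqrt 2 * pi\<^sup>2)) 0) (2 * n)"

definition v_seq :: "nat \<Rightarrow> complex" where
  "v_seq n = fps_nth (fps_expansion (\<lambda>z. V z / of_real (sqrt 2 * pi\<^sup>2)) 0) (2 * n)"

definition A_bar :: "complex fps" where "A_bar = Abs_fps a_seq"

definition V_bar :: "complex fps" where "V_bar = Abs_fps v_seq"

definition d_seq :: "nat \<Rightarrow> complex" where
  "d_seq n = fps_nth (2 * fps_deriv V_bar * A_bar - 3 * V_bar * fps_deriv A_bar) n"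

(* In [:c0, c1, ...:] the constant term comes first. *)
definition p_coeffs :: "complex poly list" where
  "p_coeffs =
  [[:-84, -136, -81, -21, -2:],
   [:399, 730, 484, 137, 14:],
   [:-474, -835, -529, -143, -14:],
   [:54, 99, 66, 19, 2:]]"

definition q_coeffs :: "complex poly list" where
  "q_coeffs =
  [[:-252, -303, -136, -27, -2:],
   [:960, 1384, 730, 167, 14:],
   [:-1008, -1436, -748, -169, -14:],
   [:90, 141, 82, 21, 2:]]"

definition r_coeffs :: "complex poly list" where
  "r_coeffs =
  [[:-1630207404/1529, -3176073675/3058, -660587685/1529, -1216898711/12232, -167529251/12232, -626799/556, -7141/139, -1:],
   [:18219511026/1529, 6798395835/556, 16328931207/3058, 15735207287/12232, 2258693435/12232, 8782801/556, 103675/139, 15:],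
   [:-80949464718/1529, -338705850511/6116, -150907466733/6116, -74228837833/12232, -10882115811/12232, -43223443/556, -521157/139, -77:],
   [:347623458975/3058, 32991350565/278, 322759355227/6116, 158457515673/12232, 23184921987/12232, 91902509/556, 1105723/139, 163:],
   [:-368052969807/3058, -190572156372/1529, -168114763631/3058, -163720428321/12232, -23758375953/12232, -93404429/556, -1114663/139, -163:],
   [:177327816597/3058, 366011927673/6116, 40230202855/1529, 78121412337/12232, 11304865929/12232, 44328883/556, 527737/139, 77:],
   [:-29809040325/3058, -62775138251/6116, -28175845633/6116, -13970430847/12232, -2065443305/12232, -8275441/556, -100655/139, -15:],
   [:818331696/1529, 880217988/1529, 1617383067/6116, 822460415/12232, 124982969/12232, 515919/556, 6481/139, 1:]]"

end

theory Submission
  imports Defs "HOL-Number_Theory.Cong" "HOL-Library.More_List"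
begin

text \<open>
  Let \<open>\<rho> = \<surd>2 + sin v\<close>. The conformal angle \<open>\<phi>\<close> with \<open>d\<phi> =
      dv / \<rho>\<close> makes \<open>Q\<close> on the Clifford torus equal to \<open>\<rho>\<close> times
  \<open>E = \<surd>2 (1 + z\<^sup>2) + 2 z cos u - (1 - z\<^sup>2) sin \<phi>\<close>, so the area is the
      integral of \<open>1 / E\<^sup>2\<close> over \<open>(u, \<phi>)\<close>. The divergence
  theorem, applied to \<open>(x - x\<^sub>0) / |x - x\<^sub>0|\<^sup>6\<close> with \<open>x\<^sub>0 = (- 1 /
      z, 0, 0)\<close>, turns the volume into a similar integral with
  \<open>E\<^sup>3\<close> in the denominator. Exact trigonometric forms (creative telescoping) show that the
      area satisfies a
  differential equation of order two and that the volume is a combination of the area and its derivative with rational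
  coefficients. Hence the three generating functions lie in modules of rank 2, 2 and 3 over the rational
      functions, and
  each recurrence becomes an identity between integer polynomials. Uniqueness is a rank computation modulo a prime at
  which all sequence elements involved are integral.
\<close>

text \<open>All decisive checks are evaluations on integer lists, so the encodings avoid fractions:
  polynomials are coefficient lists, denominators are carried as explicit factors, residues replace
  rational numbers. Read coefficientwise, the differential equation \<open>A_bar_ode\<close> is a
  recurrence of order 5 and degree 2. The claimed recurrences trade order for degree and correspond
  to operators of higher order in \<open>theta\<close>. Hence a membership test
  (\<open>annihilated\<close>): every power of \<open>theta\<close> applied to the series is reduced
  to the module basis, and the weighted sum must vanish. For uniqueness, a competitor has (r + 1)(d
  + 1) unknown complex coefficients. Subtracting a multiple of the known recurrence removes one of
  them, and the first T = (r + 1)(d + 1) - 1 instances (19, 19 and 63) then form a square system. If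
  its pivots are units modulo p, they are nonzero over the complex numbers, and modulo p no numbers
  grow. The residues of the sequence come from running the already proved recurrence modulo p, which
  is why its leading coefficient must be invertible there.\<close>

section \<open>Uniqueness of recurrences by elimination modulo a prime\<close>

text \<open>\<open>x\<close> lies in the localization of the integers at \<open>p\<close> and has residue
    \<open>e\<close>.\<close>

definition local_res :: "int \<Rightarrow> complex \<Rightarrow> int \<Rightarrow> bool" where
  "local_res p x e \<longleftrightarrow> (\<exists>K D. coprime K p \<and> of_int K * x = of_int D \<and> [D =
      K * e] (mod p))"

lemma local_res_of_int: "local_res p (of_int n) n"
  unfolding local_res_def by (intro exI[of _ 1] exI[of _ n]) auto

lemma local_res_cong:
  assumes "local_res p x e" "[e = f] (mod p)"
  shows "local_res p x f"
proof -
  from assms(1) obtain K D where *: "coprime K p" "of_int K * x = of_int D" "[D = K * e] (mod p)"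
    unfolding local_res_def by blast
  have "[D = K * f] (mod p)"
    using *(3) cong_scalar_left[OF assms(2), of K] by (rule cong_trans)
  with * show ?thesis unfolding local_res_def by blast
qed

lemma local_res_mod: "local_res p x e \<Longrightarrow> local_res p x (e mod p)"
  by (erule local_res_cong) (simp add: cong_def)

lemma local_res_add:
  assumes "local_res p x e" "local_res p y f"
  shows "local_res p (x + y) (e + f)"
proof -
  from assms obtain K D L G where *: "coprime K p" "of_int K * x = of_int D" "[D = K * e] (mod p)"
    "coprime L p" "of_int L * y = of_int G" "[G = L * f] (mod p)"
    unfolding local_res_def by blast
  have "of_int (K * L) * (x + y) = of_int L * (of_int K * x) + of_int K * (of_int L * y)"
    by (simp add: algebra_simps)
  also have "\<dots> = of_int (L * D + K * G)" using * by simp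
  finally have 1: "of_int (K * L) * (x + y) = of_int (L * D + K * G)" .
  have "[L * D + K * G = L * (K * e) + K * (L * f)] (mod p)"
    by (intro cong_add cong_scalar_left *)
  then have "[L * D + K * G = (K * L) * (e + f)] (mod p)" by (simp add: algebra_simps)
  with 1 * show ?thesis unfolding local_res_def
    by (intro exI[of _ "K * L"] exI[of _ "L * D + K * G"]) auto
qed

lemma local_res_mult:
  assumes "local_res p x e" "local_res p y f"
  shows "local_res p (x * y) (e * f)"
proof -
  from assms obtain K D L G where *: "coprime K p" "of_int K * x = of_int D" "[D = K * e] (mod p)"
    "coprime L p" "of_int L * y = of_int G" "[G = L * f] (mod p)"
    unfolding local_res_def by blast
  have "of_int (K * L) * (x * y) = (of_int K * x) * (of_int L * y)"
    by (simp add: algebra_simps)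
  also have "\<dots> = of_int (D * G)" using * by simp
  finally have 1: "of_int (K * L) * (x * y) = of_int (D * G)" .
  have "[D * G = (K * e) * (L * f)] (mod p)"
    by (intro cong_mult *)
  then have "[D * G = (K * L) * (e * f)] (mod p)" by (simp add: algebra_simps)
  with 1 * show ?thesis unfolding local_res_def
    by (intro exI[of _ "K * L"] exI[of _ "D * G"]) auto
qed

text \<open>The residue of \<open>c\<close> being a unit makes its numerator \<open>D\<close>
  coprime to \<open>p\<close>, so that \<open>D * L\<close> is an admissible denominator of the
  quotient \<open>x = y / c\<close>.\<close>

lemma local_res_div:
  assumes "local_res p c e" "local_res p y f" "c * x = y" "[u * e = 1] (mod p)"
  shows "local_res p x (u * f)"
proof -
  from assms obtain K D L G where *: "coprime K p" "of_int K * c = of_int D" "[D = K * e] (mod p)"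
    "coprime L p" "of_int L * y = of_int G" "[G = L * f] (mod p)"
    unfolding local_res_def by blast
  have "coprime e p" using assms(4)
    by (metis cong_imp_coprime cong_sym coprime_1_left coprime_mult_left_iff)
  then have "coprime D p" using * by (meson cong_imp_coprime cong_sym coprime_mult_left_iff)
  have "of_int (D * L) * x = of_int K * (of_int L * (c * x))"
    using *(2) by (simp add: algebra_simps flip: *(2))
  also have "\<dots> = of_int (K * G)" using *(5) assms(3) by simp
  finally have 1: "of_int (D * L) * x = of_int (K * G)" .
  have "[K * G = K * (L * f)] (mod p)" by (intro cong_scalar_left *)
  also have "[K * (L * f) = (u * e) * (K * (L * f))] (mod p)"
    using cong_scalar_right[OF assms(4), of "K * (L * f)"] by (simp add: cong_sym)
  also have "(u * e) * (K * (L * f)) = (K * e) * (L * (u * f))" by simp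
  also have "[(K * e) * (L * (u * f)) = D * (L * (u * f))] (mod p)"
    by (intro cong_scalar_right cong_sym[OF *(3)])
  finally have "[K * G = (D * L) * (u * f)] (mod p)" by (simp add: algebra_simps)
  with 1 \<open>coprime D p\<close> *(4) show ?thesis unfolding local_res_def
    by (intro exI[of _ "D * L"] exI[of _ "K * G"]) auto
qed

text \<open>The bridge from pivots modulo \<open>p\<close> to pivots over the complex
  numbers.\<close>

lemma local_res_nonzero:
  assumes "local_res p x e" "[u * e = 1] (mod p)" "\<bar>p\<bar> \<noteq> 1"
  shows "x \<noteq> 0"
proof
  assume "x = 0"
  with assms(1) obtain K where K: "coprime K p" "[0 = K * e] (mod p)"
    unfolding local_res_def by auto
  have "p dvd K * e" using cong_sym[OF K(2)] by (simp add: cong_0_iff)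
  then have "p dvd e" using K(1) by (simp add: coprime_commute coprime_dvd_mult_right_iff)
  then have "p dvd 1" using assms(2) by (metis cong_dvd_iff dvd_mult)
  with assms(3) show False by simp
qed

fun dot :: "'a::comm_ring_1 list \<Rightarrow> 'a list \<Rightarrow> 'a" where
  "dot (a # as) (b # bs) = a * b + dot as bs"
| "dot _ _ = 0"

fun axpy :: "int \<Rightarrow> int \<Rightarrow> int list \<Rightarrow> int list \<Rightarrow> int list" where
  "axpy p k (s # ss) (t # ts) = (s + k * t) mod p # axpy p k ss ts"
| "axpy p k _ _ = []"

primrec powmod :: "int \<Rightarrow> int \<Rightarrow> nat \<Rightarrow> int" where
  "powmod p h 0 = 1"
| "powmod p h (Suc k) = h * powmod p h k mod p"

text \<open>Fermat's candidate \<open>h ^ (p - 2)\<close> for the inverse. That it is one is tested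
  at every use, by \<open>units\<close> and by \<open>only_trivial\<close>.\<close>

definition invmod :: "int \<Rightarrow> int \<Rightarrow> int" where
  "invmod p h = powmod p (h mod p) (nat (p - 2))"

lemma axpy_local_res:
  assumes "list_all2 (local_res p) b s" "list_all2 (local_res p) c t" "local_res p k l"
    "length s = length t"
  shows "list_all2 (local_res p) (map2 (\<lambda>x y. x + k * y) b c) (axpy p l s t)"
  using assms(4,1,2)
proof (induction s t arbitrary: b c rule: list_induct2)
  case (Cons x xs y ys)
  then obtain x' b' y' c' where "b = x' # b'" "c = y' # c'"
    by (metis list_all2_Cons2)
  with Cons assms(3) show ?case
    by (auto intro!: local_res_mod local_res_add local_res_mult)
qed auto

section \<open>Residues of a sequence generated by its recurrence\<close>

primrec horner :: "int list \<Rightarrow> int \<Rightarrow> int" where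
  "horner [] x = 0"
| "horner (a # as) x = a + x * horner as x"

primrec horner_mod :: "int \<Rightarrow> int list \<Rightarrow> int \<Rightarrow> int" where
  "horner_mod p [] x = 0"
| "horner_mod p (a # as) x = (a + x * horner_mod p as x) mod p"

lemma horner_mod: "horner_mod p l x = horner l x mod p"
  by (induction l) (simp, simp, metis mod_add_right_eq mod_mult_right_eq)

lemma dot_local_res:
  assumes "list_all2 (local_res p) b s" "list_all2 (local_res p) c t"
  shows "local_res p (dot b c) (dot s t)"
  using assms
proof (induction s t arbitrary: b c rule: dot.induct)
  case (1 x xs y ys)
  then show ?case
    by (auto simp: list_all2_Cons2 intro!: local_res_add local_res_mult)
next
  case ("2_1" t)
  then show ?case using local_res_of_int[of p 0] by auto
next
  case ("2_2" s)
  then show ?case using local_res_of_int[of p 0] by (cases b) auto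
qed

definition next_res :: "int \<Rightarrow> int list list \<Rightarrow> int list \<Rightarrow> int \<Rightarrow>
    int list \<Rightarrow> int" where
  "next_res p cs l n w = invmod p (horner_mod p l n) * - dot (map (\<lambda>c. horner_mod p c n) cs) w mod p"

text \<open>The window \<open>w\<close> holds r consecutive residues starting at index
  \<open>n\<close>; each step emits its head and appends the next term. The final window is the tail
  of the output, so r + k residues result.\<close>

primrec residues :: "int \<Rightarrow> int list list \<Rightarrow> int list \<Rightarrow> int \<Rightarrow> nat
    \<Rightarrow> int list \<Rightarrow> int list" where
  "residues p cs l n 0 w = w"
| "residues p cs l n (Suc k) w = hd w # residues p cs l (n + 1) k (tl w @ [next_res p cs l n w])"

primrec units :: "int \<Rightarrow> int list \<Rightarrow> int \<Rightarrow> nat \<Rightarrow> bool" where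
  "units p l n 0 \<longleftrightarrow> True"
| "units p l n (Suc k) \<longleftrightarrow> invmod p (horner_mod p l n) * horner_mod p l n mod p = 1 \<and>
    units p l (n + 1) k"

lemma residues_correct:
  fixes s :: "nat \<Rightarrow> complex"
  assumes rec: "\<And>n. dot (map (\<lambda>c. of_int (horner c (int n))) cs) (map s [n..<n + length cs]) +
      of_int (horner l (int n)) * s (n + length cs) = 0"
    and "units p l (int n) k" "p > 1" "cs \<noteq> []"
    and "list_all2 (local_res p) (map s [n..<n + length cs]) w"
  shows "list_all2 (local_res p) (map s [n..<n + length cs + k]) (residues p cs l (int n) k w)"
  using assms(2,5)
proof (induction k arbitrary: n w)
  case (Suc k)
  let ?r = "length cs"
  define h where "h = horner_mod p l (int n)"
  obtain r where r: "?r = Suc r" using \<open>cs \<noteq> []\<close> by (cases cs) auto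
  have upt: "[n..<n + ?r] = n # [Suc n..<n + ?r]" using r by (simp add: upt_conv_Cons)
  then obtain x w' where w: "w = x # w'" "local_res p (s n) x"
    "list_all2 (local_res p) (map s [Suc n..<n + ?r]) w'"
    using Suc.prems(2) by (auto simp: list_all2_Cons1)
  have u: "[invmod p h * h = 1] (mod p)"
    using Suc.prems(1) \<open>p > 1\<close> by (auto simp: h_def cong_def mod_pos_pos_trivial)
  have "local_res p (s (n + ?r)) (next_res p cs l (int n) w)"
    unfolding next_res_def h_def[symmetric]
  proof (rule local_res_mod, rule local_res_div)
    show "local_res p (of_int (horner l (int n))) h"
      unfolding h_def horner_mod by (intro local_res_mod local_res_of_int)
    have "list_all2 (local_res p) (map (\<lambda>c. of_int (horner c (int n))) cs) (map (\<lambda>c. horner_mod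
        p c (int n)) cs)"
      by (simp add: list_all2_map1 list_all2_map2 list.rel_refl local_res_of_int local_res_mod horner_mod)
    from local_res_mult[OF local_res_of_int[of p "-1"] dot_local_res[OF this Suc.prems(2)]]
    show "local_res p (- dot (map (\<lambda>c. of_int (horner c (int n))) cs) (map s [n..<n + ?r]))
       (- dot (map (\<lambda>c. horner_mod p c (int n)) cs) w)" by simp
    show "of_int (horner l (int n)) * s (n + ?r) =
        - dot (map (\<lambda>c. of_int (horner c (int n))) cs) (map s [n..<n + ?r])"
      using rec[of n] by (simp add: eq_neg_iff_add_eq_0 add.commute)
  qed (use u in simp)
  then have "list_all2 (local_res p) (map s ([Suc n..<n + ?r] @ [n + ?r])) (w' @ [next_res p cs l (int n) w])"
    using w by (simp add: list_all2_appendI)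
  also have "[Suc n..<n + ?r] @ [n + ?r] = [Suc n..<Suc n + ?r]" using r by simp
  finally have "list_all2 (local_res p) (map s [Suc n..<Suc n + ?r + k])
       (residues p cs l (int (Suc n)) k (w' @ [next_res p cs l (int n) w]))"
    using Suc.prems(1) by (intro Suc.IH) (simp_all add: add.commute)
  moreover have "[n..<n + ?r + Suc k] = n # [Suc n..<Suc n + ?r + k]" by (subst upt_conv_Cons) auto
  ultimately show ?case using w by (simp add: add.commute)
qed auto

section \<open>Linear systems whose unknowns are polynomials of bounded degree\<close>

primrec scale_up :: "int \<Rightarrow> int \<Rightarrow> int list \<Rightarrow> int list" where
  "scale_up p i [] = []"
| "scale_up p i (x # xs) = i * x mod p # scale_up p (i + 1) xs"

text \<open>
  A state \<open>(D\<^sub>i, x\<^sub>i)\<^sub>i\<close> stands for the linear system \<open>\<Sum>i.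
      q\<^sub>i(n) f\<^sub>i(n) = 0\<close> in polynomials \<open>q\<^sub>i\<close> with fewer than
      \<open>D\<^sub>i\<close>
  coefficients, where \<open>x\<^sub>i\<close> lists the residues of \<open>f\<^sub>i\<close>. If
      \<open>f\<^sub>0(n)\<close> is a unit and \<open>D\<^sub>0\<close> is maximal, the equation at
      \<open>n\<close> says
  that \<open>q\<^sub>0 + (\<Sum>i>0. q\<^sub>i f\<^sub>i(n) / f\<^sub>0(n))\<close> is divisible by \<open>X -
      n\<close>; the quotient replaces \<open>q\<^sub>0\<close> and moves to the end.
\<close>

fun only_trivial :: "int \<Rightarrow> nat \<Rightarrow> (nat \<times> int list) list \<Rightarrow> bool" where
  "only_trivial p 0 st \<longleftrightarrow> list_all (\<lambda>(D, x). D = 0) st"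
| "only_trivial p (Suc T) ((D, h # hs) # st) \<longleftrightarrow>
     D > 0 \<and> invmod p h * h mod p = 1 \<and> list_all (\<lambda>(D', x). D' \<le> D) st \<and>
     only_trivial p T (map (\<lambda>(D', x). (D', axpy p (- invmod p h * hd x mod p) (tl x) hs)) st @
       [(D - 1, scale_up p 1 hs)])"
| "only_trivial p (Suc T) _ \<longleftrightarrow> False"

lemma scale_up_local_res:
  "list_all2 (local_res p) (map f [a..<b]) x \<Longrightarrow>
   list_all2 (local_res p) (map (\<lambda>n. of_int (i + int (n - a)) * f n) [a..<b]) (scale_up p i x)"
proof (induction x arbitrary: a i)
  case (Cons x xs)
  then have "a < b" by (cases "a < b") auto
  then have upt: "[a..<b] = a # [Suc a..<b]" by (simp add: upt_conv_Cons)
  have "list_all2 (local_res p) (map (\<lambda>n. of_int (i + 1 + int (n - Suc a)) * f n) [Suc a..<b])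
      (scale_up p (i + 1) xs)"
    using Cons.IH[of "Suc a" "i + 1"] Cons.prems by (simp add: upt)
  moreover have eq: "map (\<lambda>n. of_int (i + 1 + int (n - Suc a)) * f n) [Suc a..<b] =
      map (\<lambda>n. of_int (i + int (n - a)) * f n) [Suc a..<b]"
    by (simp add: of_nat_diff Suc_diff_Suc algebra_simps)
  ultimately have "list_all2 (local_res p) (map (\<lambda>n. of_int (i + int (n - a)) * f n) [Suc a..<b])
      (scale_up p (i + 1) xs)" by (simp only: eq)
  moreover have "local_res p (of_int (i + int (a - a)) * f a) (i * x mod p)"
    using Cons.prems by (intro local_res_mod local_res_mult) (auto simp: upt local_res_of_int)
  ultimately show ?case by (simp only: upt list.map list.rel_inject scale_up.simps)
qed simp

lemma coeff_bounded_iff: "(\<forall>i\<ge>D. coeff q i = 0) \<longleftrightarrow> q = 0 \<or> degree q < D"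
  by (metis coeff_0 coeff_eq_0 leading_coeff_0_iff linorder_not_less order_le_less_trans)

lemma coeff_dot_bounded:
  fixes q :: "complex poly list"
  assumes "list_all2 (\<lambda>q D. \<forall>i\<ge>D. coeff q i = 0) qs Ds" "\<forall>D\<in>set Ds. D \<le> E"
      "i \<ge> E"
  shows "coeff (dot (map (\<lambda>x. [:x:]) xs) qs) i = 0"
  using assms
proof (induction "map (\<lambda>x. [:x:]) xs" qs arbitrary: xs Ds rule: dot.induct)
  case (1 a as b bs)
  then show ?case by (auto simp: list_all2_Cons1)
qed auto

lemma dot_append: "length a = length c \<Longrightarrow> dot (a @ b) (c @ e) = dot a c + dot b e"
  by (induction a c rule: list_induct2) auto

lemma dot_map: "dot (map f is) (map g is) = (\<Sum>i\<leftarrow>is. f i * g i)"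
  by (induction "is") auto

lemma poly_dot: "poly (dot xs ys) z = dot (map (\<lambda>q. poly q z) xs) (map (\<lambda>q. poly q z) ys)"
  by (induction xs ys rule: dot.induct) auto

lemma dot_eliminate:
  "length qs = length fs \<Longrightarrow> dot (map f qs) (map (\<lambda>\<delta>. \<delta> n - g \<delta> * c) fs) =
     dot (map f qs) (map (\<lambda>\<delta>. \<delta> n) fs) - c * dot (map g fs) (map f qs)"
  by (induction qs fs rule: list_induct2) (auto simp: algebra_simps)

lemma dot_scale: "c * dot (map (\<lambda>x. f x / c) xs) ys = dot (map f xs) (ys :: 'a::field list)" if "c \<noteq> 0"
  using that by (induction "map f xs" ys arbitrary: xs rule: dot.induct) (auto simp: algebra_simps)

lemma dot_commute: "dot xs ys = dot ys xs"
  by (induction xs ys rule: dot.induct) (auto simp: mult.commute)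

text \<open>Induction on the number \<open>T\<close> of equations left, those at n = m, ..., m + T -
  1. The old first unknown is recovered from the quotient and the other unknowns, so triviality of
  the new system gives triviality of the old one.\<close>

lemma only_trivial_correct:
  fixes fs :: "(nat \<Rightarrow> complex) list"
  assumes "only_trivial p T st" "p > 1"
    and "list_all2 (\<lambda>\<delta> (D, x). list_all2 (local_res p) (map \<delta> [m..<m + T]) x) fs st"
    and "list_all2 (\<lambda>q D. \<forall>i\<ge>D. coeff q i = 0) qs (map fst st)"
    and "\<And>n. m \<le> n \<Longrightarrow> n < m + T \<Longrightarrow>
      dot (map (\<lambda>q. poly q (of_nat n)) qs) (map (\<lambda>\<delta>. \<delta> n) fs) = 0"
  shows "\<forall>q\<in>set qs. q = 0"
  using assms
proof (induction p T st arbitrary: m fs qs rule: only_trivial.induct)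
  case (1 p st m fs qs)
  have "\<forall>q\<in>set qs. q = 0" if "list_all2 (\<lambda>q D. \<forall>i\<ge>D. coeff q i = (0::complex))
      qs (map fst st)"
    "list_all (\<lambda>(D, x). D = (0::nat)) st" for qs and st :: "(nat \<times> int list) list"
    using that by (induction qs "map fst st" arbitrary: st rule: list_all2_induct)
      (auto simp: poly_eq_iff)
  with 1 show ?case by simp
next
  case (2 p T D h hs st m fs qs)
  define u where "u = invmod p h"
  note [simp] = upt_conv_Cons
  obtain \<delta> fs' where fs: "fs = \<delta> # fs'" and \<delta>: "local_res p (\<delta> m) h"
    "list_all2 (local_res p) (map \<delta> [Suc m..<Suc m + T]) hs"
    and fs': "list_all2 (\<lambda>\<delta> (D, x). list_all2 (local_res p) (map \<delta> [m..<m + Suc T]) x) fs' st"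
    using 2(4) by (auto simp: list_all2_Cons2 simp del: upt_Suc)
  obtain q qs' where qs: "qs = q # qs'" and q: "\<forall>i\<ge>D. coeff q i = 0"
    and qs': "list_all2 (\<lambda>q D. \<forall>i\<ge>D. coeff q i = 0) qs' (map fst st)"
    using 2(5) by (auto simp: list_all2_Cons2)
  have len: "length qs' = length fs'"
    using list_all2_lengthD[OF qs'] list_all2_lengthD[OF fs'] by simp
  have D: "D > 0" "\<forall>D'\<in>set (map fst st). D' \<le> D" using 2(2) by (auto simp: list_all_iff)
  have u: "[u * h = 1] (mod p)"
    using 2(2,3) by (auto simp: u_def cong_def mod_pos_pos_trivial)
  have nz: "\<delta> m \<noteq> 0" using local_res_nonzero[OF \<delta>(1) u] 2(3) by simp
  define \<rho> where "\<rho> f = f m / \<delta> m" for f :: "nat \<Rightarrow> complex"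
  \<comment> \<open>The equation at \<open>m\<close>, divided by the pivot
    \<open>\<delta> m\<close>, says exactly that \<open>Q\<close> vanishes at
    \<open>m\<close>.\<close>
  define Q where "Q = q + dot (map (\<lambda>x. [:x:]) (map \<rho> fs')) qs'"
  have poly_Q: "poly Q x = poly q x + dot (map \<rho> fs') (map (\<lambda>q. poly q x) qs')" for x
    by (simp add: Q_def poly_dot o_def)
  have "\<delta> m * poly Q (of_nat m) = 0"
    using 2(6)[of m] dot_scale[OF nz, of "\<lambda>f. f m" fs']
    by (simp add: poly_Q \<rho>_def[abs_def] fs qs ring_distribs dot_commute[of "map _ fs'"] mult.commute)
  then have "poly Q (of_nat m) = 0" using nz by simp
  then obtain Q' where Q': "Q = [:- of_nat m, 1:] * Q'" by (auto simp: poly_eq_0_iff_dvd)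
  \<comment> \<open>Maximality of \<open>D\<close> enters here: the added polynomials do not raise
    the bound, and splitting off the root \<open>m\<close> then lowers it by one.\<close>
  have "\<forall>i\<ge>D. coeff Q i = 0"
    using q coeff_dot_bounded[OF qs' D(2)] by (simp add: Q_def del: map_map)
  then have "\<forall>i\<ge>D - 1. coeff Q' i = 0"
    unfolding coeff_bounded_iff Q' using D(1)
    by (cases "Q' = 0") (auto simp: degree_mult_eq simp del: mult_pCons_left)
  \<comment> \<open>Substituting \<open>Q = (X - m) Q'\<close> into the equations at n > m replaces
    \<open>\<delta> n\<close> by \<open>(n - m) * \<delta> n\<close> and every other
    \<open>f n\<close> by \<open>f n - \<rho> f * \<delta> n\<close>. The weight n - m is written as
    1 + (n - Suc m) to match \<open>scale_up p 1\<close>.\<close>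
  define fs2 where "fs2 = map (\<lambda>f n. f n - \<rho> f * \<delta> n) fs' @ [\<lambda>n. of_int (1 + int (n
      - Suc m)) * \<delta> n]"
  define st2 where "st2 = map (\<lambda>(D', x). (D', axpy p (- u * hd x mod p) (tl x) hs)) st @
       [(D - 1, scale_up p 1 hs)]"
  have step: "list_all2 (local_res p) (map (\<lambda>n. f n - \<rho> f * \<delta> n) [Suc m..<Suc m + T])
        (axpy p (- u * hd x mod p) (tl x) hs)"
    if "list_all2 (local_res p) (map f [m..<m + Suc T]) x" for f x
  proof -
    from that obtain y ys where x: "x = y # ys" "local_res p (f m) y"
      "list_all2 (local_res p) (map f [Suc m..<Suc m + T]) ys"
      by (auto simp: list_all2_Cons1 simp del: upt_Suc)
    have "local_res p (\<rho> f) (u * y)"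
      by (rule local_res_div[OF \<delta>(1) x(2) _ u]) (simp add: \<rho>_def nz)
    from local_res_mod[OF local_res_mult[OF local_res_of_int[of p "-1"] this]]
    have "local_res p (- \<rho> f) (- u * hd x mod p)" by (simp add: x)
    moreover have "length ys = length hs"
      using list_all2_lengthD[OF x(3)] list_all2_lengthD[OF \<delta>(2)] by simp
    ultimately have "list_all2 (local_res p) (map2 (\<lambda>x y. x + - \<rho> f * y) (map f [Suc m..<Suc m + T])
        (map \<delta> [Suc m..<Suc m + T])) (axpy p (- u * hd x mod p) ys hs)"
      by (intro axpy_local_res x(3) \<delta>(2))
    then show ?thesis by (simp add: x map2_map_map)
  qed
  have "\<forall>q\<in>set (qs' @ [Q']). q = 0"
  proof (rule 2(1))
    show "p > 1" by fact
    show "only_trivial p T (map (\<lambda>(D', x). (D', axpy p (- invmod p h * hd x mod p) (tl x) hs)) st @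
       [(D - 1, scale_up p 1 hs)])" using 2(2) by simp
    have "list_all2 (\<lambda>\<delta> (D, x). list_all2 (local_res p) (map \<delta> [Suc m..<Suc m + T]) x) fs2 st2"
      unfolding fs2_def st2_def
    proof (rule list_all2_appendI)
      show "list_all2 (\<lambda>\<delta> (D, x). list_all2 (local_res p) (map \<delta> [Suc m..<Suc m + T]) x)
        (map (\<lambda>f n. f n - \<rho> f * \<delta> n) fs') (map (\<lambda>(D', x). (D', axpy p (- u * hd x
            mod p) (tl x) hs)) st)"
      proof (subst list_all2_map1, subst list_all2_map2, rule list_all2_mono[OF fs'])
        fix f y
        assume "case y of (D, x) \<Rightarrow> list_all2 (local_res p) (map f [m..<m + Suc T]) x"
        then show "case (case y of (D', x) \<Rightarrow> (D', axpy p (- u * hd x mod p) (tl x) hs)) of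
          (D, x) \<Rightarrow> list_all2 (local_res p) (map (\<lambda>n. f n - \<rho> f * \<delta> n) [Suc
              m..<Suc m + T]) x"
          by (cases y) (simp only: prod.case step)
      qed
      show "list_all2 (\<lambda>\<delta> (D, x). list_all2 (local_res p) (map \<delta> [Suc m..<Suc m + T]) x)
        [\<lambda>n. of_int (1 + int (n - Suc m)) * \<delta> n] [(D - 1, scale_up p 1 hs)]"
        using scale_up_local_res[OF \<delta>(2), of 1] by (simp del: upt_Suc)
    qed
    then show "list_all2 (\<lambda>\<delta> (D, x). list_all2 (local_res p) (map \<delta> [Suc m..<Suc m + T]) x) fs2
      (map (\<lambda>(D', x). (D', axpy p (- invmod p h * hd x mod p) (tl x) hs)) st @
       [(D - 1, scale_up p 1 hs)])" by (simp add: st2_def u_def)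
    have fst_eq: "map fst (map (\<lambda>(D', x). (D', axpy p (- invmod p h * hd x mod p) (tl x) hs)) st) = map
        fst st"
      by (auto simp: o_def case_prod_beta)
    then show "list_all2 (\<lambda>q D. \<forall>i\<ge>D. coeff q i = 0) (qs' @ [Q'])
      (map fst (map (\<lambda>(D', x). (D', axpy p (- invmod p h * hd x mod p) (tl x) hs)) st @
       [(D - 1, scale_up p 1 hs)]))"
      unfolding map_append fst_eq
      using qs' \<open>\<forall>i\<ge>D - 1. coeff Q' i = 0\<close> by (intro list_all2_appendI) simp_all
  next
    fix n assume n: "Suc m \<le> n" "n < Suc m + T"
    have idx: "(of_int (1 + int (n - Suc m)) :: complex) = of_nat n - of_nat m"
      using n by (simp add: of_nat_diff)
    then have "poly Q' (of_nat n) * (of_int (1 + int (n - Suc m)) * \<delta> n) = poly Q (of_nat n) * \<delta> n"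
      unfolding idx by (simp add: Q' algebra_simps)
    moreover have "dot (map (\<lambda>q. poly q (of_nat n)) qs') (map (\<lambda>f. f n - \<rho> f * \<delta> n) fs') =
        dot (map (\<lambda>q. poly q (of_nat n)) qs') (map (\<lambda>f. f n) fs') -
        \<delta> n * dot (map \<rho> fs') (map (\<lambda>q. poly q (of_nat n)) qs')"
      by (rule dot_eliminate) (rule len)
    ultimately have "dot (map (\<lambda>q. poly q (of_nat n)) (qs' @ [Q'])) (map (\<lambda>\<delta>. \<delta>
        n) fs2) =
        dot (map (\<lambda>q. poly q (of_nat n)) qs) (map (\<lambda>\<delta>. \<delta> n) fs)"
      unfolding fs2_def qs fs map_append
      by (subst dot_append) (simp_all add: len o_def poly_Q algebra_simps)
    also have "\<dots> = 0" using 2(6)[of n] n by simp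
    finally show "dot (map (\<lambda>q. poly q (of_nat n)) (qs' @ [Q'])) (map (\<lambda>\<delta>. \<delta> n)
        fs2) = 0" .
  qed
  then have "\<forall>q\<in>set qs'. q = 0" "Q = 0" by (auto simp: Q')
  moreover have "dot xs qs' = 0" if "\<forall>q\<in>set qs'. q = (0 :: complex poly)" for xs qs'
    using that by (induction xs qs' rule: dot.induct) auto
  ultimately show ?case by (auto simp: Q_def qs)
qed auto

text \<open>The unknown with index 0 comes last and has one coefficient fewer, its top one having
  been normalized away; thus the head has a maximal bound from the start. The bounds add up to r (d
  + 1) + d, the number \<open>T\<close> of equations used later.\<close>

definition initial_state :: "nat \<Rightarrow> nat \<Rightarrow> nat \<Rightarrow> int list \<Rightarrow> (nat
    \<times> int list) list" where
  "initial_state r d T S = map (\<lambda>i. (Suc d, take T (drop i S))) [1..<Suc r] @ [(d, take T S)]"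

text \<open>Matching the coefficient of n^d in \<open>c 0\<close> determines \<open>k\<close>; the
  difference \<open>e\<close> satisfies the same relation with one unknown fewer, and
  \<open>only_trivial\<close> forces it to vanish. Finally \<open>k\<close> is nonzero because some
  \<open>c i\<close> is.\<close>

lemma P_recurrence_unique:
  fixes s :: "nat \<Rightarrow> complex"
  assumes c0: "P_recurrence r d c0 s" "coeff (c0 0) d \<noteq> 0"
    and S: "list_all2 (local_res p) (map s [0..<r + T]) S"
    and d: "d > 0"
    and det: "only_trivial p T (initial_state r d T S)" and p: "p > 1"
    and c: "P_recurrence r d c s"
  shows "\<exists>k. k \<noteq> 0 \<and> (\<forall>i\<le>r. c i = smult k (c0 i))"
proof -
  define k where "k = coeff (c 0) d / coeff (c0 0) d"
  define e where "e i = c i - smult k (c0 i)" for i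
  have deg: "degree (e i) \<le> d" if "i \<le> r" for i
    using c c0 that unfolding e_def P_recurrence_def
    by (metis degree_diff_le degree_smult_le le_trans)
  have "coeff (e 0) d = 0" using c0(2) by (simp add: e_def k_def)
  then have deg0: "degree (e 0) < d" using deg[of 0] d
    by (metis bot_nat_0.extremum eq_zero_or_degree_less degree_0)
  have rec: "(\<Sum>i\<le>r. poly (e i) (of_nat n) * s (n + i)) = 0" for n
  proof -
    have "(\<Sum>i\<le>r. poly (e i) (of_nat n) * s (n + i)) =
      (\<Sum>i\<le>r. poly (c i) (of_nat n) * s (n + i)) - k * (\<Sum>i\<le>r. poly (c0 i) (of_nat n) * s (n + i))"
      by (simp add: e_def algebra_simps sum_subtractf sum_distrib_left)
    then show ?thesis using c c0 by (simp add: P_recurrence_def)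
  qed
  define fs where "fs = map (\<lambda>i n. s (n + i)) [1..<Suc r] @ [s]"
  define qs where "qs = map e [1..<Suc r] @ [e 0]"
  have win: "list_all2 (local_res p) (map (\<lambda>n. s (n + i)) [0..<0 + T]) (take T (drop i S))" if "i \<le>
      r" for i
  proof -
    have "take T (drop i (map s [0..<r + T])) = map (\<lambda>n. s (n + i)) [0..<0 + T]"
      using that by (intro nth_equalityI) (auto simp: add.commute)
    with list_all2_takeI[OF list_all2_dropI[OF S, of i], of T] show ?thesis by simp
  qed
  have "\<forall>q\<in>set qs. q = 0"
  proof (rule only_trivial_correct[OF det p])
    show "list_all2 (\<lambda>\<delta> (D, x). list_all2 (local_res p) (map \<delta> [0..<0 + T]) x) fs
        (initial_state r d T S)"
      unfolding fs_def initial_state_def using win win[of 0]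
      by (intro list_all2_appendI)
        (auto simp: list_all2_map1 list_all2_map2 intro!: list.rel_refl_strong simp del: upt_Suc)
    show "list_all2 (\<lambda>q D. \<forall>i\<ge>D. coeff q i = 0) qs (map fst (initial_state r d T S))"
    proof -
      have "coeff (e i) j = 0" if "i \<le> r" "Suc d \<le> j" for i j
        using deg[OF that(1)] that(2) by (intro coeff_eq_0) simp
      moreover have "coeff (e 0) j = 0" if "d \<le> j" for j
        using deg0 that by (intro coeff_eq_0) simp
      ultimately show ?thesis
        unfolding qs_def initial_state_def map_append
        by (intro list_all2_appendI)
          (auto simp: list_all2_map1 list_all2_map2 intro!: list.rel_refl_strong simp del: upt_Suc)
    qed
    fix n
    have "dot (map (\<lambda>q. poly q (of_nat n)) qs) (map (\<lambda>\<delta>. \<delta> n) fs) =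
       (\<Sum>i\<leftarrow>[1..<Suc r]. poly (e i) (of_nat n) * s (n + i)) + poly (e 0) (of_nat n) * s n"
      unfolding qs_def fs_def by (simp add: dot_append o_def dot_map del: upt_Suc)
    also have "\<dots> = (\<Sum>i\<le>r. poly (e i) (of_nat n) * s (n + i))"
      unfolding atMost_atLeast0 by (subst sum.atLeast_Suc_atMost)
        (simp_all add: interv_sum_list_conv_sum_set_nat atLeastLessThanSuc_atLeastAtMost del: upt_Suc)
    finally show "dot (map (\<lambda>q. poly q (of_nat n)) qs) (map (\<lambda>\<delta>. \<delta> n) fs) = 0"
        using rec by simp
  qed
  moreover have "e i \<in> set qs" if "i \<le> r" for i
    using that by (cases i) (auto simp: qs_def simp del: upt_Suc)
  ultimately have eq: "c i = smult k (c0 i)" if "i \<le> r" for i using that by (force simp: e_def)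
  moreover have "k \<noteq> 0"
    using c eq by (auto simp: P_recurrence_def)
  ultimately show ?thesis by blast
qed

section \<open>Theta operators acting on finite modules of power series\<close>

primrec fps_ints :: "int list \<Rightarrow> complex fps" where
  "fps_ints [] = 0"
| "fps_ints (a # as) = of_int a + fps_X * fps_ints as"

fun padd :: "int list \<Rightarrow> int list \<Rightarrow> int list" where
  "padd (a # as) (b # bs) = (a + b) # padd as bs"
| "padd [] bs = bs"
| "padd as [] = as"

primrec pmul :: "int list \<Rightarrow> int list \<Rightarrow> int list" where
  "pmul [] q = []"
| "pmul (a # as) q = padd (map ((*) a) q) (0 # pmul as q)"

text \<open>The offset \<open>k\<close> is the exponent belonging to the first entry, which the
  recursion increases; \<open>ptheta 0\<close> represents \<open>theta\<close>.\<close>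

primrec ptheta :: "int \<Rightarrow> int list \<Rightarrow> int list" where
  "ptheta k [] = []"
| "ptheta k (a # as) = k * a # ptheta (k + 1) as"

definition theta :: "complex fps \<Rightarrow> complex fps" where
  "theta f = fps_X * fps_deriv f"

lemma fps_ints_padd: "fps_ints (padd p q) = fps_ints p + fps_ints q"
  by (induction p q rule: padd.induct) (auto simp: algebra_simps)

lemma fps_ints_smult: "fps_ints (map ((*) a) q) = of_int a * fps_ints q"
  by (induction q) (auto simp: algebra_simps)

lemma fps_ints_pmul: "fps_ints (pmul p q) = fps_ints p * fps_ints q"
  by (induction p) (auto simp: algebra_simps fps_ints_padd fps_ints_smult)

lemma theta_of_int [simp]: "theta (of_int a) = 0"
  by (simp add: theta_def)

lemma theta_add: "theta (f + g) = theta f + theta g"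
  by (simp add: theta_def algebra_simps)

lemma theta_mult: "theta (f * g) = theta f * g + f * theta g"
  by (simp add: theta_def algebra_simps)

lemma fps_ints_ptheta_aux: "fps_ints (ptheta k l) = of_int k * fps_ints l + theta (fps_ints l)"
  by (induction l arbitrary: k) (auto simp: theta_add theta_mult algebra_simps, simp_all add: theta_def)

lemma fps_ints_ptheta: "fps_ints (ptheta 0 l) = theta (fps_ints l)"
  by (simp add: fps_ints_ptheta_aux)

lemma fps_ints_eq_0: "list_all (\<lambda>a. a = 0) l \<Longrightarrow> fps_ints l = 0"
  by (induction l) auto

fun vadd :: "int list list \<Rightarrow> int list list \<Rightarrow> int list list" where
  "vadd (p # ps) (q # qs) = padd p q # vadd ps qs"
| "vadd [] qs = qs"
| "vadd ps [] = ps"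

fun vecmat :: "int list list \<Rightarrow> int list list list \<Rightarrow> int list list" where
  "vecmat (g # gs) (c # cs) = vadd (map (pmul g) c) (vecmat gs cs)"
| "vecmat _ _ = []"

abbreviation vdot :: "int list list \<Rightarrow> complex fps list \<Rightarrow> complex fps" where
  "vdot g T \<equiv> dot (map fps_ints g) T"

lemma vdot_vadd: "vdot (vadd g h) T = vdot g T + vdot h T"
proof (induction g h arbitrary: T rule: vadd.induct)
  case (1 p ps q qs T)
  then show ?case by (cases T) (auto simp: fps_ints_padd algebra_simps)
qed auto

lemma vdot_pmul: "dot (map (fps_ints \<circ> pmul p) g) T = fps_ints p * vdot g T"
proof (induction "map fps_ints g" T arbitrary: g rule: dot.induct)
  case (1 a as b bs)
  then show ?case by (auto simp: fps_ints_pmul algebra_simps)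
qed auto

lemma vdot_vecmat:
  assumes "list_all2 (\<lambda>t c. D * theta t = vdot c T) U C"
  shows "vdot (vecmat g C) T = D * dot (map fps_ints g) (map theta U)"
  using assms
proof (induction g C arbitrary: U rule: vecmat.induct)
  case (1 g gs c cs)
  then show ?case by (auto simp: list_all2_Cons2 vdot_vadd vdot_pmul algebra_simps)
qed auto

lemma theta_vdot: "theta (vdot g T) = vdot (map (ptheta 0) g) T + dot (map fps_ints g) (map theta T)"
proof (induction "map fps_ints g" T arbitrary: g rule: dot.induct)
  case (1 a as b bs)
  then show ?case by (auto simp: theta_add theta_mult fps_ints_ptheta algebra_simps)
next
  case ("2_1" T)
  then show ?case by (simp add: theta_def)
next
  case ("2_2" g)
  then show ?case by (cases g) (simp_all add: theta_def)
qed

text \<open>One application of \<open>theta\<close> to a module element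
  \<open>g T / (\<delta>^k M)\<close>, by the quotient rule: the three summands differentiate the
  coordinates, the basis and the denominator.\<close>

definition vstep :: "int list \<Rightarrow> int list list list \<Rightarrow> int list \<Rightarrow> nat
    \<Rightarrow> int list list \<Rightarrow> int list list" where
  "vstep \<delta> C \<nu> k g = vadd (map (\<lambda>p. pmul \<delta> (ptheta 0 p)) g)
     (vadd (vecmat g C) (map (pmul (map ((*) (-1)) (padd (map ((*) (int k)) (ptheta 0 \<delta>)) \<nu>))) g))"

lemma vstep_correct:
  assumes T: "list_all2 (\<lambda>t c. fps_ints \<delta> * theta t = vdot c T) T C"
    and \<nu>: "fps_ints \<delta> * theta M = fps_ints \<nu> * M"
    and Y: "fps_ints \<delta> ^ k * M * Y = vdot g T"
  shows "fps_ints \<delta> ^ Suc k * M * theta Y = vdot (vstep \<delta> C \<nu> k g) T"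
proof -
  have pow: "fps_ints \<delta> * theta (fps_ints \<delta> ^ k) = of_nat k * theta (fps_ints \<delta>) *
      fps_ints \<delta> ^ k"
    by (induction k) (auto simp: theta_mult algebra_simps, simp add: theta_def)
  have 1: "dot (map (fps_ints \<circ> (\<lambda>p. pmul \<delta> (ptheta 0 p))) g) T = fps_ints \<delta> * dot
      (map (fps_ints \<circ> ptheta 0) g) T"
    using vdot_pmul[of \<delta> "map (ptheta 0) g" T] by (simp add: o_def)
  have "vdot (vstep \<delta> C \<nu> k g) T = fps_ints \<delta> * theta (vdot g T)
      - (of_nat k * theta (fps_ints \<delta>) + fps_ints \<nu>) * vdot g T"
    unfolding vstep_def
    unfolding vdot_vadd 1 map_map vdot_pmul vdot_vecmat[OF T] theta_vdot
    by (simp add: fps_ints_smult fps_ints_padd fps_ints_ptheta algebra_simps)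
  also have "fps_ints \<delta> * theta (vdot g T) = (fps_ints \<delta> * theta (fps_ints \<delta> ^ k)) * M * Y +
      fps_ints \<delta> ^ k * (fps_ints \<delta> * theta M) * Y + fps_ints \<delta> ^ Suc k * M * theta Y"
    unfolding Y[symmetric] by (simp add: theta_mult algebra_simps)
  finally show ?thesis unfolding pow \<nu> Y[symmetric] by (simp add: algebra_simps)
qed

lemma vdot_eq_0: "list_all (list_all (\<lambda>a. a = 0)) g \<Longrightarrow> vdot g T = 0"
proof (induction "map fps_ints g" T arbitrary: g rule: dot.induct)
  case (1 a as b bs)
  then show ?case by (auto simp: fps_ints_eq_0)
qed auto

text \<open>
  Here \<open>\<delta> \<theta>(T) = C T\<close> and \<open>\<delta> \<theta>(M) = \<nu> M\<close>; in step
      \<open>k\<close>, \<open>g\<close> represents \<open>\<delta>\<^sup>k M \<theta>\<^sup>k(Y)\<close> in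
      terms of \<open>T\<close>, and \<open>acc\<close> the partial sum
  of the operator with coefficients \<open>ls\<close> applied to \<open>Y\<close>.
\<close>

fun annihilated :: "int list \<Rightarrow> int list list list \<Rightarrow> int list \<Rightarrow> nat
    \<Rightarrow> int list list \<Rightarrow> int list list \<Rightarrow>
    int list list \<Rightarrow> bool" where
  "annihilated \<delta> C \<nu> k g [] acc \<longleftrightarrow> list_all (list_all (\<lambda>a. a = 0)) acc"
| "annihilated \<delta> C \<nu> k g (l # ls) acc \<longleftrightarrow> annihilated \<delta> C \<nu> (Suc k)
    (vstep \<delta> C \<nu> k g) ls
     (vadd (map (pmul \<delta>) acc) (map (pmul l) g))"

lemma annihilated_correct:
  assumes T: "list_all2 (\<lambda>t c. fps_ints \<delta> * theta t = vdot c T) T C"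
    and \<nu>: "fps_ints \<delta> * theta M = fps_ints \<nu> * M"
    and Y: "M * Y = vdot g T"
    and ann: "annihilated \<delta> C \<nu> 0 g ls []"
    and nz: "fps_ints \<delta> \<noteq> 0" "M \<noteq> 0"
  shows "(\<Sum>j<length ls. fps_ints (ls ! j) * (theta ^^ j) Y) = 0"
proof -
  \<comment> \<open>After k > 0 steps \<open>acc\<close> represents \<open>\<delta>^(k-1) M\<close>
    times the partial sum, since its highest term involves only \<open>theta ^^ (k-1)\<close>. The
    additional factor \<open>\<delta>\<close> on both sides of the invariant makes it meaningful at
    k = 0 too.\<close>
  have "fps_ints \<delta> ^ (k + length ls') * M * (\<Sum>j<k + length ls'. fps_ints ((ls0 @ ls') ! j) * (theta
      ^^ j) Y) = 0"
    if "annihilated \<delta> C \<nu> k g ls' acc" "fps_ints \<delta> ^ k * M * (theta ^^ k) Y = vdot g T"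
        "length ls0 = k"
       "fps_ints \<delta> * vdot acc T = fps_ints \<delta> ^ k * M * (\<Sum>j<k. fps_ints (ls0 ! j) * (theta ^^ j) Y)"
    for k ls0 ls' g acc
    using that
  proof (induction ls' arbitrary: k g acc ls0)
    case Nil
    then have "vdot acc T = 0" by (intro vdot_eq_0) simp
    then show ?case using Nil by simp
  next
    case (Cons l ls')
    have "fps_ints \<delta> ^ Suc k * M * (theta ^^ Suc k) Y = vdot (vstep \<delta> C \<nu> k g) T"
      using vstep_correct[OF T \<nu> Cons.prems(2)] by simp
    moreover have "fps_ints \<delta> * vdot (vadd (map (pmul \<delta>) acc) (map (pmul l) g)) T =
      fps_ints \<delta> ^ Suc k * M * (\<Sum>j<Suc k. fps_ints ((ls0 @ [l]) ! j) * (theta ^^ j) Y)"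
    proof -
      have "(\<Sum>j<Suc k. fps_ints ((ls0 @ [l]) ! j) * (theta ^^ j) Y) =
         (\<Sum>j<k. fps_ints (ls0 ! j) * (theta ^^ j) Y) + fps_ints l * (theta ^^ k) Y"
        using Cons.prems(3) by (simp add: nth_append)
      then show ?thesis
        unfolding vdot_vadd map_map vdot_pmul Cons.prems(4) Cons.prems(2)[symmetric]
        by (simp add: algebra_simps)
    qed
    ultimately have "fps_ints \<delta> ^ (Suc k + length ls') * M *
        (\<Sum>j<Suc k + length ls'. fps_ints (((ls0 @ [l]) @ ls') ! j) * (theta ^^ j) Y) = 0"
      using Cons.prems by (intro Cons.IH) (simp_all del: funpow.simps)
    then show ?case by simp
  qed
  from this[OF ann, of "[]"] Y nz show ?thesis by simp
qed

lemma nth_theta_funpow: "fps_nth ((theta ^^ j) Y) n = of_nat n ^ j * fps_nth Y n"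
proof (induction j)
  case (Suc j)
  then show ?case by (cases n) (simp_all add: theta_def)
qed simp

lemma nth_fps_ints_mult:
  "length l \<le> Suc r \<Longrightarrow> fps_nth (fps_ints l * G) (n + r) = (\<Sum>m\<le>r. of_int
      (nth_default 0 l m) * fps_nth G (n + r - m))"
proof (induction l arbitrary: r)
  case (Cons a l)
  show ?case
  proof (cases r)
    case 0
    then show ?thesis using Cons by (simp add: algebra_simps flip: fps_mult_fps_X_commute)
  next
    case (Suc r')
    have "fps_nth (fps_ints (a # l) * G) (n + r) = of_int a * fps_nth G (n + r) + fps_nth (fps_ints l * G) (n + r')"
      using Suc by (simp add: algebra_simps)
    also have "\<dots> = (\<Sum>m\<le>r. of_int (nth_default 0 (a # l) m) * fps_nth G (n + r - m))"
      using Suc Cons by (simp add: sum.atMost_Suc_shift del: sum.atMost_Suc)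
    finally show ?thesis .
  qed
qed (simp add: nth_default_def)

section \<open>From operators in theta to recurrences for coefficients\<close>

primrec pcomp :: "int list \<Rightarrow> int list \<Rightarrow> int list" where
  "pcomp [] q = []"
| "pcomp (a # as) q = padd [a] (pmul (pcomp as q) q)"

lemma horner_padd: "horner (padd p q) x = horner p x + horner q x"
  by (induction p q rule: padd.induct) (auto simp: algebra_simps)

lemma horner_smult: "horner (map ((*) a) q) x = a * horner q x"
  by (induction q) (auto simp: algebra_simps)

lemma horner_pmul: "horner (pmul p q) x = horner p x * horner q x"
  by (induction p) (auto simp: algebra_simps horner_padd horner_smult)

lemma horner_pcomp: "horner (pcomp p q) x = horner p (horner q x)"
  by (induction p) (auto simp: horner_padd horner_pmul mult.commute)

lemma horner_sum: "length l \<le> D \<Longrightarrow> horner l x = (\<Sum>j<D. nth_default 0 l j * x ^ j)"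
proof (induction l arbitrary: D)
  case (Cons a l)
  then obtain D' where "D = Suc D'" by (cases D) auto
  with Cons show ?case
    by (simp add: sum.lessThan_Suc_shift sum_distrib_left algebra_simps del: sum.lessThan_Suc)
qed (simp add: nth_default_def)

primrec shifted :: "int \<Rightarrow> int list list \<Rightarrow> int list list" where
  "shifted k [] = []"
| "shifted k (c # cs) = pcomp c [k, 1] # shifted (k - 1) cs"

lemma shifted_nth: "i < length cs \<Longrightarrow> shifted k cs ! i = pcomp (cs ! i) [k - int i, 1]"
  by (induction cs arbitrary: k i) (auto simp: nth_Cons algebra_simps split: nat.splits)

lemma length_shifted [simp]: "length (shifted k cs) = length cs"
  by (induction cs arbitrary: k) auto

text \<open>
  Shifting the index, \<open>\<Sum>i. c\<^sub>i(n) y\<^sub>n\<^sub>+\<^sub>i\<close> is the coefficient of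
      \<open>X\<^sup>n\<^sup>+\<^sup>r\<close> in \<open>\<Sum>i. X\<^sup>r\<^sup>-\<^sup>i c\<^sub>i(\<theta>
      - i) Y\<close>.
\<close>

definition theta_form :: "nat \<Rightarrow> int list list \<Rightarrow> int list list" where
  "theta_form D cs = map (\<lambda>j. map (\<lambda>c. nth_default 0 c j) (rev (shifted 0 cs))) [0..<D]"

text \<open>The operator c_i(\<theta> - i) multiplies the coefficient of index n + i by c_i(n), and
  X^(r-i) moves it to index n + r. The hypothesis also covers the indices below r, that is, the
  recurrence at n = -r, ..., -1 for the sequence extended by zero.\<close>

lemma theta_form_recurrence:
  assumes "(\<Sum>j<D. fps_ints (theta_form D cs ! j) * (theta ^^ j) Y) = 0"
    and len: "length cs = Suc r" and D: "list_all (\<lambda>c. length c \<le> D) (shifted 0 cs)"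
  shows "(\<Sum>i\<le>r. of_int (horner (cs ! i) (int n)) * fps_nth Y (n + i)) = 0"
proof -
  have "0 = fps_nth (\<Sum>j<D. fps_ints (theta_form D cs ! j) * (theta ^^ j) Y) (n + r)"
    using assms(1) by simp
  also have "\<dots> = (\<Sum>j<D. \<Sum>m\<le>r. of_int (nth_default 0 (theta_form D cs ! j) m) *
      (of_nat (n + r - m) ^ j * fps_nth Y (n + r - m)))"
    unfolding fps_sum_nth
    by (intro sum.cong refl, subst nth_fps_ints_mult) (simp_all add: theta_form_def len nth_theta_funpow)
  also have "\<dots> = (\<Sum>m\<le>r. \<Sum>j<D. of_int (nth_default 0 (theta_form D cs ! j) m) *
      (of_nat (n + r - m) ^ j * fps_nth Y (n + r - m)))"
    by (rule sum.swap)
  also have "\<dots> = (\<Sum>m\<le>r. of_int (horner (cs ! (r - m)) (int n)) * fps_nth Y (n + (r - m)))"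
  proof (intro sum.cong refl)
    fix m assume "m \<in> {..r}"
    define c where "c = shifted 0 cs ! (r - m)"
    have c: "length c \<le> D" using D len unfolding c_def list_all_length by simp
    define N where "N = n + r - m"
    have "nth_default 0 (theta_form D cs ! j) m = nth_default 0 c j" if "j < D" for j
      using \<open>m \<in> _\<close> len that by (simp add: theta_form_def nth_default_def c_def rev_nth)
    then have "(\<Sum>j<D. of_int (nth_default 0 (theta_form D cs ! j) m) *
      (of_nat N ^ j * fps_nth Y N)) = of_int (\<Sum>j<D. nth_default 0 c j * int N ^ j) * fps_nth Y N"
      by (simp add: sum_distrib_right mult.assoc)
    also have "(\<Sum>j<D. nth_default 0 c j * int N ^ j) = horner c (int N)"
      using horner_sum[OF c] by simp
    also have "\<dots> = horner (cs ! (r - m)) (int n)"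
      using \<open>m \<in> _\<close> len by (simp add: c_def N_def shifted_nth horner_pcomp of_nat_diff)
    finally show "(\<Sum>j<D. of_int (nth_default 0 (theta_form D cs ! j) m) *
      (of_nat (n + r - m) ^ j * fps_nth Y (n + r - m))) =
      of_int (horner (cs ! (r - m)) (int n)) * fps_nth Y (n + (r - m))"
      using \<open>m \<in> _\<close> by (simp add: N_def)
  qed
  also have "\<dots> = (\<Sum>i\<le>r. of_int (horner (cs ! i) (int n)) * fps_nth Y (n + i))"
    by (rule sum.reindex_bij_witness[of _ "\<lambda>i. r - i" "\<lambda>i. r - i"]) auto
  finally show ?thesis by simp
qed

lemma annihilated_recurrence:
  assumes "list_all2 (\<lambda>t c. fps_ints \<delta> * theta t = vdot c T) T C"
    and "fps_ints \<delta> * theta M = fps_ints \<nu> * M" "M * Y = vdot g T" "fps_ints \<delta> \<noteq> 0" "M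
        \<noteq> 0"
    and "annihilated \<delta> C \<nu> 0 g (theta_form D cs) []"
    and "length cs = Suc r" "list_all (\<lambda>c. length c \<le> D) (shifted 0 cs)"
  shows "(\<Sum>i\<le>r. of_int (horner (cs ! i) (int n)) * fps_nth Y (n + i)) = 0"
  using annihilated_correct[OF assms(1-3,6,4,5)] assms(7,8)
  by (intro theta_form_recurrence) (simp_all add: theta_form_def)

section \<open>Integrals over the torus\<close>

abbreviation period :: "real set" where "period \<equiv> {0..2 * pi}"

definition torus_int :: "(real \<Rightarrow> real \<Rightarrow> complex) \<Rightarrow> complex" where
  "torus_int f = integral period (\<lambda>v. integral period (\<lambda>u. f u v))"

lemma inner_continuous:
  fixes f :: "'a::topological_space \<Rightarrow> real \<Rightarrow> real \<Rightarrow> complex"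
  assumes "continuous_on (U \<times> period \<times> period) (\<lambda>(x, v, u). f x u v)"
  shows "continuous_on (U \<times> period) (\<lambda>(x, v). integral period (\<lambda>u. f x u v))"
proof -
  have "continuous_on ((U \<times> period) \<times> cbox 0 (2 * pi)) (\<lambda>(p, u). f (fst p) u (snd p))"
    unfolding case_prod_beta
    by (rule continuous_on_compose2[OF assms, of _ "\<lambda>p. (fst (fst p), snd (fst p), snd p)",
          unfolded case_prod_beta fst_conv snd_conv]) (auto intro!: continuous_intros)
  from integral_continuous_on_param[OF this] show ?thesis
    by (simp add: case_prod_beta)
qed

lemma torus_int_continuous:
  fixes f :: "'a::topological_space \<Rightarrow> real \<Rightarrow> real \<Rightarrow> complex"
  assumes "continuous_on (U \<times> period \<times> period) (\<lambda>(x, v, u). f x u v)"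
  shows "continuous_on U (\<lambda>x. torus_int (f x))"
  unfolding torus_int_def
  using integral_continuous_on_param[of U 0 "2 * pi" "\<lambda>x v. integral period (\<lambda>u. f x u v)"]
    inner_continuous[OF assms] by simp

lemma continuous_on_slice:
  assumes "continuous_on (U \<times> S) f" "x \<in> U"
  shows "continuous_on S (\<lambda>y. f (x, y))"
  by (rule continuous_on_compose2[OF assms(1)]) (use assms(2) in \<open>auto intro!: continuous_intros\<close>)

lemma torus_int_has_field_derivative:
  fixes f f' :: "complex \<Rightarrow> real \<Rightarrow> real \<Rightarrow> complex"
  assumes f: "continuous_on (U \<times> period \<times> period) (\<lambda>(x, v, u). f x u v)"
    and f': "continuous_on (U \<times> period \<times> period) (\<lambda>(x, v, u). f' x u v)"
    and deriv: "\<And>x u v. x \<in> U \<Longrightarrow> ((\<lambda>x. f x u v) has_field_derivative f' x u v)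
        (at x within U)"
    and U: "convex U" "x \<in> U"
  shows "((\<lambda>x. torus_int (f x)) has_field_derivative torus_int (f' x)) (at x within U)"
proof -
  have slice: "continuous_on (U \<times> period) (\<lambda>(x, u). g x u v)"
    if "v \<in> period" "continuous_on (U \<times> period \<times> period) (\<lambda>(x, v, u). g x u v)"
    for g :: "complex \<Rightarrow> real \<Rightarrow> real \<Rightarrow> complex" and v
    unfolding case_prod_beta
    by (rule continuous_on_compose2[OF that(2), of _ "\<lambda>p. (fst p, v, snd p)",
          unfolded case_prod_beta fst_conv snd_conv]) (use that(1) in \<open>auto intro!: continuous_intros\<close>)
  have 1: "((\<lambda>x. integral (cbox 0 (2 * pi)) (\<lambda>u. f x u v)) has_field_derivative
      integral (cbox 0 (2 * pi)) (\<lambda>u. f' x u v)) (at x within U)" if "x \<in> U" "v \<in> period" for x v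
    by (rule leibniz_rule_field_derivative)
      (use that U deriv slice[OF that(2) f'] continuous_on_slice[OF slice[OF that(2) f]] in
        \<open>auto intro!: integrable_continuous_real\<close>)
  have "((\<lambda>x. integral (cbox 0 (2 * pi)) (\<lambda>v. integral period (\<lambda>u. f x u v)))
      has_field_derivative
      integral (cbox 0 (2 * pi)) (\<lambda>v. integral period (\<lambda>u. f' x u v))) (at x within U)"
    by (rule leibniz_rule_field_derivative)
      (use U 1 inner_continuous[OF f'] continuous_on_slice[OF inner_continuous[OF f]] in
        \<open>auto intro!: integrable_continuous_real\<close>)
  then show ?thesis by (simp add: torus_int_def)
qed

lemma torus_int_has_vector_derivative:
  fixes f f' :: "real \<Rightarrow> real \<Rightarrow> real \<Rightarrow> complex"
  assumes f: "continuous_on (U \<times> period \<times> period) (\<lambda>(x, v, u). f x u v)"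
    and f': "continuous_on (U \<times> period \<times> period) (\<lambda>(x, v, u). f' x u v)"
    and deriv: "\<And>x u v. x \<in> U \<Longrightarrow> ((\<lambda>x. f x u v) has_vector_derivative f' x u v)
        (at x within U)"
    and U: "convex U" "x \<in> U"
  shows "((\<lambda>x. torus_int (f x)) has_vector_derivative torus_int (f' x)) (at x within U)"
proof -
  have slice: "continuous_on (U \<times> period) (\<lambda>(x, u). g x u v)"
    if "v \<in> period" "continuous_on (U \<times> period \<times> period) (\<lambda>(x, v, u). g x u v)"
    for g :: "real \<Rightarrow> real \<Rightarrow> real \<Rightarrow> complex" and v
    unfolding case_prod_beta
    by (rule continuous_on_compose2[OF that(2), of _ "\<lambda>p. (fst p, v, snd p)",
          unfolded case_prod_beta fst_conv snd_conv]) (use that(1) in \<open>auto intro!: continuous_intros\<close>)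
  have 1: "((\<lambda>x. integral (cbox 0 (2 * pi)) (\<lambda>u. f x u v)) has_vector_derivative
      integral (cbox 0 (2 * pi)) (\<lambda>u. f' x u v)) (at x within U)" if "x \<in> U" "v \<in> period" for x v
    by (rule leibniz_rule_vector_derivative)
      (use that U deriv slice[OF that(2) f'] continuous_on_slice[OF slice[OF that(2) f]] in
        \<open>auto intro!: integrable_continuous_real\<close>)
  have "((\<lambda>x. integral (cbox 0 (2 * pi)) (\<lambda>v. integral period (\<lambda>u. f x u v)))
      has_vector_derivative
      integral (cbox 0 (2 * pi)) (\<lambda>v. integral period (\<lambda>u. f' x u v))) (at x within U)"
    by (rule leibniz_rule_vector_derivative)
      (use U 1 inner_continuous[OF f'] continuous_on_slice[OF inner_continuous[OF f]] in
        \<open>auto intro!: integrable_continuous_real\<close>)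
  then show ?thesis by (simp add: torus_int_def)
qed

lemma integrable_slices:
  assumes "continuous_on (period \<times> period) (\<lambda>(v, u). f u v)"
  shows "v \<in> period \<Longrightarrow> (\<lambda>u. f u v :: complex) integrable_on period"
    and "(\<lambda>v. integral period (\<lambda>u. f u v)) integrable_on period"
proof -
  show "v \<in> period \<Longrightarrow> (\<lambda>u. f u v :: complex) integrable_on period"
    using continuous_on_slice[OF assms] by (auto intro!: integrable_continuous_real)
  show "(\<lambda>v. integral period (\<lambda>u. f u v)) integrable_on period"
    using integral_continuous_on_param[of period 0 "2 * pi" "\<lambda>v u. f u v"] assms
    by (auto intro!: integrable_continuous_real)
qed

lemma torus_int_add:
  assumes "continuous_on (period \<times> period) (\<lambda>(v, u). f u v)"
    "continuous_on (period \<times> period) (\<lambda>(v, u). g u v)"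
  shows "torus_int (\<lambda>u v. f u v + g u v) = torus_int f + torus_int g"
proof -
  have "integral period (\<lambda>u. f u v + g u v) = integral period (\<lambda>u. f u v) + integral period
      (\<lambda>u. g u v)"
    if "v \<in> period" for v
    by (rule integral_add[OF integrable_slices(1)[OF assms(1) that] integrable_slices(1)[OF assms(2) that]])
  then have "torus_int (\<lambda>u v. f u v + g u v) =
      integral period (\<lambda>v. integral period (\<lambda>u. f u v) + integral period (\<lambda>u. g u v))"
    unfolding torus_int_def by (intro integral_cong)
  also have "\<dots> = torus_int f + torus_int g"
    unfolding torus_int_def by (rule integral_add[OF integrable_slices(2)[OF assms(1)] integrable_slices(2)[OF
        assms(2)]])
  finally show ?thesis .
qed

lemma torus_int_cmult: "torus_int (\<lambda>u v. c * f u v) = c * torus_int f"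
  by (simp add: torus_int_def)

lemma torus_int_cong:
  "(\<And>u v. u \<in> period \<Longrightarrow> v \<in> period \<Longrightarrow> f u v = g u v)
      \<Longrightarrow> torus_int f = torus_int g"
  unfolding torus_int_def by (intro integral_cong) auto

text \<open>Derivatives of periodic functions integrate to zero: \<open>g\<close> in the inner
  variable directly, \<open>h\<close> after exchanging the integrals. The primitives take complex
  arguments so that complex differentiation rules apply to them; they are restricted to real points
  here.\<close>

lemma torus_int_exact:
  assumes U: "\<And>u v. (G (complex_of_real v) has_field_derivative g u v) (at (complex_of_real u))"
    and V: "\<And>u v. (H (complex_of_real u) has_field_derivative h u v) (at (complex_of_real v))"
    and per: "\<And>v. G (of_real v) (of_real (2 * pi)) = G (of_real v) 0"
      "\<And>u. H (of_real u) (of_real (2 * pi)) = H (of_real u) 0"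
    and cont: "continuous_on (period \<times> period) (\<lambda>(v, u). g u v)"
      "continuous_on (period \<times> period) (\<lambda>(v, u). h u v)"
  shows "torus_int (\<lambda>u v. g u v + h u v) = 0"
proof -
  have "((\<lambda>u. g u v) has_integral G v (of_real (2 * pi)) - G v (of_real 0)) period" for v
    by (rule fundamental_theorem_of_calculus)
      (auto intro: has_vector_derivative_real_field U)
  then have "integral period (\<lambda>u. g u v) = 0" for v
    using integral_unique[of "\<lambda>u. g u v"] unfolding per(1) by simp
  then have "torus_int g = 0"
    by (simp add: torus_int_def)
  have "((\<lambda>v. h u v) has_integral H u (of_real (2 * pi)) - H u (of_real 0)) period" for u
    by (rule fundamental_theorem_of_calculus)
      (auto intro: has_vector_derivative_real_field V)
  then have "integral period (\<lambda>v. h u v) = 0" for u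
    using integral_unique[of "\<lambda>v. h u v"] unfolding per(2) by simp
  then have "integral period (\<lambda>u. integral period (\<lambda>v. h u v)) = 0"
    by simp
  moreover have "integral (cbox 0 (2 * pi)) (\<lambda>v. integral (cbox 0 (2 * pi)) (\<lambda>u. h u v)) =
      integral (cbox 0 (2 * pi)) (\<lambda>u. integral (cbox 0 (2 * pi)) (\<lambda>v. h u v))"
    by (rule integral_swap_continuous) (use cont(2) in \<open>simp add: cbox_Pair_eq\<close>)
  ultimately have "torus_int h = 0" by (simp add: torus_int_def)
  with \<open>torus_int g = 0\<close> show ?thesis by (simp add: torus_int_add cont)
qed

lemma continuous_on_cmult_case:
  "continuous_on S (\<lambda>(v, u). f u v) \<Longrightarrow> continuous_on S (\<lambda>(v, u). c * f u v :: complex)"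
  using continuous_on_mult[OF continuous_on_const[of S c], of "\<lambda>(v, u). f u v"]
  by (simp add: case_prod_beta)

lemma torus_int_lincomb:
  assumes "continuous_on (period \<times> period) (\<lambda>(v, u). f u v)"
    "continuous_on (period \<times> period) (\<lambda>(v, u). g u v)"
    "continuous_on (period \<times> period) (\<lambda>(v, u). h u v)"
  shows "torus_int (\<lambda>u v. a * f u v + (b * g u v + c * h u v)) =
    a * torus_int f + (b * torus_int g + c * torus_int h)"
proof -
  have "continuous_on (period \<times> period) (\<lambda>(v, u). b * g u v + c * h u v)"
    using continuous_on_add[OF continuous_on_cmult_case[OF assms(2), of b] continuous_on_cmult_case[OF
        assms(3), of c]]
    by (simp add: case_prod_beta)
  with assms show ?thesis
    by (simp add: torus_int_add torus_int_cmult continuous_on_cmult_case)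
qed

section \<open>The conformal angle\<close>

abbreviation root2 :: complex where "root2 \<equiv> of_real (sqrt 2)"

lemma root2_sq [simp]: "root2 * root2 = 2" "root2\<^sup>2 = 2"
  by (simp_all flip: of_real_mult of_real_power)

text \<open>\<open>Q\<close> in toroidal coordinates, where the squared norm is 2 + 2 sqrt 2 r sin v
  + r^2, extended to complex \<open>r\<close>, \<open>u\<close>, \<open>v\<close> so that it has
  complex derivatives in each of them.\<close>

definition Q_polar :: "complex \<Rightarrow> complex \<Rightarrow> complex \<Rightarrow> complex \<Rightarrow>
    complex" where
  "Q_polar z r u v = 1 + 2 * (root2 + r * sin v) * cos u * z + (2 + 2 * root2 * r * sin v + r\<^sup>2) * z\<^sup>2"

lemma Q_torus_pt: "Q z (torus_pt u v r) = Q_polar z (of_real r) (of_real u) (of_real v)"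
proof -
  have "(norm (torus_pt u v r))\<^sup>2 = ((sqrt 2 + r * sin v) * cos u)\<^sup>2 + ((sqrt 2 + r * sin v) * sin
      u)\<^sup>2 + (r * cos v)\<^sup>2"
    unfolding power2_norm_eq_inner inner_vec_def sum_3 torus_pt_def by (simp add: power2_eq_square)
  also have "\<dots> = (sqrt 2 + r * sin v)\<^sup>2 * ((sin u)\<^sup>2 + (cos u)\<^sup>2) + r\<^sup>2 * (cos
      v)\<^sup>2"
    by (simp only: power_mult_distrib distrib_left add_ac)
  also have "\<dots> = (sqrt 2)\<^sup>2 + 2 * sqrt 2 * r * sin v + r\<^sup>2 * ((sin v)\<^sup>2 + (cos v)\<^sup>2)"
    by (simp add: cos_squared_eq[of v] power2_sum power_mult_distrib algebra_simps)
  finally have norm: "(norm (torus_pt u v r))\<^sup>2 = 2 + 2 * sqrt 2 * r * sin v + r\<^sup>2" by simp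
  show ?thesis unfolding Q_def norm Q_polar_def
    by (simp add: torus_pt_def algebra_simps flip: sin_of_real cos_of_real)
qed

lemma sqrt2_bounds: "7 / 5 \<le> sqrt 2" "sqrt 2 \<le> 3 / 2"
  by (rule real_le_rsqrt, simp add: power2_eq_square) (rule real_le_lsqrt, simp_all add: power2_eq_square)

text \<open>The linear and quadratic terms are at most 5/10 and 6/100 in norm. The radius 1/10 is a
  convenient choice below sqrt 2 - 1, since only germs at 0 matter for the coefficient
  sequences.\<close>

lemma Q_polar_nonzero:
  assumes "norm z < 1 / 10" "0 \<le> r" "r \<le> 1"
  shows "Q_polar z (of_real r) (of_real u) (of_real v) \<noteq> 0"
proof
  assume eq: "Q_polar z (of_real r) (of_real u) (of_real v) = 0"
  define x1 where "x1 = (sqrt 2 + r * sin v) * cos u"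
  define x2 where "x2 = 2 + 2 * sqrt 2 * r * sin v + r\<^sup>2"
  have rs: "\<bar>r * sin v\<bar> \<le> 1"
    using assms(2,3) mult_mono[of r 1 "\<bar>sin v\<bar>" 1] by (simp add: abs_mult)
  have "\<bar>sqrt 2 + r * sin v\<bar> \<le> 5 / 2" using rs sqrt2_bounds by linarith
  then have x1: "\<bar>x1\<bar> \<le> 5 / 2" unfolding x1_def abs_mult
    using mult_mono[of "\<bar>sqrt 2 + r * sin v\<bar>" "5 / 2" "\<bar>cos u\<bar>" 1] by simp
  have "\<bar>2 * sqrt 2 * (r * sin v)\<bar> \<le> 3 * 1" unfolding abs_mult[of "2 * sqrt 2"]
    using sqrt2_bounds rs by (intro mult_mono) auto
  moreover have "r\<^sup>2 \<le> 1" using assms(2,3) by (simp add: power_le_one)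
  moreover have "0 \<le> r\<^sup>2" by simp
  ultimately have x2: "\<bar>x2\<bar> \<le> 6" unfolding x2_def mult.assoc abs_le_iff by linarith
  have "Q_polar z (of_real r) (of_real u) (of_real v) = 1 + (2 * of_real x1 * z + of_real x2 * z\<^sup>2)"
    by (simp add: Q_polar_def x1_def x2_def flip: sin_of_real cos_of_real)
  then have "norm (2 * of_real x1 * z + of_real x2 * z\<^sup>2) = 1"
    using eq by (metis add_eq_0_iff norm_minus_cancel norm_one)
  moreover have "norm (2 * of_real x1 * z + of_real x2 * z\<^sup>2) \<le> 2 * \<bar>x1\<bar> * norm z +
      \<bar>x2\<bar> * (norm z)\<^sup>2"
    by (rule order.trans[OF norm_triangle_ineq]) (simp add: norm_mult norm_power)
  moreover have "2 * \<bar>x1\<bar> * norm z \<le> 5 * (1 / 10)" using x1 assms(1) by (intro mult_mono) auto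
  moreover have "(norm z)\<^sup>2 \<le> (1 / 10)\<^sup>2" using assms(1) by (intro power_mono) auto
  then have "\<bar>x2\<bar> * (norm z)\<^sup>2 \<le> 6 * (1 / 10)\<^sup>2" using x2 by (intro mult_mono) auto
  ultimately show False by (simp add: power2_eq_square)
qed

text \<open>\<open>conf_sin\<close> and \<open>conf_cos\<close> are the sine and cosine of the conformal
    angle.\<close>

definition rho :: "complex \<Rightarrow> complex" where "rho v = root2 + sin v"
definition conf_sin :: "complex \<Rightarrow> complex" where "conf_sin v = (1 + root2 * sin v) / rho v"
definition conf_cos :: "complex \<Rightarrow> complex" where "conf_cos v = cos v / rho v"
definition kernel :: "complex \<Rightarrow> complex \<Rightarrow> complex \<Rightarrow> complex" where
  "kernel z u v = root2 * (1 + z\<^sup>2) + 2 * z * cos u - (1 - z\<^sup>2) * conf_sin v"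

lemma rho_nonzero [simp]: "rho (of_real v) \<noteq> 0"
proof -
  have "sqrt 2 + sin v > 0" using sqrt2_bounds sin_ge_minus_one[of v] by linarith
  moreover have "rho (of_real v) = of_real (sqrt 2 + sin v)" by (simp add: rho_def flip: sin_of_real)
  ultimately show ?thesis by (metis less_irrefl of_real_eq_0_iff)
qed

lemma conf_sin_cos: "rho v \<noteq> 0 \<Longrightarrow> (conf_sin v)\<^sup>2 + (conf_cos v)\<^sup>2 = 1"
proof -
  assume nz: "rho v \<noteq> 0"
  have "(1 + root2 * sin v)\<^sup>2 + (cos v)\<^sup>2 = (rho v)\<^sup>2"
    unfolding rho_def cos_squared_eq by (simp add: power2_sum power_mult_distrib algebra_simps)
  with nz show ?thesis unfolding conf_sin_def conf_cos_def by (simp add: power_divide flip: add_divide_distrib)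
qed

lemma Q_polar_kernel: "rho v \<noteq> 0 \<Longrightarrow> Q_polar z 1 u v = rho v * kernel z u v"
proof -
  assume "rho v \<noteq> 0"
  then have "rho v * conf_sin v = 1 + root2 * sin v" by (simp add: conf_sin_def)
  moreover have "rho v * kernel z u v = rho v * (root2 * (1 + z\<^sup>2) + 2 * z * cos u) - (1 - z\<^sup>2) *
      (rho v * conf_sin v)"
    by (simp add: kernel_def algebra_simps)
  ultimately have "rho v * kernel z u v = rho v * (root2 * (1 + z\<^sup>2) + 2 * z * cos u) - (1 - z\<^sup>2) *
      (1 + root2 * sin v)"
    by simp
  also have "\<dots> = Q_polar z 1 u v" unfolding Q_polar_def rho_def by (simp add: algebra_simps)
  finally show ?thesis by simp
qed

lemma kernel_nonzero: "norm z < 1 / 10 \<Longrightarrow> kernel z (of_real u) (of_real v) \<noteq> 0"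
  using Q_polar_nonzero[of z 1 u v] Q_polar_kernel[of "of_real v" z "of_real u"] by auto

text \<open>The angle itself is never introduced: this and \<open>DERIV_conf_cos\<close> encode
  \<open>d\<phi> = dv / \<rho>\<close>.\<close>

lemma DERIV_conf_sin: "rho v \<noteq> 0 \<Longrightarrow> (conf_sin has_field_derivative conf_cos v / rho v) (at v)"
  unfolding conf_sin_def[abs_def]
  by (auto intro!: derivative_eq_intros simp: rho_def[abs_def] conf_cos_def field_simps power2_eq_square)

lemma DERIV_conf_cos: "rho v \<noteq> 0 \<Longrightarrow> (conf_cos has_field_derivative - conf_sin v / rho v) (at v)"
proof -
  assume nz: "rho v \<noteq> 0"
  then have "(conf_cos has_field_derivative (- sin v * rho v - cos v * cos v) / (rho v * rho v)) (at v)"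
    unfolding conf_cos_def[abs_def] by (auto intro!: derivative_eq_intros simp: rho_def[abs_def])
  also have "- sin v * rho v - cos v * cos v = - (1 + root2 * sin v)"
    using sin_cos_squared_add[of v] by (simp add: rho_def algebra_simps power2_eq_square)
  also have "- (1 + root2 * sin v) / (rho v * rho v) = - conf_sin v / rho v"
    by (simp only: conf_sin_def minus_divide_left divide_divide_eq_left)
  finally show ?thesis .
qed

text \<open>The surface element contributes \<open>\<rho>\<close> and the square of \<open>Q\<close>
  contributes \<open>\<rho>^2\<close>. The remaining \<open>1 / \<rho>\<close> is
  \<open>d\<phi> / dv\<close>, so in the variables u and \<phi> the integrand depends on
  \<open>E\<close> alone.\<close>

lemma A_eq: "A z = torus_int (\<lambda>u v. 1 / (rho (of_real v) * kernel z (of_real u) (of_real v) ^ 2))"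
  unfolding A_def torus_int_def
proof (intro integral_cong)
  fix u v
  have "of_real (sqrt 2 + sin v) = rho (of_real v)" by (simp add: rho_def flip: sin_of_real)
  then show "of_real (sqrt 2 + sin v) / (Q z (torus_pt u v 1))\<^sup>2 =
      1 / (rho (of_real v) * kernel z (of_real u) (of_real v) ^ 2)"
    unfolding Q_torus_pt by (simp add: Q_polar_kernel power_mult_distrib power2_eq_square)
qed

text \<open>The polynomials \<open>a\<close> and \<open>b\<close> below were found by solving a linear system
    for their coefficients.\<close>

lemma ode_certificate:
  fixes t x y z :: complex
  assumes t: "t\<^sup>2 = 2"
    and E: "E = t * (1 + z\<^sup>2) + 2 * z * x - (1 - z\<^sup>2) * y"
    and E1: "E1 = 2 * t * z + 2 * x + 2 * z * y" and E2: "E2 = 2 * t + 2 * y"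
    and a: "a = (4 * z - 20 * z ^ 3 - 408 * z ^ 5 + 408 * z ^ 7 + 20 * z ^ 9 - 4 * z ^ 11) + (24 * z ^ 3 - 24 *
        z ^ 5 - 24 * z ^ 7 + 24 * z ^ 9) * t * y + (- 72 * z ^ 3 + 216 * z ^ 5 - 216 * z ^ 7 + 72 * z ^ 9) * y
        ^ 2 + (- 144 * z ^ 4 + 144 * z ^ 8) * t * x + (- 96 * z ^ 5 + 96 * z ^ 7) * x ^ 2"
    and ax: "ax = (- 144 * z ^ 4 + 144 * z ^ 8) * t + (- 192 * z ^ 5 + 192 * z ^ 7) * x"
    and b: "b = (56 * z ^ 2 - 224 * z ^ 4 + 208 * z ^ 6 - 224 * z ^ 8 + 56 * z ^ 10) + (- 36 * z ^ 2 + 72 * z ^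
        4 - 72 * z ^ 8 + 36 * z ^ 10) * t * y + (12 * z ^ 2 - 48 * z ^ 4 + 72 * z ^ 6 - 48 * z ^ 8 + 12 * z ^
        10) * y ^ 2 + (24 * z ^ 3 - 24 * z ^ 5 - 24 * z ^ 7 + 24 * z ^ 9) * t * x + (144 * z ^ 4 - 288 * z ^ 6
        + 144 * z ^ 8) * x ^ 2"
    and bby: "bby = (- 36 * z ^ 2 + 72 * z ^ 4 - 72 * z ^ 8 + 36 * z ^ 10) * t + (24 * z ^ 2 - 96 * z ^ 4 + 144
        * z ^ 6 - 96 * z ^ 8 + 24 * z ^ 10) * y"
  shows "(52 * z ^ 2 - 172 * z ^ 4 - 4 * z ^ 6 + 44 * z ^ 8 + 16 * z ^ 10) * E\<^sup>2 + (44 * z ^ 2 - 20 * z ^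
      4 - 68 * z ^ 6 + 4 * z ^ 8 + 8 * z ^ 10) * (- 2 * z * E1 * E) +
      (- 1 + 5 * z ^ 2 + 6 * z ^ 4 - 6 * z ^ 6 - 5 * z ^ 8 + z ^ 10) * (- 2 * z * E1 * E + z\<^sup>2 * (6 *
          E1\<^sup>2 - 2 * E2 * E)) =
    ((x * a - (1 - x\<^sup>2) * ax) * E + 6 * z * (1 - x\<^sup>2) * a) +
    ((- y * b + (1 - y\<^sup>2) * bby) * E + 3 * (1 - z\<^sup>2) * (1 - y\<^sup>2) * b)"
    (is "?L = ?R")
proof -
  \<comment> \<open>The sides agree only because t^2 = 2. Displaying the cofactor of t^2 - 2 leaves
    a plain polynomial identity.\<close>
  have "?L - ?R = (t\<^sup>2 - 2) * ((288 * z ^ 4 + 288 * z ^ 6 - 288 * z ^ 8 - 288 * z ^ 10) * x * x + (- 72 *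
      z ^ 2 + 72 * z ^ 4 + 144 * z ^ 6 - 144 * z ^ 8 - 72 * z ^ 10 + 72 * z ^ 12) * y * y + (96 * z ^ 2 - 480 *
      z ^ 4 - 576 * z ^ 6 + 576 * z ^ 8 + 480 * z ^ 10 - 96 * z ^ 12))"
    unfolding E E1 E2 a ax b bby by algebra
  then show ?thesis using t by simp
qed

text \<open>The analogue with one power of \<open>E\<close> less. Over E^3 the left side combines
  the flux that represents the volume, the area density and \<open>z\<close> times its derivative in
  \<open>z\<close>; the right side collects two exact forms built from \<open>a\<close> and
  \<open>b\<close>.\<close>

lemma volume_certificate:
  fixes t x y z :: complex
  assumes t: "t\<^sup>2 = 2"
    and E: "E = t * (1 + z\<^sup>2) + 2 * z * x - (1 - z\<^sup>2) * y"
    and E1: "E1 = 2 * t * z + 2 * x + 2 * z * y"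
    and a: "a = (4 * z ^ 2 + 4 * z ^ 4) * t + (- 1 - 4 * z ^ 2 + z ^ 4) * y + (4 * z ^ 3) * x"
    and ax: "ax = (4 * z ^ 3)"
    and b: "b = (- 2 * z + 2 * z ^ 5) * t + (z - 2 * z ^ 3 + z ^ 5) * y + (1 + 3 * z ^ 4) * x"
    and bby: "bby = (z - 2 * z ^ 3 + z ^ 5)"
  shows "(- 2 - 6 * z ^ 2 - 6 * z ^ 4 - 2 * z ^ 6) * (z * y + (t * y - 1) * x) + (- 3 * z + 10 * z ^ 3 + 5 * z
      ^ 5) * E + (- 2 * z + 2 * z ^ 5) * (- 2 * z * E1) =
    ((x * a - (1 - x\<^sup>2) * ax) * E + 4 * z * (1 - x\<^sup>2) * a) +
    ((- y * b + (1 - y\<^sup>2) * bby) * E + 2 * (1 - z\<^sup>2) * (1 - y\<^sup>2) * b)"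
    (is "?L = ?R")
proof -
  have "?L - ?R = (t\<^sup>2 - 2) * ((- 4 * z ^ 2 - 8 * z ^ 4 - 4 * z ^ 6) * x + (- 2 * z - 2 * z ^ 3 + 2 * z ^
      5 + 2 * z ^ 7) * y)"
    unfolding E E1 a ax b bby by algebra
  then show ?thesis using t by simp
qed

section \<open>The differential equation of the area\<close>

lemma continuous_on_sin_cos_of_real [continuous_intros]:
  fixes f :: "'a::t2_space \<Rightarrow> real"
  assumes "continuous_on S f"
  shows "continuous_on S (\<lambda>x. sin (complex_of_real (f x)))"
    and "continuous_on S (\<lambda>x. cos (complex_of_real (f x)))"
  using assms by (auto simp: sin_of_real cos_of_real intro!: continuous_intros)

lemma continuous_on_rho [continuous_intros]:
  "continuous_on S (f :: 'a::t2_space \<Rightarrow> real) \<Longrightarrow> continuous_on S (\<lambda>x. rho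
      (of_real (f x)))"
  unfolding rho_def by (intro continuous_intros)

lemma continuous_on_conf_sin [continuous_intros]:
  "continuous_on S (f :: 'a::t2_space \<Rightarrow> real) \<Longrightarrow> continuous_on S (\<lambda>x.
      conf_sin (of_real (f x)))"
  unfolding conf_sin_def by (intro continuous_intros) auto

lemma continuous_on_kernel [continuous_intros]:
  "continuous_on S (g :: 'a::t2_space \<Rightarrow> complex) \<Longrightarrow> continuous_on S f
      \<Longrightarrow> continuous_on S h \<Longrightarrow>
   continuous_on S (\<lambda>x. kernel (g x) (of_real (f x)) (of_real (h x)))"
  unfolding kernel_def by (intro continuous_intros)

definition kernel_dz :: "complex \<Rightarrow> complex \<Rightarrow> complex \<Rightarrow> complex" where
  "kernel_dz z u v = 2 * root2 * z + 2 * cos u + 2 * z * conf_sin v"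

definition kernel_dzz :: "complex \<Rightarrow> complex" where
  "kernel_dzz v = 2 * root2 + 2 * conf_sin v"

lemma continuous_on_kernel_dz [continuous_intros]:
  "continuous_on S (g :: 'a::t2_space \<Rightarrow> complex) \<Longrightarrow> continuous_on S f
      \<Longrightarrow> continuous_on S h \<Longrightarrow>
   continuous_on S (\<lambda>x. kernel_dz (g x) (of_real (f x)) (of_real (h x)))"
  unfolding kernel_dz_def by (intro continuous_intros)

lemma continuous_on_kernel_dzz [continuous_intros]:
  "continuous_on S (h :: 'a::t2_space \<Rightarrow> real) \<Longrightarrow> continuous_on S (\<lambda>x.
      kernel_dzz (of_real (h x)))"
  unfolding kernel_dzz_def by (intro continuous_intros)

definition area_density :: "complex \<Rightarrow> real \<Rightarrow> real \<Rightarrow> complex" where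
  "area_density z u v = 1 / (rho (of_real v) * kernel z (of_real u) (of_real v) ^ 2)"

definition area_density_dz :: "complex \<Rightarrow> real \<Rightarrow> real \<Rightarrow> complex" where
  "area_density_dz z u v = - 2 * kernel_dz z (of_real u) (of_real v) / (rho (of_real v) * kernel z (of_real u)
      (of_real v) ^ 3)"

definition area_density_dzz :: "complex \<Rightarrow> real \<Rightarrow> real \<Rightarrow> complex" where
  "area_density_dzz z u v = (6 * (kernel_dz z (of_real u) (of_real v))\<^sup>2 - 2 * kernel_dzz (of_real v) *
      kernel z (of_real u) (of_real v)) /
     (rho (of_real v) * kernel z (of_real u) (of_real v) ^ 4)"

abbreviation small_disc :: "complex set" where "small_disc \<equiv> ball 0 (1 / 10)"

lemma continuous_on_area_density:
  "continuous_on (small_disc \<times> period \<times> period) (\<lambda>(z, v, u). area_density z u v)"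
  "continuous_on (small_disc \<times> period \<times> period) (\<lambda>(z, v, u). area_density_dz z u v)"
  "continuous_on (small_disc \<times> period \<times> period) (\<lambda>(z, v, u). area_density_dzz z u v)"
  unfolding area_density_def area_density_dz_def area_density_dzz_def case_prod_beta
  by (intro continuous_intros; auto simp: kernel_nonzero)+

lemma continuous_on_area_density_slice:
  assumes "z \<in> small_disc"
  shows "continuous_on (period \<times> period) (\<lambda>(v, u). area_density z u v)"
    "continuous_on (period \<times> period) (\<lambda>(v, u). area_density_dz z u v)"
    "continuous_on (period \<times> period) (\<lambda>(v, u). area_density_dzz z u v)"
  using continuous_on_area_density[THEN continuous_on_slice, OF assms] by simp_all

lemma DERIV_kernel: "((\<lambda>z. kernel z u v) has_field_derivative kernel_dz z u v) (at z within S)"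
  unfolding kernel_def kernel_dz_def by (auto intro!: derivative_eq_intros simp: algebra_simps)

lemma DERIV_kernel_dz: "((\<lambda>z. kernel_dz z u v) has_field_derivative kernel_dzz v) (at z within S)"
  unfolding kernel_dz_def kernel_dzz_def by (auto intro!: derivative_eq_intros simp: algebra_simps)

lemma DERIV_quotient_power:
  assumes "(N has_field_derivative N') (at x within S)" "(E has_field_derivative E') (at x within S)"
    and "E x \<noteq> 0" "(r::complex) \<noteq> 0"
  shows "((\<lambda>x. N x / (r * E x ^ k)) has_field_derivative (N' * E x - of_nat k * N x * E') / (r * E x ^ Suc k))
    (at x within S)"
  using assms by (auto intro!: derivative_eq_intros) (cases k; simp add: field_simps)

lemma DERIV_area_density: "norm z < 1 / 10 \<Longrightarrow> ((\<lambda>z. area_density z u v)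
    has_field_derivative area_density_dz z u v) (at z within S)"
proof -
  assume z: "norm z < 1 / 10"
  from DERIV_quotient_power[OF DERIV_const DERIV_kernel kernel_nonzero[OF z] rho_nonzero, where k = 2]
  show ?thesis unfolding area_density_def area_density_dz_def by (rule DERIV_cong) (simp add: eval_nat_numeral)
qed

lemma DERIV_area_density_dz: "norm z < 1 / 10 \<Longrightarrow> ((\<lambda>z. area_density_dz z u v)
    has_field_derivative area_density_dzz z u v) (at z within S)"
proof -
  assume z: "norm z < 1 / 10"
  have "((\<lambda>z. - 2 * kernel_dz z (of_real u) (of_real v)) has_field_derivative - 2 * kernel_dzz (of_real
      v)) (at z within S)"
    by (rule DERIV_cmult[OF DERIV_kernel_dz])
  from DERIV_quotient_power[OF this DERIV_kernel kernel_nonzero[OF z] rho_nonzero, where k = 3]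
  show ?thesis unfolding area_density_dz_def area_density_dzz_def
    by (rule DERIV_cong) (simp add: power2_eq_square algebra_simps eval_nat_numeral)
qed

definition A_deriv :: "complex \<Rightarrow> complex" where "A_deriv z = torus_int (area_density_dz z)"
definition A_deriv2 :: "complex \<Rightarrow> complex" where "A_deriv2 z = torus_int (area_density_dzz z)"

lemma DERIV_A: "z \<in> small_disc \<Longrightarrow> (A has_field_derivative A_deriv z) (at z)"
  using torus_int_has_field_derivative[OF continuous_on_area_density(1,2) DERIV_area_density, of z]
  unfolding A_eq[abs_def] A_deriv_def area_density_def by (simp add: at_within_open[of z small_disc])

lemma DERIV_A_deriv: "z \<in> small_disc \<Longrightarrow> (A_deriv has_field_derivative A_deriv2 z) (at z)"
  using torus_int_has_field_derivative[OF continuous_on_area_density(2,3) DERIV_area_density_dz, of z]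
  unfolding A_deriv_def[abs_def] A_deriv2_def by (simp add: at_within_open[of z small_disc])

text \<open>The factor \<open>sin u\<close> of the primitive yields a derivative containing only
  sin^2 u = 1 - cos^2 u, so the certificates need just the variables cos u and
  \<open>conf_sin v\<close>. The factor \<open>conf_cos v\<close> does the same in
  \<open>DERIV_outer\<close>.\<close>

lemma DERIV_inner:
  assumes "(a has_field_derivative - sin u * a') (at u)" "E = (\<lambda>u. kernel z u v)" "E u \<noteq> 0" "r
      \<noteq> 0"
  shows "((\<lambda>u. sin u * a u / (r * E u ^ k)) has_field_derivative
     ((cos u * a u - (1 - (cos u)\<^sup>2) * a') * E u + of_nat (2 * k) * z * (1 - (cos u)\<^sup>2) * a u) / (r
         * E u ^ Suc k)) (at u)"
proof -
  have E: "(E has_field_derivative - 2 * z * sin u) (at u)"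
    unfolding assms(2) kernel_def by (auto intro!: derivative_eq_intros)
  have N: "((\<lambda>u. sin u * a u) has_field_derivative cos u * a u + sin u * (- sin u * a')) (at u)"
    by (auto intro!: derivative_eq_intros assms(1))
  have sq: "1 - (cos u)\<^sup>2 = sin u * sin u" by (simp add: sin_squared_eq flip: power2_eq_square)
  show ?thesis unfolding sq
    by (rule DERIV_cong[OF DERIV_quotient_power[OF N E assms(3,4), of k]]) (simp add: algebra_simps)
qed

lemma DERIV_outer:
  assumes "(b has_field_derivative b' * (conf_cos v / rho v)) (at v)" "E = (\<lambda>v. kernel z u v)" "E v
      \<noteq> 0" "rho v \<noteq> 0"
  shows "((\<lambda>v. conf_cos v * b v / E v ^ k) has_field_derivative
     ((- conf_sin v * b v + (1 - (conf_sin v)\<^sup>2) * b') * E v + of_nat k * (1 - z\<^sup>2) * (1 -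
         (conf_sin v)\<^sup>2) * b v) /
       (rho v * E v ^ Suc k)) (at v)"
proof -
  have E: "(E has_field_derivative - (1 - z\<^sup>2) * (conf_cos v / rho v)) (at v)"
    unfolding assms(2) kernel_def
    by (rule derivative_eq_intros DERIV_conf_sin assms refl)+ (simp add: diff_divide_distrib algebra_simps)
  have N: "((\<lambda>v. conf_cos v * b v) has_field_derivative
      (- conf_sin v / rho v) * b v + conf_cos v * (b' * (conf_cos v / rho v))) (at v)"
    using DERIV_mult[OF DERIV_conf_cos[OF assms(4)] assms(1)] by (simp add: algebra_simps)
  have conf_cos: "1 - (conf_sin v)\<^sup>2 = conf_cos v * conf_cos v"
    using conf_sin_cos[OF assms(4)] by (simp add: algebra_simps power2_eq_square)
  have "((- conf_sin v / rho v * b v + conf_cos v * (b' * (conf_cos v / rho v))) * E v -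
       of_nat k * (conf_cos v * b v) * (- (1 - z\<^sup>2) * (conf_cos v / rho v))) / (1 * E v ^ Suc k) =
     ((- conf_sin v * b v + (1 - (conf_sin v)\<^sup>2) * b') * E v + of_nat k * (1 - z\<^sup>2) * (1 -
         (conf_sin v)\<^sup>2) * b v) /
       (rho v * E v ^ Suc k)"
    unfolding conf_cos using assms(3,4) by (simp add: divide_simps) (simp add: algebra_simps)
  with DERIV_quotient_power[OF N E assms(3) one_neq_zero, of k] show ?thesis by simp
qed

definition ode_a :: "complex \<Rightarrow> complex \<Rightarrow> complex \<Rightarrow> complex" where
  "ode_a z x y = (4 * z - 20 * z ^ 3 - 408 * z ^ 5 + 408 * z ^ 7 + 20 * z ^ 9 - 4 * z ^ 11) + (24 * z ^ 3 - 24
      * z ^ 5 - 24 * z ^ 7 + 24 * z ^ 9) * root2 * y + (- 72 * z ^ 3 + 216 * z ^ 5 - 216 * z ^ 7 + 72 * z ^ 9)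
      * y ^ 2 + (- 144 * z ^ 4 + 144 * z ^ 8) * root2 * x + (- 96 * z ^ 5 + 96 * z ^ 7) * x ^ 2"

definition ode_a_x :: "complex \<Rightarrow> complex \<Rightarrow> complex \<Rightarrow> complex" where
  "ode_a_x z x y = (- 144 * z ^ 4 + 144 * z ^ 8) * root2 + (- 192 * z ^ 5 + 192 * z ^ 7) * x"

definition ode_b :: "complex \<Rightarrow> complex \<Rightarrow> complex \<Rightarrow> complex" where
  "ode_b z x y = (56 * z ^ 2 - 224 * z ^ 4 + 208 * z ^ 6 - 224 * z ^ 8 + 56 * z ^ 10) + (- 36 * z ^ 2 + 72 * z
      ^ 4 - 72 * z ^ 8 + 36 * z ^ 10) * root2 * y + (12 * z ^ 2 - 48 * z ^ 4 + 72 * z ^ 6 - 48 * z ^ 8 + 12 * z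
      ^ 10) * y ^ 2 + (24 * z ^ 3 - 24 * z ^ 5 - 24 * z ^ 7 + 24 * z ^ 9) * root2 * x + (144 * z ^ 4 - 288 * z
      ^ 6 + 144 * z ^ 8) * x ^ 2"

definition ode_b_y :: "complex \<Rightarrow> complex \<Rightarrow> complex \<Rightarrow> complex" where
  "ode_b_y z x y = (- 36 * z ^ 2 + 72 * z ^ 4 - 72 * z ^ 8 + 36 * z ^ 10) * root2 + (24 * z ^ 2 - 96 * z ^ 4 +
      144 * z ^ 6 - 96 * z ^ 8 + 24 * z ^ 10) * y"

lemma DERIV_ode_a: "((\<lambda>u. ode_a z (cos u) y) has_field_derivative - sin u * ode_a_x z (cos u) y) (at u)"
  unfolding ode_a_def ode_a_x_def by (auto intro!: derivative_eq_intros simp: algebra_simps)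

lemma DERIV_ode_b:
  "rho v \<noteq> 0 \<Longrightarrow> ((\<lambda>v. ode_b z x (conf_sin v)) has_field_derivative ode_b_y z x
      (conf_sin v) * (conf_cos v / rho v)) (at v)"
  unfolding ode_b_def ode_b_y_def by (auto intro!: derivative_eq_intros DERIV_conf_sin[THEN DERIV_cong] simp:
      algebra_simps)

definition vol_a :: "complex \<Rightarrow> complex \<Rightarrow> complex \<Rightarrow> complex" where
  "vol_a z x y = (4 * z ^ 2 + 4 * z ^ 4) * root2 + (- 1 - 4 * z ^ 2 + z ^ 4) * y + (4 * z ^ 3) * x"

definition vol_a_x :: "complex \<Rightarrow> complex \<Rightarrow> complex \<Rightarrow> complex" where
  "vol_a_x z x y = (4 * z ^ 3)"

definition vol_b :: "complex \<Rightarrow> complex \<Rightarrow> complex \<Rightarrow> complex" where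
  "vol_b z x y = (- 2 * z + 2 * z ^ 5) * root2 + (z - 2 * z ^ 3 + z ^ 5) * y + (1 + 3 * z ^ 4) * x"

definition vol_b_y :: "complex \<Rightarrow> complex \<Rightarrow> complex \<Rightarrow> complex" where
  "vol_b_y z x y = (z - 2 * z ^ 3 + z ^ 5)"

lemma DERIV_vol_a: "((\<lambda>u. vol_a z (cos u) y) has_field_derivative - sin u * vol_a_x z (cos u) y) (at u)"
  unfolding vol_a_def vol_a_x_def by (auto intro!: derivative_eq_intros simp: algebra_simps)

lemma DERIV_vol_b:
  "rho v \<noteq> 0 \<Longrightarrow> ((\<lambda>v. vol_b z x (conf_sin v)) has_field_derivative vol_b_y z x
      (conf_sin v) * (conf_cos v / rho v)) (at v)"
  unfolding vol_b_def vol_b_y_def by (auto intro!: derivative_eq_intros DERIV_conf_sin[THEN DERIV_cong] simp: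
      algebra_simps)

text \<open>In the variables u and \<phi> the integrand is the u-derivative of sin u a / E^k plus
  the \<phi>-derivative of cos \<phi> b / E^k; the common factor \<open>1 / \<rho>\<close> converts
  d\<phi> into dv.\<close>

lemma torus_int_forms:
  assumes z: "norm z < 1 / 10" and k: "k > 0"
    and a: "\<And>u y. ((\<lambda>u. a (cos u) y) has_field_derivative - sin u * a' (cos u) y) (at u)"
    and b: "\<And>v x. rho v \<noteq> 0 \<Longrightarrow> ((\<lambda>v. b x (conf_sin v)) has_field_derivative
        b' x (conf_sin v) * (conf_cos v / rho v)) (at v)"
    and cont: "continuous_on UNIV (\<lambda>(x, y). a x y)" "continuous_on UNIV (\<lambda>(x, y). a' x y)"
      "continuous_on UNIV (\<lambda>(x, y). b x y)" "continuous_on UNIV (\<lambda>(x, y). b' x y)"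
  shows "torus_int (\<lambda>u v. (let x = cos (of_real u); y = conf_sin (of_real v); E = kernel z (of_real u)
      (of_real v) in
     (((x * a x y - (1 - x\<^sup>2) * a' x y) * E + of_nat (2 * k) * z * (1 - x\<^sup>2) * a x y) +
      ((- y * b x y + (1 - y\<^sup>2) * b' x y) * E + of_nat k * (1 - z\<^sup>2) * (1 - y\<^sup>2) * b x y)) /
     (rho (of_real v) * E ^ Suc k))) = 0"
proof -
  define g where "g u v = (let x = cos (of_real u); y = conf_sin (of_real v); E = kernel z (of_real u) (of_real v) in
     ((x * a x y - (1 - x\<^sup>2) * a' x y) * E + of_nat (2 * k) * z * (1 - x\<^sup>2) * a x y) / (rho
         (of_real v) * E ^ Suc k))" for u v
  define h where "h u v = (let x = cos (of_real u); y = conf_sin (of_real v); E = kernel z (of_real u) (of_real v) in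
     ((- y * b x y + (1 - y\<^sup>2) * b' x y) * E + of_nat k * (1 - z\<^sup>2) * (1 - y\<^sup>2) * b x y) /
         (rho (of_real v) * E ^ Suc k))" for u v
  have "continuous_on (period \<times> period) (\<lambda>p. w (cos (complex_of_real (snd p))) (conf_sin
      (of_real (fst p))))"
    if "continuous_on UNIV (\<lambda>(x, y). w x y :: complex)" for w
  proof -
    have "continuous_on (period \<times> period) (\<lambda>p. (cos (complex_of_real (snd p)), conf_sin (of_real
        (fst p))))"
      by (intro continuous_intros)
    from continuous_on_compose2[OF that this] show ?thesis by simp
  qed
  note ci = this[OF cont(1)] this[OF cont(2)] this[OF cont(3)] this[OF cont(4)]
  define a1 a2 b1 b2 where ab_def: "a1 = (\<lambda>p. a (cos (complex_of_real (snd p))) (conf_sin (of_real (fst p))))"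
    "a2 = (\<lambda>p. a' (cos (complex_of_real (snd p))) (conf_sin (of_real (fst p))))"
    "b1 = (\<lambda>p. b (cos (complex_of_real (snd p))) (conf_sin (of_real (fst p))))"
    "b2 = (\<lambda>p. b' (cos (complex_of_real (snd p))) (conf_sin (of_real (fst p))))"
  note ci = ci[folded ab_def]
  have "torus_int (\<lambda>u v. g u v + h u v) = 0"
  proof (rule torus_int_exact)
    show "((\<lambda>u. sin u * a (cos u) (conf_sin (of_real v)) / (rho (of_real v) * kernel z u (of_real v) ^
        k)) has_field_derivative g u v)
      (at (of_real u))" for u v
      unfolding g_def Let_def by (rule DERIV_inner[OF a refl kernel_nonzero[OF z] rho_nonzero])
    show "((\<lambda>v. conf_cos v * b (cos (of_real u)) (conf_sin v) / kernel z (of_real u) v ^ k)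
        has_field_derivative h u v)
      (at (of_real v))" for u v
      unfolding h_def Let_def by (rule DERIV_outer[OF b refl kernel_nonzero[OF z] rho_nonzero]) simp
    have "(\<lambda>(v, u). g u v) = (\<lambda>p. ((cos (of_real (snd p)) * a1 p - (1 - (cos (of_real (snd
        p)))\<^sup>2) * a2 p) *
        kernel z (of_real (snd p)) (of_real (fst p)) + of_nat (2 * k) * z * (1 - (cos (of_real (snd
            p)))\<^sup>2) * a1 p) /
        (rho (of_real (fst p)) * kernel z (of_real (snd p)) (of_real (fst p)) ^ Suc k))"
      unfolding g_def Let_def ab_def case_prod_beta by (rule refl)
    then show "continuous_on (period \<times> period) (\<lambda>(v, u). g u v)"
      by (rule ssubst) (intro ci continuous_intros ballI, auto simp: kernel_nonzero[OF z])
    have "(\<lambda>(v, u). h u v) = (\<lambda>p. ((- conf_sin (of_real (fst p)) * b1 p + (1 - (conf_sin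
        (of_real (fst p)))\<^sup>2) * b2 p) *
        kernel z (of_real (snd p)) (of_real (fst p)) + of_nat k * (1 - z\<^sup>2) * (1 - (conf_sin (of_real
            (fst p)))\<^sup>2) * b1 p) /
        (rho (of_real (fst p)) * kernel z (of_real (snd p)) (of_real (fst p)) ^ Suc k))"
      unfolding h_def Let_def ab_def case_prod_beta by (rule refl)
    then show "continuous_on (period \<times> period) (\<lambda>(v, u). h u v)"
      by (rule ssubst) (intro ci continuous_intros ballI, auto simp: kernel_nonzero[OF z])
    have sin: "sin (complex_of_real (2 * pi)) = 0" by (simp only: sin_of_real sin_two_pi of_real_0)
    have cos: "cos (complex_of_real (2 * pi)) = 1" by (simp only: cos_of_real cos_two_pi of_real_1)
    have per: "conf_sin (of_real (2 * pi)) = conf_sin 0" "conf_cos (of_real (2 * pi)) = conf_cos 0"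
      unfolding conf_sin_def conf_cos_def rho_def sin cos by simp_all
    then show "conf_cos (of_real (2 * pi)) * b (cos (of_real u)) (conf_sin (of_real (2 * pi))) /
        kernel z (of_real u) (of_real (2 * pi)) ^ k =
      conf_cos 0 * b (cos (of_real u)) (conf_sin 0) / kernel z (of_real u) 0 ^ k" for u
      unfolding kernel_def by (simp only:)
    show "sin (of_real (2 * pi)) * a (cos (of_real (2 * pi))) (conf_sin (of_real v)) /
        (rho (of_real v) * kernel z (of_real (2 * pi)) (of_real v) ^ k) =
      sin 0 * a (cos 0) (conf_sin (of_real v)) / (rho (of_real v) * kernel z 0 (of_real v) ^ k)" for v
      unfolding sin by simp
  qed
  then show ?thesis by (simp add: g_def h_def Let_def add_divide_distrib)
qed

text \<open>With \<theta> = z d/dz the three terms belong to A, \<theta> A and \<theta>^2 A, the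
  last being z A' + z^2 A''. The equation is \<open>ode_certificate\<close> divided by
  \<open>\<rho> E^4\<close> and integrated.\<close>

lemma A_ode:
  assumes z: "z \<in> small_disc"
  shows "(52 * z ^ 2 - 172 * z ^ 4 - 4 * z ^ 6 + 44 * z ^ 8 + 16 * z ^ 10) * A z + (44 * z ^ 2 - 20 * z ^ 4 -
      68 * z ^ 6 + 4 * z ^ 8 + 8 * z ^ 10) * (z * A_deriv z) +
    (- 1 + 5 * z ^ 2 + 6 * z ^ 4 - 6 * z ^ 6 - 5 * z ^ 8 + z ^ 10) * (z * A_deriv z + z\<^sup>2 * A_deriv2 z) = 0"
proof -
  define c0 where "c0 = (52 * z ^ 2 - 172 * z ^ 4 - 4 * z ^ 6 + 44 * z ^ 8 + 16 * z ^ 10)"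
  define c1 where "c1 = (44 * z ^ 2 - 20 * z ^ 4 - 68 * z ^ 6 + 4 * z ^ 8 + 8 * z ^ 10)"
  define c2 where "c2 = (- 1 + 5 * z ^ 2 + 6 * z ^ 4 - 6 * z ^ 6 - 5 * z ^ 8 + z ^ 10)"
  have nz: "norm z < 1 / 10" using z by simp
  let ?form = "\<lambda>u v :: real. (let x = cos (of_real u); y = conf_sin (of_real v); E = kernel z (of_real
      u) (of_real v) in
     (((x * ode_a z x y - (1 - x\<^sup>2) * ode_a_x z x y) * E + of_nat (2 * 3) * z * (1 - x\<^sup>2) * ode_a z x y) +
      ((- y * ode_b z x y + (1 - y\<^sup>2) * ode_b_y z x y) * E + of_nat 3 * (1 - z\<^sup>2) * (1 - y\<^sup>2)
          * ode_b z x y)) /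
     (rho (of_real v) * E ^ Suc 3))"
  have "torus_int ?form = 0"
    by (rule torus_int_forms[OF nz _ DERIV_ode_a DERIV_ode_b])
      (auto simp: ode_a_def ode_a_x_def ode_b_def ode_b_y_def case_prod_beta intro!: continuous_intros)
  also have "?form =
    (\<lambda>u v. c0 * area_density z u v + ((c1 + c2) * z * area_density_dz z u v + c2 * z\<^sup>2 *
        area_density_dzz z u v))"
  proof (intro ext)
    fix u v :: real
    define x y E E1 E2 where "x = cos (complex_of_real u)" and "y = conf_sin (of_real v)"
      and "E = kernel z (of_real u) (of_real v)" and "E1 = kernel_dz z (of_real u) (of_real v)"
      and "E2 = kernel_dzz (of_real v)"
    have E: "E = root2 * (1 + z\<^sup>2) + 2 * z * x - (1 - z\<^sup>2) * y" and E1: "E1 = 2 * root2 * z + 2 * x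
        + 2 * z * y"
      and E2: "E2 = 2 * root2 + 2 * y"
      unfolding E_def E1_def E2_def x_def y_def kernel_def kernel_dz_def kernel_dzz_def by simp_all
    note cert = ode_certificate[OF root2_sq(2) E E1 E2 ode_a_def ode_a_x_def ode_b_def ode_b_y_def,
      folded c0_def c1_def c2_def]
    have num: "of_nat (2 * 3) = (6 :: complex)" "of_nat 3 = (3 :: complex)" by simp_all
    have "E \<noteq> 0" using kernel_nonzero[OF nz] by (simp add: E_def)
    then have "c0 * area_density z u v + ((c1 + c2) * z * area_density_dz z u v + c2 * z\<^sup>2 *
        area_density_dzz z u v) =
      (c0 * E\<^sup>2 + c1 * (- 2 * z * E1 * E) + c2 * (- 2 * z * E1 * E + z\<^sup>2 * (6 * E1\<^sup>2 - 2 * E2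
          * E))) /
        (rho (of_real v) * E ^ Suc 3)"
      unfolding area_density_def area_density_dz_def area_density_dzz_def E_def[symmetric] E1_def[symmetric]
          E2_def[symmetric]
      by (simp add: divide_simps eval_nat_numeral) (simp add: algebra_simps)
    then show "?form u v = c0 * area_density z u v + ((c1 + c2) * z * area_density_dz z u v + c2 * z\<^sup>2 *
        area_density_dzz z u v)"
      unfolding Let_def x_def[symmetric] y_def[symmetric] E_def[symmetric] num cert[symmetric] by (rule sym)
  qed
  also have "torus_int \<dots> = c0 * A z + ((c1 + c2) * z * A_deriv z + c2 * z\<^sup>2 * A_deriv2 z)"
    using torus_int_lincomb[OF continuous_on_area_density_slice[OF z]] by (simp add: A_eq A_deriv_def
        A_deriv2_def area_density_def)
  finally show ?thesis unfolding c0_def[symmetric] c1_def[symmetric] c2_def[symmetric]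
    by (simp add: algebra_simps)
qed

section \<open>Reduction of the volume to a boundary integral\<close>

text \<open>Here \<open>x\<close>, \<open>d\<close>, \<open>s\<close>, \<open>c\<close> stand for
  cos u, sin u, sin v, cos v. The field (z p + e_1) / Q^3 at the point p has divergence - 3 z / Q^3,
  since Q is z^2 times the squared distance from - e_1 / z. The three groups on the right are its
  r-, u- and v-parts, taken with the volume element r R and multiplied by - Q^4.\<close>

lemma divergence_certificate:
  fixes t s c x d z r :: complex
  assumes t: "t\<^sup>2 = 2" and c: "c\<^sup>2 = 1 - s\<^sup>2" and d: "d\<^sup>2 = 1 - x\<^sup>2"
    and R: "R = t + r * s"
    and q: "q = 1 + 2 * R * x * z + (2 + 2 * t * r * s + r\<^sup>2) * z\<^sup>2"
  shows "3 * z * (r * R) * q =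
    - (((R + r * s) * (z * (t * s + r) + s * x) + r * R * z) * q -
        3 * (r * R * (z * (t * s + r) + s * x)) * (2 * s * x * z + (2 * t * s + 2 * r) * z\<^sup>2)) +
    ((r * x * q - 3 * (r * d) * (- 2 * R * d * z)) -
     ((r * c * c - R * s) * (z * t + x) * q - 3 * (R * c * (z * t + x)) * (2 * r * c * x * z + 2 * t * r * c *
         z\<^sup>2)))"
proof -
  have d2: "d * d = 1 - x\<^sup>2" and c2: "c * c = 1 - s\<^sup>2" using d c by (simp_all add: power2_eq_square)
  have "3 * (r * d) * (- 2 * R * d * z) = - 6 * r * R * z * (d * d)"
    "r * c * c - R * s = r * (c * c) - R * s"
    "3 * (R * c * (z * t + x)) * (2 * r * c * x * z + 2 * t * r * c * z\<^sup>2) =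
     3 * R * (z * t + x) * (2 * r * x * z + 2 * t * r * z\<^sup>2) * (c * c)" by algebra+
  then show ?thesis unfolding d2 c2 q R using t by algebra
qed

lemma continuous_on_Q_polar [continuous_intros]:
  "continuous_on S (g :: 'a::t2_space \<Rightarrow> complex) \<Longrightarrow> continuous_on S k
      \<Longrightarrow> continuous_on S f \<Longrightarrow> continuous_on S h \<Longrightarrow>
   continuous_on S (\<lambda>x. Q_polar (g x) (of_real (k x)) (of_real (f x)) (of_real (h x)))"
  unfolding Q_polar_def by (intro continuous_intros)

definition rho_polar :: "complex \<Rightarrow> complex \<Rightarrow> complex" where "rho_polar r v = root2 + r
    * sin v"

text \<open>\<open>- flux_num / (3 z Q\<^sup>3)\<close> is the radial component, times the surface element, of
    a field of divergence \<open>1 / Q\<^sup>3\<close>.\<close>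

definition flux_num :: "complex \<Rightarrow> complex \<Rightarrow> complex \<Rightarrow> complex \<Rightarrow>
    complex" where
  "flux_num z r u v = r * rho_polar r v * (z * (root2 * sin v + r) + sin v * cos u)"

definition flux_deriv :: "complex \<Rightarrow> complex \<Rightarrow> complex \<Rightarrow> complex
    \<Rightarrow> complex" where
  "flux_deriv z r u v = (((rho_polar r v + r * sin v) * (z * (root2 * sin v + r) + sin v * cos u) + r *
      rho_polar r v * z) * Q_polar z r u v -
     3 * flux_num z r u v * (2 * sin v * cos u * z + (2 * root2 * sin v + 2 * r) * z\<^sup>2)) / Q_polar z r u v ^ 4"

text \<open>\<open>u_deriv\<close> and \<open>v_deriv\<close> are the angular parts of the same
  divergence with the sign reversed. As derivatives of periodic functions they integrate to
  zero.\<close>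

definition u_deriv :: "complex \<Rightarrow> complex \<Rightarrow> complex \<Rightarrow> complex \<Rightarrow>
    complex" where
  "u_deriv z r u v = (r * cos u * Q_polar z r u v - 3 * (r * sin u) * (- 2 * rho_polar r v * sin u * z)) /
      Q_polar z r u v ^ 4"

definition v_deriv :: "complex \<Rightarrow> complex \<Rightarrow> complex \<Rightarrow> complex \<Rightarrow>
    complex" where
  "v_deriv z r u v = - (((r * cos v * cos v - rho_polar r v * sin v) * (z * root2 + cos u) * Q_polar z r u v -
     3 * (rho_polar r v * cos v * (z * root2 + cos u)) * (2 * r * cos v * cos u * z + 2 * root2 * r * cos v *
         z\<^sup>2)) / Q_polar z r u v ^ 4)"

lemma divergence_identity:
  assumes "Q_polar z r u v \<noteq> 0"
  shows "3 * z * (r * rho_polar r v / Q_polar z r u v ^ 3) = - flux_deriv z r u v + (u_deriv z r u v + v_deriv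
      z r u v)"
proof -
  note cert = divergence_certificate[OF root2_sq(2) cos_squared_eq[of v] sin_squared_eq[of u] rho_polar_def[of r v],
    where q = "Q_polar z r u v" and z = z]
  have "Q_polar z r u v = 1 + 2 * rho_polar r v * cos u * z + (2 + 2 * root2 * r * sin v + r\<^sup>2) * z\<^sup>2"
    by (simp add: Q_polar_def rho_polar_def)
  note cert = cert[OF this]
  have split: "(- a + (b - c)) / d = - (a / d) + (b / d + - (c / d))" for a b c d :: complex
    by (simp add: add_divide_distrib diff_divide_distrib)
  have "3 * z * (r * rho_polar r v / Q_polar z r u v ^ 3) = 3 * z * (r * rho_polar r v) * Q_polar z r u v /
      Q_polar z r u v ^ 4"
    using assms by (simp add: divide_simps eval_nat_numeral)
  also have "\<dots> = - flux_deriv z r u v + (u_deriv z r u v + v_deriv z r u v)"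
    unfolding cert flux_deriv_def u_deriv_def v_deriv_def flux_num_def
    by (rule split)
  finally show ?thesis .
qed

lemma DERIV_flux:
  assumes "Q_polar z r u v \<noteq> 0"
  shows "((\<lambda>r. flux_num z r u v / Q_polar z r u v ^ 3) has_field_derivative flux_deriv z r u v) (at r)"
proof -
  have N: "((\<lambda>r. flux_num z r u v) has_field_derivative
      (rho_polar r v + r * sin v) * (z * (root2 * sin v + r) + sin v * cos u) + r * rho_polar r v * z) (at r)"
    unfolding flux_num_def rho_polar_def by (auto intro!: derivative_eq_intros simp: algebra_simps)
  have E: "((\<lambda>r. Q_polar z r u v) has_field_derivative 2 * sin v * cos u * z + (2 * root2 * sin v + 2 *
      r) * z\<^sup>2) (at r)"
    unfolding Q_polar_def by (auto intro!: derivative_eq_intros simp: algebra_simps)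
  from DERIV_quotient_power[OF N E assms one_neq_zero, of 3] show ?thesis
    by (simp add: flux_deriv_def)
qed

lemma DERIV_u:
  assumes "Q_polar z r u v \<noteq> 0"
  shows "((\<lambda>u. r * sin u / Q_polar z r u v ^ 3) has_field_derivative u_deriv z r u v) (at u)"
proof -
  have N: "((\<lambda>u. r * sin u) has_field_derivative r * cos u) (at u)"
    by (auto intro!: derivative_eq_intros)
  have E: "((\<lambda>u. Q_polar z r u v) has_field_derivative - 2 * rho_polar r v * sin u * z) (at u)"
    unfolding Q_polar_def rho_polar_def by (auto intro!: derivative_eq_intros simp: algebra_simps)
  from DERIV_quotient_power[OF N E assms one_neq_zero, of 3] show ?thesis
    by (simp add: u_deriv_def)
qed

lemma DERIV_v:
  assumes "Q_polar z r u v \<noteq> 0"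
  shows "((\<lambda>v. - (rho_polar r v * cos v * (z * root2 + cos u) / Q_polar z r u v ^ 3))
      has_field_derivative v_deriv z r u v) (at v)"
proof -
  have N: "((\<lambda>v. rho_polar r v * cos v * (z * root2 + cos u)) has_field_derivative
     (r * cos v * cos v - rho_polar r v * sin v) * (z * root2 + cos u)) (at v)"
    unfolding rho_polar_def by (auto intro!: derivative_eq_intros simp: algebra_simps)
  have E: "((\<lambda>v. Q_polar z r u v) has_field_derivative 2 * r * cos v * cos u * z + 2 * root2 * r * cos
      v * z\<^sup>2) (at v)"
    unfolding Q_polar_def by (auto intro!: derivative_eq_intros simp: algebra_simps)
  from DERIV_minus[OF DERIV_quotient_power[OF N E assms one_neq_zero, of 3]] show ?thesis
    by (simp add: v_deriv_def)
qed

definition V_density :: "complex \<Rightarrow> real \<Rightarrow> real \<Rightarrow> real \<Rightarrow> complex" where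
  "V_density z r u v = of_real r * rho_polar (of_real r) (of_real v) / Q_polar z (of_real r) (of_real u)
      (of_real v) ^ 3"

lemma V_eq: "V z = integral {0..1} (\<lambda>r. torus_int (V_density z r))"
  unfolding V_def torus_int_def V_density_def Q_torus_pt rho_polar_def by (simp flip: sin_of_real)

lemma continuous_on_rho_polar [continuous_intros]:
  "continuous_on S (k :: 'a::t2_space \<Rightarrow> real) \<Longrightarrow> continuous_on S h \<Longrightarrow>
   continuous_on S (\<lambda>x. rho_polar (of_real (k x)) (of_real (h x)))"
  unfolding rho_polar_def by (intro continuous_intros)

text \<open>The angular parts vanish by periodicity, and integrating the radial part leaves its
  values at r = 1 and r = 0. The latter is zero because \<open>flux_num\<close> has the factor
  \<open>r\<close>.\<close>

lemma boundary_flux: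
  assumes z: "z \<in> small_disc"
  shows "3 * z * V z = - torus_int (\<lambda>u v. (z * conf_sin (of_real v) + (root2 * conf_sin (of_real v) -
      1) * cos (of_real u)) /
      (rho (of_real v) * kernel z (of_real u) (of_real v) ^ 3))"
proof -
  have nz: "Q_polar z (of_real r) (of_real u) (of_real v) \<noteq> 0" if "r \<in> {0..1}" for r u v
    using that z Q_polar_nonzero[of z r u v] by simp
  define X where "X r u v = flux_num z (of_real r) (of_real u) (of_real v) / Q_polar z (of_real r) (of_real u)
      (of_real v) ^ 3"
    for r u v :: real
  define X' where "X' r u v = flux_deriv z (of_real r) (of_real u) (of_real v)" for r u v :: real
  have contX: "continuous_on ({0..1} \<times> period \<times> period) (\<lambda>(r, v, u). X r u v)"
    unfolding X_def flux_num_def case_prod_beta by (intro continuous_intros ballI) (auto simp: nz)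
  have contX': "continuous_on ({0..1} \<times> period \<times> period) (\<lambda>(r, v, u). X' r u v)"
    unfolding X'_def flux_deriv_def flux_num_def case_prod_beta
    by (intro continuous_intros ballI) (auto simp: nz)
  have deriv: "((\<lambda>r. torus_int (X r)) has_vector_derivative torus_int (X' r)) (at r within {0..1})" if
      "r \<in> {0..1}" for r
  proof (rule torus_int_has_vector_derivative[OF contX contX' _ _ that])
    show "((\<lambda>r. X r u v) has_vector_derivative X' r u v) (at r within {0..1})" if "r \<in> {0..1}" for r u v
      unfolding X_def X'_def
      by (rule has_vector_derivative_real_field[where f = "\<lambda>r. flux_num z r (of_real u) (of_real v) /
        Q_polar z r (of_real u) (of_real v) ^ 3", OF DERIV_flux[OF nz[OF that]]])
  qed simp
  have exact: "3 * z * torus_int (V_density z r) = - torus_int (X' r)" if r: "r \<in> {0..1}" for r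
  proof -
    define g where "g u v = u_deriv z (of_real r) (of_real u) (of_real v)" for u v :: real
    define h where "h u v = v_deriv z (of_real r) (of_real u) (of_real v)" for u v :: real
    have cg: "continuous_on (period \<times> period) (\<lambda>(v, u). g u v)"
      unfolding g_def u_deriv_def case_prod_beta by (intro continuous_intros ballI) (auto simp: nz[OF r])
    have ch: "continuous_on (period \<times> period) (\<lambda>(v, u). h u v)"
      unfolding h_def v_deriv_def case_prod_beta by (intro continuous_intros ballI) (auto simp: nz[OF r])
    have sin: "sin (complex_of_real (2 * pi)) = 0" by (simp only: sin_of_real sin_two_pi of_real_0)
    have cos: "cos (complex_of_real (2 * pi)) = 1" by (simp only: cos_of_real cos_two_pi of_real_1)
    have "torus_int (\<lambda>u v. g u v + h u v) = 0"
    proof (rule torus_int_exact[OF _ _ _ _ cg ch])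
      show "((\<lambda>u. of_real r * sin u / Q_polar z (of_real r) u (of_real v) ^ 3) has_field_derivative g u
          v) (at (of_real u))" for u v
        unfolding g_def by (rule DERIV_u[OF nz[OF r]])
      show "((\<lambda>v. - (rho_polar (of_real r) v * cos v * (z * root2 + cos (of_real u)) / Q_polar z
          (of_real r) (of_real u) v ^ 3))
         has_field_derivative h u v) (at (of_real v))" for u v
        unfolding h_def by (rule DERIV_v[OF nz[OF r]])
      show "of_real r * sin (of_real (2 * pi)) / Q_polar z (of_real r) (of_real (2 * pi)) (of_real v) ^ 3 =
         of_real r * sin 0 / Q_polar z (of_real r) 0 (of_real v) ^ 3" for v
        unfolding sin by simp
      show "- (rho_polar (of_real r) (of_real (2 * pi)) * cos (of_real (2 * pi)) * (z * root2 + cos (of_real u)) /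
          Q_polar z (of_real r) (of_real u) (of_real (2 * pi)) ^ 3) =
        - (rho_polar (of_real r) 0 * cos 0 * (z * root2 + cos (of_real u)) / Q_polar z (of_real r) (of_real u)
            0 ^ 3)" for u
        unfolding Q_polar_def rho_polar_def sin cos by simp
    qed
    moreover have cX: "continuous_on (period \<times> period) (\<lambda>(v, u). - 1 * X' r u v)"
      using continuous_on_slice[OF contX' r] by (intro continuous_on_cmult_case) simp
    moreover have "3 * z * torus_int (V_density z r) = torus_int (\<lambda>u v. - 1 * X' r u v + (g u v + h u v))"
      unfolding torus_int_cmult[symmetric] V_density_def X'_def g_def h_def
      by (intro torus_int_cong) (subst divergence_identity[OF nz[OF r]], simp)
    moreover have cgh: "continuous_on (period \<times> period) (\<lambda>(v, u). g u v + h u v)"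
      using continuous_on_add[OF cg ch] by (simp add: case_prod_beta)
    ultimately show ?thesis
      using torus_int_add[OF cX cgh] torus_int_cmult[of "-1" "X' r"] by simp
  qed
  have "((\<lambda>r. torus_int (X' r)) has_integral torus_int (X 1) - torus_int (X 0)) {0..1}"
    by (rule fundamental_theorem_of_calculus) (auto intro: deriv)
  moreover have "torus_int (X 0) = 0" by (simp add: X_def flux_num_def torus_int_def)
  ultimately have "integral {0..1} (\<lambda>r. torus_int (X' r)) = torus_int (X 1)"
    by (simp add: integral_unique)
  moreover have "3 * z * V z = integral {0..1} (\<lambda>r. - torus_int (X' r))"
    unfolding V_eq integral_mult_right[symmetric] by (rule integral_cong) (simp add: exact)
  ultimately have "3 * z * V z = - torus_int (X 1)" by simp
  also have "torus_int (X 1) = torus_int (\<lambda>u v. (z * conf_sin (of_real v) + (root2 * conf_sin (of_real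
      v) - 1) * cos (of_real u)) /
      (rho (of_real v) * kernel z (of_real u) (of_real v) ^ 3))"
  proof (rule torus_int_cong)
    fix u v :: real
    \<comment> \<open>At r = 1 both sqrt 2 sin v + 1 and sin v are \<open>\<rho>\<close> times a
      linear expression in \<open>conf_sin v\<close>. The numerator thus acquires
      \<open>\<rho>^2\<close> against \<open>\<rho>^3\<close> from Q^3, which leaves the weight
      \<open>1 / \<rho>\<close> of the conformal angle.\<close>
    have y: "rho (of_real v) * conf_sin (of_real v) = 1 + root2 * sin (of_real v)" by (simp add: conf_sin_def)
    then have s: "sin (of_real v) = rho (of_real v) * (root2 * conf_sin (of_real v) - 1)"
    proof -
      have "rho (of_real v) * (root2 * conf_sin (of_real v) - 1) = root2 * (rho (of_real v) * conf_sin (of_real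
          v)) - rho (of_real v)"
        by (simp add: algebra_simps)
      also have "\<dots> = root2 * root2 * sin (of_real v) - sin (of_real v)"
        unfolding y by (simp add: rho_def algebra_simps)
      finally show ?thesis by simp
    qed
    have "flux_num z 1 (of_real u) (of_real v) =
      rho (of_real v) * (z * (rho (of_real v) * conf_sin (of_real v)) + sin (of_real v) * cos (of_real u))"
      unfolding y by (simp add: flux_num_def rho_polar_def rho_def algebra_simps)
    also have "\<dots> = (rho (of_real v))\<^sup>2 * (z * conf_sin (of_real v) + (root2 * conf_sin (of_real v)
        - 1) * cos (of_real u))"
      by (subst s) (simp add: algebra_simps power2_eq_square)
    finally show "X 1 u v = (z * conf_sin (of_real v) + (root2 * conf_sin (of_real v) - 1) * cos (of_real u)) /
      (rho (of_real v) * kernel z (of_real u) (of_real v) ^ 3)"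
      unfolding X_def by (simp add: Q_polar_kernel eval_nat_numeral divide_simps)
  qed
  finally show ?thesis .
qed

definition flux_density :: "complex \<Rightarrow> real \<Rightarrow> real \<Rightarrow> complex" where
  "flux_density z u v = (z * conf_sin (of_real v) + (root2 * conf_sin (of_real v) - 1) * cos (of_real u)) /
      (rho (of_real v) * kernel z (of_real u) (of_real v) ^ 3)"

text \<open>The integrated \<open>volume_certificate\<close>, with the flux replaced by - 3 z V. The
  coefficient of V is 6 z (1 + z^2)^3, hence nonzero for z \<noteq> 0 in the disc, and V is a
  rational combination of A and its derivative.\<close>

lemma V_relation:
  assumes z: "z \<in> small_disc"
  shows "- 3 * (- 2 - 6 * z ^ 2 - 6 * z ^ 4 - 2 * z ^ 6) * (z * V z) + (- 3 * z + 10 * z ^ 3 + 5 * z ^ 5) * A z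
      + (- 2 * z + 2 * z ^ 5) * (z * A_deriv z) = 0"
proof -
  define c0 where "c0 = (- 2 - 6 * z ^ 2 - 6 * z ^ 4 - 2 * z ^ 6)"
  define c1 where "c1 = (- 3 * z + 10 * z ^ 3 + 5 * z ^ 5)"
  define c2 where "c2 = (- 2 * z + 2 * z ^ 5)"
  have nz: "norm z < 1 / 10" using z by simp
  let ?form = "\<lambda>u v :: real. (let x = cos (of_real u); y = conf_sin (of_real v); E = kernel z (of_real
      u) (of_real v) in
     (((x * vol_a z x y - (1 - x\<^sup>2) * vol_a_x z x y) * E + of_nat (2 * 2) * z * (1 - x\<^sup>2) * vol_a z x y) +
      ((- y * vol_b z x y + (1 - y\<^sup>2) * vol_b_y z x y) * E + of_nat 2 * (1 - z\<^sup>2) * (1 - y\<^sup>2)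
          * vol_b z x y)) /
     (rho (of_real v) * E ^ Suc 2))"
  have "torus_int ?form = 0"
    by (rule torus_int_forms[OF nz _ DERIV_vol_a DERIV_vol_b])
      (auto simp: vol_a_def vol_a_x_def vol_b_def vol_b_y_def case_prod_beta intro!: continuous_intros)
  also have "?form =
    (\<lambda>u v. c0 * flux_density z u v + (c1 * area_density z u v + c2 * z * area_density_dz z u v))"
  proof (intro ext)
    fix u v :: real
    define x y E E1 where "x = cos (complex_of_real u)" and "y = conf_sin (of_real v)"
      and "E = kernel z (of_real u) (of_real v)" and "E1 = kernel_dz z (of_real u) (of_real v)"
    have E: "E = root2 * (1 + z\<^sup>2) + 2 * z * x - (1 - z\<^sup>2) * y" and E1: "E1 = 2 * root2 * z + 2 * x
        + 2 * z * y"
      unfolding E_def E1_def x_def y_def kernel_def kernel_dz_def by simp_all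
    note cert = volume_certificate[OF root2_sq(2) E E1 vol_a_def vol_a_x_def vol_b_def vol_b_y_def,
      folded c0_def c1_def c2_def]
    have num: "of_nat (2 * 2) = (4 :: complex)" "of_nat 2 = (2 :: complex)" by simp_all
    have "E \<noteq> 0" using kernel_nonzero[OF nz] by (simp add: E_def)
    then have "c0 * flux_density z u v + (c1 * area_density z u v + c2 * z * area_density_dz z u v) =
      (c0 * (z * y + (root2 * y - 1) * x) + c1 * E + c2 * (- 2 * z * E1)) / (rho (of_real v) * E ^ Suc 2)"
      unfolding flux_density_def area_density_def area_density_dz_def E_def[symmetric] E1_def[symmetric]
          x_def[symmetric] y_def[symmetric]
      by (simp add: divide_simps eval_nat_numeral)
    then show "?form u v = c0 * flux_density z u v + (c1 * area_density z u v + c2 * z * area_density_dz z u v)"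
      unfolding Let_def x_def[symmetric] y_def[symmetric] E_def[symmetric] num cert[symmetric] by (rule sym)
  qed
  also have "torus_int \<dots> = c0 * torus_int (flux_density z) + (c1 * A z + c2 * z * A_deriv z)"
  proof -
    have "continuous_on (period \<times> period) (\<lambda>(v, u). flux_density z u v)"
      unfolding flux_density_def case_prod_beta
      by (intro continuous_intros ballI) (auto simp: kernel_nonzero[OF nz])
    from torus_int_lincomb[OF this continuous_on_area_density_slice(1,2)[OF z]] show ?thesis
      by (simp add: A_eq A_deriv_def area_density_def)
  qed
  also have "torus_int (flux_density z) = - 3 * z * V z"
    using boundary_flux[OF z] by (simp add: flux_density_def[abs_def])
  finally show ?thesis unfolding c0_def[symmetric] c1_def[symmetric] c2_def[symmetric]
    by (simp add: algebra_simps)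
qed

lemma V_holomorphic: "V holomorphic_on small_disc"
proof -
  have nz: "Q_polar z (of_real r) (of_real u) (of_real v) \<noteq> 0" if "z \<in> small_disc" "r \<in> {0..1}"
      for z r u v
    using that Q_polar_nonzero[of z r u v] by simp
  define d where "d z r u v = - 3 * (of_real r * rho_polar (of_real r) (of_real v)) *
     (2 * (root2 + of_real r * sin (of_real v)) * cos (of_real u) + 2 * (2 + 2 * root2 * of_real r * sin
         (of_real v) + (of_real r)\<^sup>2) * z) /
       Q_polar z (of_real r) (of_real u) (of_real v) ^ 4" for z :: complex and r u v :: real
  have contf: "continuous_on ((small_disc \<times> {0..1}) \<times> period \<times> period) (\<lambda>(p, v,
      u). V_density (fst p) (snd p) u v)"
    unfolding V_density_def case_prod_beta by (intro continuous_intros ballI) (auto simp: nz)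
  have contd: "continuous_on ((small_disc \<times> {0..1}) \<times> period \<times> period) (\<lambda>(p, v,
      u). d (fst p) (snd p) u v)"
    unfolding d_def case_prod_beta by (intro continuous_intros ballI) (auto simp: nz)
  have slice: "continuous_on (small_disc \<times> period \<times> period) (\<lambda>(z, v, u). w z r u v)"
    if "continuous_on ((small_disc \<times> {0..1}) \<times> period \<times> period) (\<lambda>(p, v, u). w
        (fst p) (snd p) u v)" "r \<in> {0..1}"
    for w :: "complex \<Rightarrow> real \<Rightarrow> real \<Rightarrow> real \<Rightarrow> complex" and r
  proof -
    have cont: "continuous_on (small_disc \<times> period \<times> period) (\<lambda>q. ((fst q, r), fst (snd
        q), snd (snd q)))"
      by (intro continuous_intros)
    have sub: "(\<lambda>q. ((fst q, r), fst (snd q), snd (snd q))) ` (small_disc \<times> period \<times>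
        period) \<subseteq>
        (small_disc \<times> {0..1}) \<times> period \<times> period" using that(2) by auto
    from continuous_on_compose2[OF that(1) cont sub] show ?thesis by (simp add: case_prod_beta)
  qed
  have D: "((\<lambda>z. torus_int (V_density z r)) has_field_derivative torus_int (d z r)) (at z within small_disc)"
    if "z \<in> small_disc" "r \<in> {0..1}" for z r
  proof (rule torus_int_has_field_derivative[OF slice[OF contf that(2)] slice[OF contd that(2)] _ _ that(1)])
    show "((\<lambda>z. V_density z r u v) has_field_derivative d z r u v) (at z within small_disc)" if "z
        \<in> small_disc" for z u v
    proof -
      have "((\<lambda>z. Q_polar z (of_real r) (of_real u) (of_real v)) has_field_derivative
         2 * (root2 + of_real r * sin (of_real v)) * cos (of_real u) + 2 * (2 + 2 * root2 * of_real r * sin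
             (of_real v) + (of_real r)\<^sup>2) * z)
         (at z within small_disc)"
        unfolding Q_polar_def by (auto intro!: derivative_eq_intros simp: algebra_simps)
      from DERIV_quotient_power[OF DERIV_const this nz[OF that \<open>r \<in> {0..1}\<close>] one_neq_zero,
          where k = 3]
      show ?thesis unfolding V_density_def d_def by simp
    qed
  qed auto
  have "(\<lambda>z. integral (cbox 0 1) (\<lambda>r. torus_int (V_density z r))) field_differentiable at z
      within small_disc"
    if "z \<in> small_disc" for z
  proof (rule leibniz_rule_field_differentiable)
    show "((\<lambda>z. torus_int (V_density z r)) has_field_derivative torus_int (d z r)) (at z within small_disc)"
      if "z \<in> small_disc" "r \<in> cbox 0 1" for z r
      using D[of z r] that by simp
    have c: "continuous_on (small_disc \<times> cbox 0 1) (\<lambda>p. torus_int (w (fst p) (snd p)))"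
      if "continuous_on ((small_disc \<times> {0..1}) \<times> period \<times> period) (\<lambda>(p, v, u). w
          (fst p) (snd p) u v)"
      for w :: "complex \<Rightarrow> real \<Rightarrow> real \<Rightarrow> real \<Rightarrow> complex"
      using torus_int_continuous[OF that] by simp
    show "continuous_on (small_disc \<times> cbox 0 1) (\<lambda>(z, r). torus_int (d z r))"
      using c[OF contd] by (simp add: case_prod_beta)
    show "(\<lambda>r. torus_int (V_density z r)) integrable_on cbox 0 1" if "z \<in> small_disc" for z
      using continuous_on_slice[OF c[OF contf] that] by (auto intro!: integrable_continuous_real)
  qed (use that in auto)
  then show ?thesis unfolding holomorphic_on_def by (simp add: V_eq[abs_def])
qed

section \<open>Power series expansions\<close>

primrec fps_ints_sq :: "int list \<Rightarrow> complex fps" where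
  "fps_ints_sq [] = 0"
| "fps_ints_sq (a # as) = of_int a + fps_X\<^sup>2 * fps_ints_sq as"

text \<open>Polynomials in X^2 pass through \<open>even_part\<close> as polynomials in X, and
  \<open>theta\<close> acquires a factor 2. This carries the relations in z over to the generating
  functions in z^2.\<close>

definition even_part :: "complex fps \<Rightarrow> complex fps" where
  "even_part F = Abs_fps (\<lambda>n. fps_nth F (2 * n))"

lemma even_part_nth [simp]: "fps_nth (even_part F) n = fps_nth F (2 * n)"
  by (simp add: even_part_def)

lemma even_part_add: "even_part (F + G) = even_part F + even_part G"
  by (simp add: fps_eq_iff)

lemma even_part_0 [simp]: "even_part 0 = 0"
  by (simp add: fps_eq_iff)

lemma of_int_mult_nth: "fps_nth (of_int a * F) n = of_int a * fps_nth (F :: complex fps) n"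
  by (simp flip: fps_of_int)

lemma even_part_of_int_mult: "even_part (of_int a * F) = of_int a * even_part F"
  by (simp add: fps_eq_iff of_int_mult_nth)

lemma even_part_X2_mult: "even_part (fps_X\<^sup>2 * F) = fps_X * even_part F"
proof (rule fps_ext)
  show "fps_nth (even_part (fps_X\<^sup>2 * F)) n = fps_nth (fps_X * even_part F) n" for n
    by (cases n) (simp_all add: fps_X_power_mult_nth)
qed

lemma even_part_fps_ints_sq_mult: "even_part (fps_ints_sq l * F) = fps_ints l * even_part F"
  by (induction l) (simp_all add: distrib_right mult.assoc even_part_add even_part_of_int_mult even_part_X2_mult)

lemma even_part_theta: "even_part (theta F) = 2 * theta (even_part F)"
proof (rule fps_ext)
  fix n
  have 2: "(2 :: complex fps) = of_int 2" by simp
  show "fps_nth (even_part (theta F)) n = fps_nth (2 * theta (even_part F)) n"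
    unfolding 2 of_int_mult_nth by (cases n) (simp_all add: theta_def)
qed

primrec horner_complex :: "int list \<Rightarrow> complex \<Rightarrow> complex" where
  "horner_complex [] z = 0"
| "horner_complex (a # as) z = of_int a + z * horner_complex as z"

lemma horner_complex_expansion: "(\<lambda>z. horner_complex l (z\<^sup>2)) has_fps_expansion fps_ints_sq l"
proof (induction l)
  case (Cons a l)
  have "(\<lambda>z. of_int a + z\<^sup>2 * horner_complex l (z\<^sup>2)) has_fps_expansion fps_const (of_int
      a) + fps_X\<^sup>2 * fps_ints_sq l"
    by (intro fps_expansion_intros Cons)
  then show ?case by (simp add: fps_of_int)
qed simp

definition A_fps :: "complex fps" where "A_fps = fps_expansion A 0"
definition V_fps :: "complex fps" where "V_fps = fps_expansion V 0"

lemma eventually_small_disc: "eventually (\<lambda>z. z \<in> small_disc) (nhds 0)"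
  by (rule eventually_nhds_in_open) auto

lemma A_expansion: "A has_fps_expansion A_fps"
proof -
  have hol: "A holomorphic_on small_disc"
    unfolding holomorphic_on_open[OF open_ball] using DERIV_A by blast
  show ?thesis
    unfolding A_fps_def by (rule has_fps_expansion_fps_expansion[OF open_ball _ hol]) simp
qed

lemma V_expansion: "V has_fps_expansion V_fps"
  unfolding V_fps_def by (rule has_fps_expansion_fps_expansion[OF open_ball _ V_holomorphic]) simp

lemma A_deriv_expansion: "A_deriv has_fps_expansion fps_deriv A_fps"
proof -
  have "eventually (\<lambda>z. deriv A z = A_deriv z) (nhds 0)"
    using eventually_small_disc by eventually_elim (rule DERIV_imp_deriv[OF DERIV_A])
  with has_fps_expansion_deriv[OF A_expansion] show ?thesis
    using has_fps_expansion_cong by blast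
qed

lemma A_deriv2_expansion: "A_deriv2 has_fps_expansion fps_deriv (fps_deriv A_fps)"
proof -
  have "eventually (\<lambda>z. deriv A_deriv z = A_deriv2 z) (nhds 0)"
    using eventually_small_disc by eventually_elim (rule DERIV_imp_deriv[OF DERIV_A_deriv])
  with has_fps_expansion_deriv[OF A_deriv_expansion] show ?thesis
    using has_fps_expansion_cong by blast
qed

text \<open>The coefficients of \<open>A_ode\<close> in w = z^2, divided by 4, 2 and 1 because z
  d/dz = 2 w d/dw. The leading one is (w - 1)(w + 1)^2 (w^2 - 6 w + 1); its root (sqrt 2 - 1)^2
  matches the boundary of the disc |z| < sqrt 2 - 1.\<close>

definition ode0 :: "int list" where "ode0 = [0, 13, -43, -1, 11, 4]"
definition ode1 :: "int list" where "ode1 = [0, 22, -10, -34, 2, 4]"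
definition ode2 :: "int list" where "ode2 = [-1, 5, 6, -6, -5, 1]"

lemma A_fps_ode: "4 * fps_ints_sq ode0 * A_fps + 2 * fps_ints_sq ode1 * theta A_fps + fps_ints_sq ode2 * theta
    (theta A_fps) = 0"
proof -
  have "(\<lambda>z. 4 * horner_complex ode0 (z\<^sup>2) * A z + 2 * horner_complex ode1 (z\<^sup>2) * (z *
      A_deriv z) +
      horner_complex ode2 (z\<^sup>2) * (z * A_deriv z + z\<^sup>2 * A_deriv2 z)) has_fps_expansion
    4 * fps_ints_sq ode0 * A_fps + 2 * fps_ints_sq ode1 * (fps_X * fps_deriv A_fps) +
      fps_ints_sq ode2 * (fps_X * fps_deriv A_fps + fps_X\<^sup>2 * fps_deriv (fps_deriv A_fps))"
    by (intro fps_expansion_intros horner_complex_expansion A_expansion A_deriv_expansion A_deriv2_expansion)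
  moreover have ev0: "eventually (\<lambda>z. 4 * horner_complex ode0 (z\<^sup>2) * A z + 2 * horner_complex
      ode1 (z\<^sup>2) * (z * A_deriv z) +
      horner_complex ode2 (z\<^sup>2) * (z * A_deriv z + z\<^sup>2 * A_deriv2 z) = 0) (nhds 0)"
    using eventually_small_disc
  proof eventually_elim
    case (elim z)
    show ?case using A_ode[OF elim]
      by (simp add: ode0_def ode1_def ode2_def algebra_simps eval_nat_numeral)
  qed
  ultimately have "(\<lambda>z. 0) has_fps_expansion 4 * fps_ints_sq ode0 * A_fps + 2 * fps_ints_sq ode1 *
      (fps_X * fps_deriv A_fps) +
      fps_ints_sq ode2 * (fps_X * fps_deriv A_fps + fps_X\<^sup>2 * fps_deriv (fps_deriv A_fps))"
    using has_fps_expansion_cong[OF ev0 refl] by blast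
  from fps_expansion_unique_complex[OF this has_fps_expansion_0] show ?thesis
    by (simp add: theta_def power2_eq_square algebra_simps)
qed

lemma V_fps_relation:
  "6 * fps_ints_sq [1, 3, 3, 1] * V_fps = fps_ints_sq [3, -10, -5] * A_fps + 2 * fps_ints_sq [1, 0, -1] * theta A_fps"
proof -
  \<comment> \<open>The factor \<open>z\<close> of \<open>V_relation\<close> cannot be cancelled
    pointwise at 0. It is kept as \<open>fps_X\<close> and cancelled among power series.\<close>
  have "(\<lambda>z. z * (6 * horner_complex [1, 3, 3, 1] (z\<^sup>2) * V z - (horner_complex [3, -10, -5]
      (z\<^sup>2) * A z +
      2 * horner_complex [1, 0, -1] (z\<^sup>2) * (z * A_deriv z)))) has_fps_expansion
    fps_X * (6 * fps_ints_sq [1, 3, 3, 1] * V_fps - (fps_ints_sq [3, -10, -5] * A_fps + 2 * fps_ints_sq [1, 0,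
        -1] * (fps_X * fps_deriv A_fps)))"
    by (intro fps_expansion_intros horner_complex_expansion A_expansion A_deriv_expansion V_expansion)
  moreover have ev0: "eventually (\<lambda>z. z * (6 * horner_complex [1, 3, 3, 1] (z\<^sup>2) * V z -
      (horner_complex [3, -10, -5] (z\<^sup>2) * A z +
      2 * horner_complex [1, 0, -1] (z\<^sup>2) * (z * A_deriv z))) = 0) (nhds 0)"
    using eventually_small_disc
  proof eventually_elim
    case (elim z)
    show ?case using V_relation[OF elim]
      by (simp add: algebra_simps eval_nat_numeral)
  qed
  ultimately have "(\<lambda>z. 0) has_fps_expansion
    fps_X * (6 * fps_ints_sq [1, 3, 3, 1] * V_fps - (fps_ints_sq [3, -10, -5] * A_fps + 2 * fps_ints_sq [1, 0,
        -1] * (fps_X * fps_deriv A_fps)))"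
    using has_fps_expansion_cong[OF ev0 refl] by blast
  from fps_expansion_unique_complex[OF this has_fps_expansion_0] show ?thesis
    by (simp add: theta_def)
qed

abbreviation normalizer :: complex where "normalizer \<equiv> of_real (sqrt 2 * pi\<^sup>2)"

lemma normalizer_nonzero: "normalizer \<noteq> 0"
  by (simp del: of_real_mult of_real_power)

lemma A_bar_eq: "A_bar = fps_const (inverse normalizer) * even_part A_fps"
proof -
  have "(\<lambda>z. A z * inverse normalizer) has_fps_expansion A_fps * fps_const (inverse normalizer)"
    by (intro fps_expansion_intros A_expansion)
  then have "fps_expansion (\<lambda>z. A z / normalizer) 0 = A_fps * fps_const (inverse normalizer)"
    by (intro fps_expansion_eqI) (simp only: divide_inverse)
  then show ?thesis by (simp add: fps_eq_iff A_bar_def a_seq_def mult.commute)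
qed

lemma V_bar_eq: "V_bar = fps_const (inverse normalizer) * even_part V_fps"
proof -
  have "(\<lambda>z. V z * inverse normalizer) has_fps_expansion V_fps * fps_const (inverse normalizer)"
    by (intro fps_expansion_intros V_expansion)
  then have "fps_expansion (\<lambda>z. V z / normalizer) 0 = V_fps * fps_const (inverse normalizer)"
    by (intro fps_expansion_eqI) (simp only: divide_inverse)
  then show ?thesis by (simp add: fps_eq_iff V_bar_def v_seq_def mult.commute)
qed

lemma theta_fps_const_mult: "theta (fps_const c * F) = fps_const c * theta F"
  by (simp add: theta_def algebra_simps)

lemma theta_2_mult: "theta (2 * F) = 2 * theta F"
  by (simp add: theta_def)

lemma A_bar_ode: "fps_ints ode0 * A_bar + fps_ints ode1 * theta A_bar + fps_ints ode2 * theta (theta A_bar) = 0"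
proof -
  define G where "G = even_part A_fps"
  have num: "(4 :: complex fps) = of_int 4" "(2 :: complex fps) = of_int 2" by simp_all
  have "even_part (4 * fps_ints_sq ode0 * A_fps + 2 * fps_ints_sq ode1 * theta A_fps + fps_ints_sq ode2 * theta
      (theta A_fps)) = 0"
    using A_fps_ode by simp
  then have "4 * (fps_ints ode0 * G) + 2 * (fps_ints ode1 * (2 * theta G)) + fps_ints ode2 * (2 * theta (2 *
      theta G)) = 0"
    unfolding even_part_add mult.assoc num even_part_of_int_mult even_part_fps_ints_sq_mult even_part_theta G_def .
  then have E4: "4 * (fps_ints ode0 * G + fps_ints ode1 * theta G + fps_ints ode2 * theta (theta G)) = 0"
    unfolding theta_2_mult by (simp add: algebra_simps)
  define E where "E = fps_ints ode0 * G + fps_ints ode1 * theta G + fps_ints ode2 * theta (theta G)"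
  have "4 * E = 0" using E4 unfolding E_def .
  then have "E = 0" by simp
  then have "fps_const (inverse normalizer) * E = 0" by simp
  then show ?thesis
    unfolding A_bar_eq G_def[symmetric] theta_fps_const_mult E_def distrib_left
    by (simp only: mult.left_commute[of "fps_const (inverse normalizer)"])
qed

lemma V_bar_relation:
  "fps_ints [6, 18, 18, 6] * V_bar = fps_ints [3, -10, -5] * A_bar + fps_ints [4, 0, -4] * theta A_bar"
proof -
  have num: "(6 :: complex fps) = of_int 6" "(2 :: complex fps) = of_int 2" by simp_all
  have "even_part (6 * fps_ints_sq [1, 3, 3, 1] * V_fps) = even_part (fps_ints_sq [3, -10, -5] * A_fps + 2 *
      fps_ints_sq [1, 0, -1] * theta A_fps)"
    using V_fps_relation by simp
  then have "6 * (fps_ints [1, 3, 3, 1] * even_part V_fps) =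
      fps_ints [3, -10, -5] * even_part A_fps + 4 * fps_ints [1, 0, -1] * theta (even_part A_fps)"
    unfolding even_part_add mult.assoc num even_part_of_int_mult
    by (simp add: even_part_fps_ints_sq_mult even_part_theta del: fps_ints.simps fps_ints_sq.simps)
  moreover have "fps_ints [6, 18, 18, 6] = 6 * fps_ints [1, 3, 3, 1]" "fps_ints [4, 0, -4] = 4 * fps_ints [1, 0, -1]"
    by (simp_all add: algebra_simps)
  ultimately have "fps_ints [6, 18, 18, 6] * even_part V_fps = fps_ints [3, -10, -5] * even_part A_fps +
      fps_ints [4, 0, -4] * theta (even_part A_fps)"
    by (simp del: fps_ints.simps add: mult.assoc)
  then have "fps_const (inverse normalizer) * (fps_ints [6, 18, 18, 6] * even_part V_fps) =
     fps_const (inverse normalizer) * (fps_ints [3, -10, -5] * even_part A_fps + fps_ints [4, 0, -4] * theta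
         (even_part A_fps))"
    by simp
  then show ?thesis unfolding A_bar_eq V_bar_eq theta_fps_const_mult by (simp only: algebra_simps)
qed

text \<open>At z = 0 only the surface element remains, and its integral is the area of the
  torus.\<close>

lemma A_0: "A 0 = 4 * normalizer"
proof -
  have "((\<lambda>v. 2 * of_real pi * (root2 + sin (of_real v))) has_integral
      2 * of_real pi * (root2 * of_real (2 * pi) - cos (of_real (2 * pi))) -
      2 * of_real pi * (root2 * of_real 0 - cos (of_real 0))) period"
    by (rule fundamental_theorem_of_calculus)
      (auto intro!: derivative_eq_intros has_vector_derivative_real_field[where f = "\<lambda>v. 2 * of_real pi
          * (root2 * v - cos v)"])
  then have I: "integral period (\<lambda>v. 2 * of_real pi * (root2 + sin (of_real v))) = 4 * normalizer"
    unfolding cos_of_real by (simp add: integral_unique power2_eq_square algebra_simps)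
  have "A 0 = integral period (\<lambda>v. integral period (\<lambda>u. complex_of_real (sqrt 2 + sin v)))"
    by (simp add: A_def Q_def)
  also have "\<dots> = integral period (\<lambda>v. 2 * of_real pi * (root2 + sin (of_real v)))"
    by (simp add: scaleR_conv_of_real sin_of_real)
  finally show ?thesis using I by simp
qed

lemma A_bar_0: "fps_nth A_bar 0 = 4"
proof -
  have "fps_nth A_fps 0 = 4 * normalizer"
    using has_fps_expansion_imp_0_eq_fps_nth_0[OF A_expansion] A_0 by simp
  then show ?thesis using normalizer_nonzero
    by (simp add: A_bar_eq field_simps del: of_real_mult of_real_power)
qed

section \<open>The three recurrences\<close>

text \<open>The coefficients of the recurrences as integers, those of \<open>(d\<^sub>n)\<close> multiplied by
    the common denominator 12232.\<close>

definition p_ints :: "int list list" where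
  "p_ints = [
    [-84, -136, -81, -21, -2],
    [399, 730, 484, 137, 14],
    [-474, -835, -529, -143, -14],
    [54, 99, 66, 19, 2]]"

definition q_ints :: "int list list" where
  "q_ints = [
    [-252, -303, -136, -27, -2],
    [960, 1384, 730, 167, 14],
    [-1008, -1436, -748, -169, -14],
    [90, 141, 82, 21, 2]]"

definition r_ints :: "int list list" where
  "r_ints = [
    [-13041659232, -12704294700, -5284701480, -1216898711, -167529251, -13789578, -628408, -12232],
    [145756088208, 149564708370, 65315724828, 15735207287, 2258693435, 193221622, 9123400, 183480],
    [-647595717744, -677411701022, -301814933466, -74228837833, -10882115811, -950915746, -45861816, -941864],
    [1390493835900, 1451619424860, 645518710454, 158457515673, 23184921987, 2021855198, 97303624, 1993816],
    [-1472211879228, -1524577250976, -672459054524, -163720428321, -23758375953, -2054897438, -98090344, -1993816],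
    [709311266388, 732023855346, 321841622840, 78121412337, 11304865929, 975235426, 46440856, 941864],
    [-119236161300, -125550276502, -56351691266, -13970430847, -2065443305, -182059702, -8857640, -183480],
    [6546653568, 7041743904, 3234766134, 822460415, 124982969, 11350218, 570328, 12232]]"

lemma sum_atMost_3: "(\<Sum>i\<le>3. f i) = f 0 + f 1 + f 2 + (f 3 :: complex)" for f :: "nat \<Rightarrow> complex"
  by (simp add: eval_nat_numeral)

lemma sum_atMost_numeral:
  "(\<Sum>k\<le>numeral v. f k) = (\<Sum>k\<le>pred_numeral v. f k) + (f (numeral v) :: complex)" for f :: "nat
      \<Rightarrow> complex"
  by (simp add: numeral_eq_Suc)

lemma le_3_cases: "i \<le> 3 \<Longrightarrow> i = 0 \<or> i = 1 \<or> i = 2 \<or> i = (3::nat)"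
  by auto

lemma le_7_cases: "i \<le> 7 \<Longrightarrow> i = 0 \<or> i = 1 \<or> i = 2 \<or> i = 3 \<or> i = 4 \<or> i =
    5 \<or> i = 6 \<or> i = (7::nat)"
  by auto

lemma poly_p_coeffs: "i \<le> 3 \<Longrightarrow> poly (p_coeffs ! i) (of_nat n) = of_int (horner (p_ints ! i)
    (int n))"
  by (drule le_3_cases) (auto simp: p_coeffs_def p_ints_def)

lemma poly_q_coeffs: "i \<le> 3 \<Longrightarrow> poly (q_coeffs ! i) (of_nat n) = of_int (horner (q_ints ! i)
    (int n))"
  by (drule le_3_cases) (auto simp: q_coeffs_def q_ints_def)

lemma poly_r_coeffs: "i \<le> 7 \<Longrightarrow> 12232 * poly (r_coeffs ! i) (of_nat n) = of_int (horner
    (r_ints ! i) (int n))"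
  by (drule le_7_cases) (auto simp: r_coeffs_def r_ints_def algebra_simps)

lemma fps_ints_nonzero: "list_ex (\<lambda>a. a \<noteq> 0) l \<Longrightarrow> fps_ints l \<noteq> 0"
proof (induction l)
  case (Cons a l)
  show ?case
  proof
    assume 0: "fps_ints (a # l) = 0"
    then have "fps_nth (fps_ints (a # l)) 0 = 0" by simp
    then have "a = 0" by (simp flip: fps_of_int)
    with 0 Cons show False by simp
  qed
qed simp

lemma fps_ints_eqI: "list_all (\<lambda>a. a = 0) (padd p (map ((*) (-1)) q)) \<Longrightarrow> fps_ints p =
    fps_ints q"
  using fps_ints_eq_0[of "padd p (map ((*) (-1)) q)"] by (simp add: fps_ints_padd fps_ints_smult)

text \<open>The companion matrix of \<open>A_bar_ode\<close>, cleared of denominators.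
  \<open>conn_square\<close> is its symmetric square, acting on the products in which
  \<open>D_bar\<close> is expressed.\<close>

definition conn :: "int list list list" where
  "conn = [[[], ode2], [map ((*) (-1)) ode0, map ((*) (-1)) ode1]]"

definition conn_square :: "int list list list" where
  "conn_square = [[[], map ((*) 2) ode2, []], [map ((*) (-1)) ode0, map ((*) (-1)) ode1, ode2],
     [[], map ((*) (-2)) ode0, map ((*) (-2)) ode1]]"

lemma theta_theta_A_bar: "fps_ints ode2 * theta (theta A_bar) = - fps_ints ode0 * A_bar - fps_ints ode1 * theta A_bar"
  using A_bar_ode by (simp add: algebra_simps eq_neg_iff_add_eq_0)

lemma conn: "list_all2 (\<lambda>t c. fps_ints ode2 * theta t = vdot c [A_bar, theta A_bar]) [A_bar, theta
    A_bar] conn"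
  by (simp add: conn_def fps_ints_smult theta_theta_A_bar)

lemma conn_square: "list_all2 (\<lambda>t c. fps_ints ode2 * theta t = vdot c [A_bar * A_bar, A_bar * theta
    A_bar, theta A_bar * theta A_bar])
    [A_bar * A_bar, A_bar * theta A_bar, theta A_bar * theta A_bar] conn_square"
proof -
  have "fps_ints ode2 * theta (A_bar * theta A_bar) = fps_ints ode2 * theta A_bar * theta A_bar + A_bar *
      (fps_ints ode2 * theta (theta A_bar))"
    "fps_ints ode2 * theta (theta A_bar * theta A_bar) = 2 * theta A_bar * (fps_ints ode2 * theta (theta A_bar))"
    by (simp_all add: theta_mult algebra_simps)
  then show ?thesis
    unfolding theta_theta_A_bar by (simp add: conn_square_def fps_ints_smult theta_mult algebra_simps)
qed

lemma ode2_nonzero: "fps_ints ode2 \<noteq> 0"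
  by (rule fps_ints_nonzero) (simp add: ode2_def)

lemma A_bar_recurrence: "(\<Sum>i\<le>3. of_int (horner (p_ints ! i) (int n)) * fps_nth A_bar (n + i)) = 0"
\<comment> \<open>Coefficients of degree 4 in n need the powers 0 to 4 of \<open>theta\<close>,
  hence \<open>D = 5\<close>; \<open>g\<close> is the first basis vector, that is,
  \<open>A_bar\<close> itself.\<close>
proof (rule annihilated_recurrence[OF conn, where M = 1 and \<nu> = "[]" and g = "[[1], []]" and D = 5])
  show "annihilated ode2 conn [] 0 [[1], []] (theta_form 5 p_ints) []" by code_simp
  show "length p_ints = Suc 3" "list_all (\<lambda>c. length c \<le> 5) (shifted 0 p_ints)" by code_simp+
qed (simp_all add: ode2_nonzero theta_of_int[of 1, simplified])

text \<open>This is 6 (1 + X)^3. Since 1 + X divides \<open>ode2\<close>, the product of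
  \<open>ode2\<close> with the logarithmic theta-derivative of \<open>muV\<close> is a polynomial,
  namely \<open>nuV\<close>.\<close>

definition muV :: "int list" where "muV = [6, 18, 18, 6]"
definition nuV :: "int list" where "nuV = [0, -3, 18, 0, -18, 3]"
definition gV :: "int list list" where "gV = [[3, -10, -5], [4, 0, -4]]"

lemma V_bar_module: "fps_ints muV * V_bar = vdot gV [A_bar, theta A_bar]"
  using V_bar_relation by (simp add: muV_def gV_def del: fps_ints.simps)

lemma fps_ints_log_deriv:
  assumes "list_all (\<lambda>a. a = 0) (padd (pmul \<delta> (ptheta 0 \<mu>)) (map ((*) (-1)) (pmul \<nu> \<mu>)))"
  shows "fps_ints \<delta> * theta (fps_ints \<mu>) = fps_ints \<nu> * fps_ints \<mu>"
  using fps_ints_eqI[OF assms] by (simp add: fps_ints_pmul fps_ints_ptheta)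

lemma log_deriv_muV: "fps_ints ode2 * theta (fps_ints muV) = fps_ints nuV * fps_ints muV"
  by (rule fps_ints_log_deriv) code_simp

lemma V_bar_recurrence: "(\<Sum>i\<le>3. of_int (horner (q_ints ! i) (int n)) * fps_nth V_bar (n + i)) = 0"
proof (rule annihilated_recurrence[OF conn log_deriv_muV V_bar_module, where D = 5])
  show "annihilated ode2 conn nuV 0 gV (theta_form 5 q_ints) []" by code_simp
  show "length q_ints = Suc 3" "list_all (\<lambda>c. length c \<le> 5) (shifted 0 q_ints)" by code_simp+
qed (simp_all add: ode2_nonzero fps_ints_nonzero muV_def del: fps_ints.simps)

definition D_bar :: "complex fps" where
  "D_bar = 2 * fps_deriv V_bar * A_bar - 3 * V_bar * fps_deriv A_bar"

text \<open>This is 2 X (1 + X)^3 (1 - 6 X + X^2), which remains of \<open>X ode2 muV\<close> after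
  cancelling 3 (X - 1)(X + 1)^2. The cancellation keeps the later reduction of seven
  \<open>theta\<close>-steps small.\<close>

definition muD :: "int list" where "muD = [0, 2, -6, -28, -28, -6, 2]"
definition nuD :: "int list" where "nuD = [-1, 8, 28, -14, -27, 6]"
definition gD :: "int list list" where
  "gD = [[0, 22, -54, 2, 14], [-1, 60, -54, -36, 15], [-4, 24, 0, -24, 4]]"

lemma log_deriv_muD: "fps_ints ode2 * theta (fps_ints muD) = fps_ints nuD * fps_ints muD"
  by (rule fps_ints_log_deriv) code_simp

lemma D_bar_module:
  "fps_ints muD * D_bar = vdot gD [A_bar * A_bar, A_bar * theta A_bar, theta A_bar * theta A_bar]"
proof -
  define x :: "int list" where "x = [-3, -3, 3, 3]" \<comment> \<open>the common factor of \<open>X \<delta>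
      muV\<close> and the vector representing \<open>X \<delta> muV D_bar\<close>\<close>
  define W where "W = vstep ode2 conn nuV 0 gV"
  have "length W = 2" unfolding W_def by code_simp
  then obtain w0 w1 where W: "W = [w0, w1]"
    by (metis (no_types) One_nat_def Suc_1 length_0_conv length_Suc_conv)
  have V1: "fps_ints ode2 * fps_ints muV * theta V_bar = fps_ints w0 * A_bar + fps_ints w1 * theta A_bar"
    using vstep_correct[OF conn log_deriv_muV, of 0 V_bar gV] V_bar_module W by (simp add: W_def)
  have V0: "fps_ints muV * V_bar = fps_ints (gV ! 0) * A_bar + fps_ints (gV ! 1) * theta A_bar"
    using V_bar_module by (simp add: gV_def del: fps_ints.simps)
  \<comment> \<open>The factor \<open>fps_X\<close> turns both ordinary derivatives into
    \<open>theta\<close>; \<open>V0\<close> and \<open>V1\<close> then express everything by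
    \<open>A_bar\<close> and \<open>theta A_bar\<close>.\<close>
  have XD: "fps_X * D_bar = 2 * theta V_bar * A_bar - 3 * V_bar * theta A_bar"
    by (simp add: D_bar_def theta_def algebra_simps)
  have "fps_ints [0, 1] * (fps_ints ode2 * fps_ints muV) * D_bar = (fps_ints ode2 * fps_ints muV) * (fps_X * D_bar)"
    by (simp add: algebra_simps)
  also have "\<dots> = 2 * (fps_ints ode2 * fps_ints muV * theta V_bar) * A_bar - 3 * fps_ints ode2 * (fps_ints
      muV * V_bar) * theta A_bar"
    unfolding XD by (simp add: algebra_simps)
  also have "\<dots> = fps_ints (map ((*) 2) w0) * (A_bar * A_bar) +
      (fps_ints (padd (map ((*) 2) w1) (map ((*) (-3)) (pmul ode2 (gV ! 0)))) * (A_bar * theta A_bar) +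
       fps_ints (map ((*) (-3)) (pmul ode2 (gV ! 1))) * (theta A_bar * theta A_bar))"
    unfolding V0 V1 by (simp add: fps_ints_smult fps_ints_padd fps_ints_pmul algebra_simps)
  also have "fps_ints (map ((*) 2) w0) = fps_ints (pmul x (gD ! 0))"
  proof -
    have "list_all (\<lambda>a. a = 0) (padd (map ((*) 2) (vstep ode2 conn nuV 0 gV ! 0)) (map ((*) (-1)) (pmul
        [-3, -3, 3, 3] (gD ! 0))))"
      by code_simp
    then show ?thesis using W by (intro fps_ints_eqI) (simp add: W_def x_def)
  qed
  also have "fps_ints (padd (map ((*) 2) w1) (map ((*) (-3)) (pmul ode2 (gV ! 0)))) = fps_ints (pmul x (gD ! 1))"
  proof -
    have "list_all (\<lambda>a. a = 0) (padd (padd (map ((*) 2) (vstep ode2 conn nuV 0 gV ! 1)) (map ((*) (-3))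
        (pmul ode2 (gV ! 0))))
       (map ((*) (-1)) (pmul [-3, -3, 3, 3] (gD ! 1))))"
      by code_simp
    then show ?thesis using W by (intro fps_ints_eqI) (simp add: W_def x_def)
  qed
  also have "fps_ints (map ((*) (-3)) (pmul ode2 (gV ! 1))) = fps_ints (pmul x (gD ! 2))"
    unfolding x_def by (rule fps_ints_eqI) code_simp
  also have "fps_ints [0, 1] * (fps_ints ode2 * fps_ints muV) = fps_ints x * fps_ints muD"
    unfolding fps_ints_pmul[symmetric] x_def by (rule fps_ints_eqI) code_simp
  finally have "fps_ints x * (fps_ints muD * D_bar) = fps_ints x *
      vdot gD [A_bar * A_bar, A_bar * theta A_bar, theta A_bar * theta A_bar]"
    by (simp add: fps_ints_pmul gD_def algebra_simps del: fps_ints.simps)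
  moreover have "fps_ints x \<noteq> 0" unfolding x_def by (rule fps_ints_nonzero) simp
  ultimately show ?thesis by simp
qed

lemma D_bar_recurrence: "(\<Sum>i\<le>7. of_int (horner (r_ints ! i) (int n)) * fps_nth D_bar (n + i)) = 0"
proof (rule annihilated_recurrence[OF conn_square log_deriv_muD D_bar_module, where D = 8])
  show "annihilated ode2 conn_square nuD 0 gD (theta_form 8 r_ints) []" by code_simp
  show "length r_ints = Suc 7" "list_all (\<lambda>c. length c \<le> 8) (shifted 0 r_ints)" by code_simp+
qed (simp_all add: ode2_nonzero fps_ints_nonzero muD_def del: fps_ints.simps)

section \<open>Initial values of the three sequences\<close>

lemma nth_fps_ints: "fps_nth (fps_ints l) m = of_int (nth_default 0 l m)"
  by (induction l arbitrary: m) (auto simp: nth_default_Cons fps_X_mult_nth split: nat.splits simp flip: fps_of_int)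

lemma nth_fps_ints_mult_sum: "fps_nth (fps_ints l * G) N = (\<Sum>m\<le>N. of_int (nth_default 0 l m) * fps_nth
    G (N - m))"
  by (simp add: fps_mult_nth nth_fps_ints atLeast0AtMost)

lemma nth_theta: "fps_nth (theta F) n = of_nat n * fps_nth F n"
  by (cases n) (simp_all add: theta_def)

text \<open>\<open>ode2\<close> has constant term -1 while \<open>ode0\<close> and
  \<open>ode1\<close> have none, so the coefficient of X^N in \<open>A_bar_ode\<close> is - N^2 a_N
  plus earlier terms. The value a_0 therefore determines the whole series.\<close>

lemma A_bar_initial: "fps_nth A_bar 1 = 52" "fps_nth A_bar 2 = 477"
proof -
  have eq: "fps_nth (fps_ints ode0 * A_bar + fps_ints ode1 * theta A_bar + fps_ints ode2 * theta (theta A_bar))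
      N = 0" for N
    by (simp add: A_bar_ode)
  show 1: "fps_nth A_bar 1 = 52"
    using eq[of 1] by (simp add: nth_fps_ints nth_fps_ints_mult_sum nth_theta ode0_def ode1_def ode2_def
        nth_default_def A_bar_0 del: fps_ints.simps)
  show "fps_nth A_bar 2 = 477"
    using eq[of 2] 1 by (simp add: nth_fps_ints nth_fps_ints_mult_sum nth_theta ode0_def ode1_def ode2_def
        nth_default_def A_bar_0 sum_atMost_numeral del: fps_ints.simps)
qed

text \<open>Index 7 is reached because d_6, the last initial value for the recurrence of order 7,
  involves a_7 and v_7.\<close>

lemma A_bar_values:
  shows "fps_nth A_bar 0 = 4"
    "fps_nth A_bar 1 = 52"
    "fps_nth A_bar 2 = 477"
    "fps_nth A_bar 3 = 3809"
    "fps_nth A_bar 4 = 451625 / 16"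
    "fps_nth A_bar 5 = 3195333 / 16"
    "fps_nth A_bar 6 = 87634981 / 64"
    "fps_nth A_bar 7 = 587401081 / 64"
proof -
  note rec = A_bar_recurrence[unfolded sum_atMost_3]
  show a0: "fps_nth A_bar 0 = 4" by (rule A_bar_0)
  show a1: "fps_nth A_bar 1 = 52" and a2: "fps_nth A_bar 2 = 477" by (rule A_bar_initial)+
  show a3: "fps_nth A_bar 3 = 3809"
    using rec[of 0] a0 a1 a2 a2[unfolded numeral_2_eq_2] by (simp add: p_ints_def field_simps del: add_2_eq_Suc')
  show a4: "fps_nth A_bar 4 = 451625 / 16"
    using rec[of 1] a1 a2 a3 a2[unfolded numeral_2_eq_2] by (simp add: p_ints_def field_simps del: add_2_eq_Suc')
  show a5: "fps_nth A_bar 5 = 3195333 / 16"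
    using rec[of 2] a2 a3 a4 a2[unfolded numeral_2_eq_2] by (simp add: p_ints_def field_simps del: add_2_eq_Suc')
  show a6: "fps_nth A_bar 6 = 87634981 / 64"
    using rec[of 3] a3 a4 a5 a2[unfolded numeral_2_eq_2] by (simp add: p_ints_def field_simps del: add_2_eq_Suc')
  show a7: "fps_nth A_bar 7 = 587401081 / 64"
    using rec[of 4] a4 a5 a6 a2[unfolded numeral_2_eq_2] by (simp add: p_ints_def field_simps del: add_2_eq_Suc')
qed

lemma V_bar_values:
  shows "fps_nth V_bar 0 = 2"
    "fps_nth V_bar 1 = 48"
    "fps_nth V_bar 2 = 1269 / 2"
    "fps_nth V_bar 3 = 6600"
    "fps_nth V_bar 4 = 1928025 / 32"
    "fps_nth V_bar 5 = 2026101 / 4"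
    "fps_nth V_bar 6 = 514978093 / 128"
    "fps_nth V_bar 7 = 122625981 / 4"
proof -
  note rec = V_bar_recurrence[unfolded sum_atMost_3]
  have eq: "fps_nth (fps_ints [6, 18, 18, 6] * V_bar) N = fps_nth (fps_ints [3, -10, -5] * A_bar + fps_ints [4,
      0, -4] * theta A_bar) N" for N
    by (simp only: V_bar_relation)
  show v0: "fps_nth V_bar 0 = 2"
    using eq[of 0] by (simp add: nth_fps_ints nth_fps_ints_mult_sum nth_theta nth_default_def A_bar_values del:
        fps_ints.simps)
  show v1: "fps_nth V_bar 1 = 48"
    using eq[of 1] v0 by (simp add: nth_fps_ints nth_fps_ints_mult_sum nth_theta nth_default_def
        A_bar_values[unfolded One_nat_def] del: fps_ints.simps)
  have "2 * fps_nth V_bar 2 = 1269"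
    using eq[of 2] v0 v1
    by (simp add: nth_fps_ints nth_fps_ints_mult_sum nth_theta nth_default_def A_bar_values
        A_bar_values[unfolded One_nat_def] sum_atMost_numeral del: fps_ints.simps)
  then show v2: "fps_nth V_bar 2 = 1269 / 2" by (simp add: field_simps)
  show v3: "fps_nth V_bar 3 = 6600"
    using rec[of 0] v0 v1 v2 v2[unfolded numeral_2_eq_2] by (simp add: q_ints_def field_simps del: add_2_eq_Suc')
  show v4: "fps_nth V_bar 4 = 1928025 / 32"
    using rec[of 1] v1 v2 v3 v2[unfolded numeral_2_eq_2] by (simp add: q_ints_def field_simps del: add_2_eq_Suc')
  show v5: "fps_nth V_bar 5 = 2026101 / 4"
    using rec[of 2] v2 v3 v4 v2[unfolded numeral_2_eq_2] by (simp add: q_ints_def field_simps del: add_2_eq_Suc')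
  show v6: "fps_nth V_bar 6 = 514978093 / 128"
    using rec[of 3] v3 v4 v5 v2[unfolded numeral_2_eq_2] by (simp add: q_ints_def field_simps del: add_2_eq_Suc')
  show v7: "fps_nth V_bar 7 = 122625981 / 4"
    using rec[of 4] v4 v5 v6 v2[unfolded numeral_2_eq_2] by (simp add: q_ints_def field_simps del: add_2_eq_Suc')
qed

lemma D_bar_nth: "fps_nth D_bar n = (\<Sum>k\<le>n. 2 * of_nat (k + 1) * fps_nth V_bar (k + 1) * fps_nth A_bar
    (n - k) -
    3 * fps_nth V_bar k * (of_nat (n - k + 1) * fps_nth A_bar (n - k + 1)))"
proof -
  have num: "fps_nth (2 * F) k = 2 * fps_nth F k" "fps_nth (3 * F) k = 3 * fps_nth F k" for F :: "complex fps" and k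
    by (simp_all add: fps_numeral_fps_const)
  show ?thesis
    unfolding D_bar_def mult.assoc fps_sub_nth num
    unfolding fps_mult_nth fps_deriv_nth atLeast0AtMost
    by (simp add: sum_subtractf sum_distrib_left mult.assoc)
qed

lemma D_bar_values:
  shows "fps_nth D_bar 0 = 72"
    "fps_nth D_bar 1 = 1932"
    "fps_nth D_bar 2 = 31248"
    "fps_nth D_bar 3 = 790101 / 2"
    "fps_nth D_bar 4 = 17208645 / 4"
    "fps_nth D_bar 5 = 338898609 / 8"
    "fps_nth D_bar 6 = 1551478257 / 4"
  unfolding D_bar_nth by (simp_all add: sum_atMost_numeral A_bar_values V_bar_values
    A_bar_values(2)[unfolded One_nat_def] V_bar_values(2)[unfolded One_nat_def]
    A_bar_values(3)[unfolded numeral_2_eq_2] V_bar_values(3)[unfolded numeral_2_eq_2])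

section \<open>Initial residues and uniqueness of the three recurrences\<close>

lemma local_resI:
  assumes "u * K mod p = 1" "of_int K * x = of_int D" "[D = K * e] (mod p)"
  shows "local_res p x e"
proof -
  have "[K * u = 1] (mod p)"
    using assms(1) by (metis cong_def mod_mod_trivial mult.commute)
  then have "coprime K p" by (rule coprime_iff_invertible_int[THEN iffD2, OF exI])
  with assms show ?thesis unfolding local_res_def by blast
qed

lemma dot_map_upt: "dot (map f cs) (map s [n..<n + length cs]) = (\<Sum>i<length cs. f (cs ! i) * s (n + i))"
proof -
  have "map f cs = map (\<lambda>i. f (cs ! i)) [0..<length cs]" "map s [n..<n + length cs] = map (\<lambda>i.
      s (n + i)) [0..<length cs]"
    by (auto intro: nth_equalityI)
  then show ?thesis
    by (simp only: dot_map interv_sum_list_conv_sum_set_nat) (simp add: atLeast0LessThan)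
qed

lemma P_recurrence_unique_residues:
  fixes s :: "nat \<Rightarrow> complex"
  assumes rec: "\<And>n. (\<Sum>i\<le>r. of_int (horner (cs ! i) (int n)) * s (n + i)) = 0"
    and len: "length cs = Suc r" "r > 0"
    and init: "list_all2 (local_res p) (map s [0..<r]) w"
    and units: "units p (cs ! r) 0 T"
    and det: "only_trivial p T (initial_state r d T (residues p (take r cs) (cs ! r) 0 T w))"
    and "p > 1" "d > 0" "P_recurrence r d c0 s" "coeff (c0 0) d \<noteq> 0" "P_recurrence r d c s"
  shows "\<exists>k. k \<noteq> 0 \<and> (\<forall>i\<le>r. c i = smult k (c0 i))"
proof (rule P_recurrence_unique[OF assms(9,10) _ assms(8) det assms(7,11)])
  have l: "length (take r cs) = r" using len by simp
  have "list_all2 (local_res p) (map s [0..<0 + length (take r cs) + T]) (residues p (take r cs) (cs ! r) (int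
      0) T w)"
  proof (rule residues_correct)
    fix n
    show "dot (map (\<lambda>c. of_int (horner c (int n))) (take r cs)) (map s [n..<n + length (take r cs)]) +
      of_int (horner (cs ! r) (int n)) * s (n + length (take r cs)) = 0"
      using rec[of n] unfolding dot_map_upt[of _ "take r cs" s n] unfolding l
      by (simp add: lessThan_Suc_atMost[symmetric])
  qed (use assms l in auto)
  from this[unfolded l] show "list_all2 (local_res p) (map s [0..<r + T]) (residues p (take r cs) (cs ! r) 0 T w)"
    by simp
qed

lemma A_bar_initial_residues:
  "list_all2 (local_res 43) (map (fps_nth A_bar) [0..<3]) [4, 9, 4]"
proof -
  have r0: "local_res 43 (fps_nth A_bar 0) 4"
    unfolding A_bar_values by (rule local_resI[of 1 1 _ _ 4]) (simp_all add: cong_def)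
  have r1: "local_res 43 (fps_nth A_bar 1) 9"
    unfolding A_bar_values by (rule local_resI[of 1 1 _ _ 52]) (simp_all add: cong_def)
  have r2: "local_res 43 (fps_nth A_bar 2) 4"
    unfolding A_bar_values by (rule local_resI[of 1 1 _ _ 477]) (simp_all add: cong_def)
  have "[0..<3] = [0, 1, 2]" by (simp add: upt_rec)
  then show ?thesis using r0 r1 r2 by simp
qed

lemma V_bar_initial_residues:
  "list_all2 (local_res 43) (map (fps_nth V_bar) [0..<3]) [2, 5, 11]"
proof -
  have r0: "local_res 43 (fps_nth V_bar 0) 2"
    unfolding V_bar_values by (rule local_resI[of 1 1 _ _ 2]) (simp_all add: cong_def)
  have r1: "local_res 43 (fps_nth V_bar 1) 5"
    unfolding V_bar_values by (rule local_resI[of 1 1 _ _ 48]) (simp_all add: cong_def)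
  have r2: "local_res 43 (fps_nth V_bar 2) 11"
    \<comment> \<open>22 inverts the denominator 2 modulo 43, and 1269 is congruent to 2 *
      11.\<close>
    unfolding V_bar_values by (rule local_resI[of 22 2 _ _ 1269]) (simp_all add: cong_def)
  have "[0..<3] = [0, 1, 2]" by (simp add: upt_rec)
  then show ?thesis using r0 r1 r2 by simp
qed

lemma D_bar_initial_residues:
  "list_all2 (local_res 79) (map (fps_nth D_bar) [0..<7]) [72, 36, 43, 11, 78, 8, 45]"
proof -
  have r0: "local_res 79 (fps_nth D_bar 0) 72"
    unfolding D_bar_values by (rule local_resI[of 1 1 _ _ 72]) (simp_all add: cong_def)
  have r1: "local_res 79 (fps_nth D_bar 1) 36"
    unfolding D_bar_values by (rule local_resI[of 1 1 _ _ 1932]) (simp_all add: cong_def)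
  have r2: "local_res 79 (fps_nth D_bar 2) 43"
    unfolding D_bar_values by (rule local_resI[of 1 1 _ _ 31248]) (simp_all add: cong_def)
  have r3: "local_res 79 (fps_nth D_bar 3) 11"
    unfolding D_bar_values by (rule local_resI[of 40 2 _ _ 790101]) (simp_all add: cong_def)
  have r4: "local_res 79 (fps_nth D_bar 4) 78"
    unfolding D_bar_values by (rule local_resI[of 20 4 _ _ 17208645]) (simp_all add: cong_def)
  have r5: "local_res 79 (fps_nth D_bar 5) 8"
    unfolding D_bar_values by (rule local_resI[of 10 8 _ _ 338898609]) (simp_all add: cong_def)
  have r6: "local_res 79 (fps_nth D_bar 6) 45"
    unfolding D_bar_values by (rule local_resI[of 20 4 _ _ 1551478257]) (simp_all add: cong_def)
  have "[0..<7] = [0, 1, 2, 3, 4, 5, 6]" by (simp add: upt_rec)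
  then show ?thesis using r0 r1 r2 r3 r4 r5 r6 by simp
qed

text \<open>The primes 43 and 79 are such that all leading coefficients and all pivots of the elimination are
    units.\<close>

lemma A_bar_unique:
  assumes "P_recurrence 3 4 c0 (fps_nth A_bar)" "coeff (c0 0) 4 \<noteq> 0" "P_recurrence 3 4 c (fps_nth A_bar)"
  shows "\<exists>k. k \<noteq> 0 \<and> (\<forall>i\<le>3. c i = smult k (c0 i))"
proof (rule P_recurrence_unique_residues[OF A_bar_recurrence _ _ A_bar_initial_residues _ _ _ _ assms, where T = 19])
  \<comment> \<open>The leading coefficient is (n + 2)(n + 3)^2 (2 n + 3), whose factors are at most
    39 for n < 19.\<close>
  show "units 43 (p_ints ! 3) 0 19" by code_simp
  show "only_trivial 43 19 (initial_state 3 4 19 (residues 43 (take 3 p_ints) (p_ints ! 3) 0 19 [4, 9, 4]))"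
    by code_simp
qed (simp_all add: p_ints_def)

lemma V_bar_unique:
  assumes "P_recurrence 3 4 c0 (fps_nth V_bar)" "coeff (c0 0) 4 \<noteq> 0" "P_recurrence 3 4 c (fps_nth V_bar)"
  shows "\<exists>k. k \<noteq> 0 \<and> (\<forall>i\<le>3. c i = smult k (c0 i))"
proof (rule P_recurrence_unique_residues[OF V_bar_recurrence _ _ V_bar_initial_residues _ _ _ _ assms, where T = 19])
  \<comment> \<open>The leading coefficient is (n + 2)(n + 3)^2 (2 n + 5), whose factors are at most
    41 for n < 19; 43 is the next prime.\<close>
  show "units 43 (q_ints ! 3) 0 19" by code_simp
  show "only_trivial 43 19 (initial_state 3 4 19 (residues 43 (take 3 q_ints) (q_ints ! 3) 0 19 [2, 5, 11]))"
    by code_simp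
qed (simp_all add: q_ints_def)

lemma D_bar_unique:
  assumes "P_recurrence 7 7 c0 (fps_nth D_bar)" "coeff (c0 0) 7 \<noteq> 0" "P_recurrence 7 7 c (fps_nth D_bar)"
  shows "\<exists>k. k \<noteq> 0 \<and> (\<forall>i\<le>7. c i = smult k (c0 i))"
proof (rule P_recurrence_unique_residues[OF D_bar_recurrence _ _ D_bar_initial_residues _ _ _ _ assms, where T = 63])
  show "units 79 (r_ints ! 7) 0 63" by code_simp
  show "only_trivial 79 63 (initial_state 7 7 63 (residues 79 (take 7 r_ints) (r_ints ! 7) 0 63 [72, 36, 43,
      11, 78, 8, 45]))"
    by code_simp
qed (simp_all add: r_ints_def)

lemma seq_eq: "a_seq = fps_nth A_bar" "v_seq = fps_nth V_bar" "d_seq = fps_nth D_bar"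
  by (auto simp: A_bar_def V_bar_def D_bar_def d_seq_def)

lemma P_recurrence_A_bar: "P_recurrence 3 4 ((!) p_coeffs) (fps_nth A_bar)"
proof -
  have "\<forall>i\<le>3. degree (p_coeffs ! i) \<le> 4"
    by (auto dest!: le_3_cases simp: p_coeffs_def)
  moreover have "p_coeffs ! 0 \<noteq> 0" by (simp add: p_coeffs_def)
  moreover have "(\<Sum>i\<le>3. poly (p_coeffs ! i) (of_nat n) * fps_nth A_bar (n + i)) = 0" for n
    using A_bar_recurrence[of n] by (simp add: poly_p_coeffs)
  ultimately show ?thesis unfolding P_recurrence_def by blast
qed

lemma P_recurrence_V_bar: "P_recurrence 3 4 ((!) q_coeffs) (fps_nth V_bar)"
proof -
  have "\<forall>i\<le>3. degree (q_coeffs ! i) \<le> 4"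
    by (auto dest!: le_3_cases simp: q_coeffs_def)
  moreover have "q_coeffs ! 0 \<noteq> 0" by (simp add: q_coeffs_def)
  moreover have "(\<Sum>i\<le>3. poly (q_coeffs ! i) (of_nat n) * fps_nth V_bar (n + i)) = 0" for n
    using V_bar_recurrence[of n] by (simp add: poly_q_coeffs)
  ultimately show ?thesis unfolding P_recurrence_def by blast
qed

lemma P_recurrence_D_bar: "P_recurrence 7 7 ((!) r_coeffs) (fps_nth D_bar)"
proof -
  have "\<forall>i\<le>7. degree (r_coeffs ! i) \<le> 7"
    by (auto dest!: le_7_cases simp: r_coeffs_def)
  moreover have "r_coeffs ! 0 \<noteq> 0" by (simp add: r_coeffs_def)
  moreover have "(\<Sum>i\<le>7. poly (r_coeffs ! i) (of_nat n) * fps_nth D_bar (n + i)) = 0" for n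
  proof -
    have "12232 * (\<Sum>i\<le>7. poly (r_coeffs ! i) (of_nat n) * fps_nth D_bar (n + i)) =
      (\<Sum>i\<le>7. of_int (horner (r_ints ! i) (int n)) * fps_nth D_bar (n + i))"
      unfolding sum_distrib_left mult.assoc[symmetric]
      by (intro sum.cong refl arg_cong2[of _ _ _ _ "(*)"] poly_r_coeffs) simp
    then show ?thesis using D_bar_recurrence[of n] by simp
  qed
  ultimately show ?thesis unfolding P_recurrence_def by blast
qed

theorem proposition4p1:
  shows "(\<forall>n. (\<Sum>i\<le>3. poly (p_coeffs ! i) (of_nat n) * a_seq (n + i)) = 0) \<and>
         (\<forall>n. (\<Sum>i\<le>3. poly (q_coeffs ! i) (of_nat n) * v_seq (n + i)) = 0) \<and>
         (\<forall>n. (\<Sum>i\<le>7. poly (r_coeffs ! i) (of_nat n) * d_seq (n + i)) = 0) \<and>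
         P_recurrence 3 4 ((!) p_coeffs) a_seq \<and>
         (\<forall>c. P_recurrence 3 4 c a_seq \<longrightarrow>
            (\<exists>k. k \<noteq> 0 \<and> (\<forall>i\<le>3. c i = smult k (p_coeffs ! i)))) \<and>
         P_recurrence 3 4 ((!) q_coeffs) v_seq \<and>
         (\<forall>c. P_recurrence 3 4 c v_seq \<longrightarrow>
            (\<exists>k. k \<noteq> 0 \<and> (\<forall>i\<le>3. c i = smult k (q_coeffs ! i)))) \<and>
         P_recurrence 7 7 ((!) r_coeffs) d_seq \<and>
         (\<forall>c. P_recurrence 7 7 c d_seq \<longrightarrow>
            (\<exists>k. k \<noteq> 0 \<and> (\<forall>i\<le>7. c i = smult k (r_coeffs ! i))))"
proof -
  have "coeff (p_coeffs ! 0) 4 \<noteq> 0" "coeff (q_coeffs ! 0) 4 \<noteq> 0" "coeff (r_coeffs ! 0) 7 \<noteq> 0"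
    by (simp_all add: p_coeffs_def q_coeffs_def r_coeffs_def coeff_pCons numeral_eq_Suc)
  note unique = A_bar_unique[OF P_recurrence_A_bar this(1)] V_bar_unique[OF P_recurrence_V_bar this(2)]
    D_bar_unique[OF P_recurrence_D_bar this(3)]
  note recs = P_recurrence_A_bar P_recurrence_V_bar P_recurrence_D_bar
  show ?thesis
    unfolding seq_eq
    by (intro conjI allI impI recs unique recs[unfolded P_recurrence_def, THEN conjunct2, THEN conjunct2, THEN spec])
qed

end
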